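(* Let $q$ be a prime power, $A=\mathbb{F}_q[T]$, and let $M^4(1)$ be the coarse moduli scheme over $A$ of Drinfeld $A$-modules of rank $4$, i.e. the affine toric $A$-threefold attached to the cone $\sigma_M\subset\mathbb{R}^3$ (lattice $\mathbb{Z}^3$) spanned by $$e_1=\left(q^3+q^2+q+1,\,-q-1,\,-q^2-q-1\right),\quad e_2=(0,1,0),\quad e_3=(0,0,1).$$ Then the consecutive star subdivisions of $\sigma_M$ centered in the rays spanned by $$(q^2+1,-1,-q)\quad\text{and}\quad(1,0,0)$$ (in this order) define the unique minimal terminal model $M^4_{\mathrm{min}}(1)$ of $M^4(1)$.
   Context: Moduli scheme. A Drinfeld $A$-module of rank $4$ over a field $L$ with a structure morphism $\alpha_L:A\to L$ is given by $T\mapsto \alpha_L(T)+a_1\tau+a_2\tau^2+a_3\tau^3+\Delta\tau^4$ with $\Delta\in L^*$, $\tau$ the $q$-Frobenius. Their coarse moduli scheme $M^4(1)$ is (known fact) the affine toric $A$-scheme $\operatorname{Spec}A[\check\sigma_M\cap(\mathbb{Z}^3)^*]$, where $\check\sigma_M$ is the cone dual to $\sigma_M$. More generally, a fan $\Sigma$ in $\mathbb{R}^3$ (rational with respect to $\mathbb{Z}^3$) defines a toric $A$-scheme, obtained by gluing the schemes $\operatorname{Spec}A[\check\sigma\cap(\mathbb{Z}^3)^*]$ for $\sigma\in\Sigma$. A subdivision of the cone $\sigma_M$ defines a proper birational toric morphism to $M^4(1)$. Star subdivision. The star subdivision of a simplicial fan $\Sigma$ centered in a ray $\rho$ contained in its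 support is the fan obtained by replacing every cone $\sigma\in\Sigma$ containing $\rho$ by the cones $\rho+\tau$, where $\tau$ runs over the faces of $\sigma$ not containing $\rho$. Sheds. For a simplicial cone $\sigma$, let $l_\sigma$ be the linear form taking the value $1$ on the primitive lattice generators of the extremal rays of $\sigma$. The shed of $\sigma$ is the polytope $\sigma\cap l_\sigma^{-1}[0,1]$; its roof is $\sigma\cap l_\sigma^{-1}(1)$. The shed of a fan is the union of the sheds of its cones. Minimal terminal model (in the sense of Mori theory applied to toric geometry, following Reid). A minimal terminal model of $M^4(1)$ is a toric variety given by a simplicial subdivision $\Sigma$ of $\sigma_M$, projective over $M^4(1)$, which has only terminal singularities (i.e. for every $\sigma\in\Sigma$ the only lattice points in the shed of $\sigma$ are the origin and the primitive generators of the extremal rays of $\sigma$), and whose canonical divisor is nef relative to $M^4(1)$ (i.e. for every two adjacent maximal cones $\sigma,\sigma'$ of $\Sigma$ one has $l_\sigma\ge 1$ at the primitive generator of the extremal ray of $\sigma'$ not contained in $\sigma$). *)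

theory Defs
  imports
    "HOL-Analysis.Analysis"
    "HOL-Computational_Algebra.Polynomial"
    "HOL-Computational_Algebra.Fraction_Field"
    "HOL-Number_Theory.Prime_Powers"
begin

section \<open>Cones and fans in \<open>\<real>\<^sup>3\<close> with respect to the lattice \<open>\<int>\<^sup>3\<close>\<close>

definition lattice3 :: "(real ^ 3) set" where
  "lattice3 = {v. \<forall>i. v $ i \<in> \<int>}"

definition primitive_vec :: "real ^ 3 \<Rightarrow> bool" where
  "primitive_vec v \<longleftrightarrow> v \<in> lattice3 \<and> v \<noteq> 0 \<and>
     (\<forall>w\<in>lattice3. \<forall>k::nat. v = real k *\<^sub>R w \<longrightarrow> k = 1)"

definition ray :: "real ^ 3 \<Rightarrow> (real ^ 3) set" where
  "ray v = convex_cone hull {v}"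

definition rational_cone :: "(real ^ 3) set \<Rightarrow> bool" where
  "rational_cone \<sigma> \<longleftrightarrow>
     (\<exists>S. finite S \<and> S \<subseteq> lattice3 \<and> \<sigma> = convex_cone hull S) \<and> \<sigma> \<inter> uminus ` \<sigma> = {0}"

definition simplicial_cone :: "(real ^ 3) set \<Rightarrow> bool" where
  "simplicial_cone \<sigma> \<longleftrightarrow> (\<exists>S. S \<subseteq> lattice3 \<and> independent S \<and> \<sigma> = convex_cone hull S)"

text \<open>The library's \<open>face_of\<close> also counts the empty set as a face of a convex set; the nonempty
  faces, in that sense, of a polyhedral cone are its faces as a cone.\<close>

definition cone_faces :: "(real ^ 3) set \<Rightarrow> (real ^ 3) set set" where
  "cone_faces \<sigma> = {\<tau>. \<tau> face_of \<sigma> \<and> \<tau> \<noteq> {}}"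

definition fan :: "(real ^ 3) set set \<Rightarrow> bool" where
  "fan \<Sigma> \<longleftrightarrow> finite \<Sigma> \<and> (\<forall>\<sigma>\<in>\<Sigma>. rational_cone \<sigma>) \<and> (\<forall>\<sigma>\<in>\<Sigma>. cone_faces \<sigma> \<subseteq> \<Sigma>) \<and>
     (\<forall>\<sigma>\<in>\<Sigma>. \<forall>\<sigma>'\<in>\<Sigma>. \<sigma> \<inter> \<sigma>' \<in> cone_faces \<sigma> \<and> \<sigma> \<inter> \<sigma>' \<in> cone_faces \<sigma>')"

definition simplicial_fan :: "(real ^ 3) set set \<Rightarrow> bool" where
  "simplicial_fan \<Sigma> \<longleftrightarrow> fan \<Sigma> \<and> (\<forall>\<sigma>\<in>\<Sigma>. simplicial_cone \<sigma>)"

definition subdivision_of :: "(real ^ 3) set set \<Rightarrow> (real ^ 3) set \<Rightarrow> bool" where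
  "subdivision_of \<Sigma> \<sigma> \<longleftrightarrow> fan \<Sigma> \<and> \<Union>\<Sigma> = \<sigma>"

definition star_subdivision :: "(real ^ 3) set set \<Rightarrow> (real ^ 3) set \<Rightarrow> (real ^ 3) set set" where
  "star_subdivision \<Sigma> \<rho> =
     {\<sigma> \<in> \<Sigma>. \<not> \<rho> \<subseteq> \<sigma>} \<union>
     {{x + y | x y. x \<in> \<rho> \<and> y \<in> \<tau>} | \<sigma> \<tau>. \<sigma> \<in> \<Sigma> \<and> \<rho> \<subseteq> \<sigma> \<and> \<tau> \<in> cone_faces \<sigma> \<and> \<not> \<rho> \<subseteq> \<tau>}"

definition ray_gens :: "(real ^ 3) set \<Rightarrow> (real ^ 3) set" where
  "ray_gens \<sigma> = {v. primitive_vec v \<and> ray v \<in> cone_faces \<sigma>}"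

text \<open>For a simplicial cone this form is determined on the span of the cone. It is only ever
  evaluated there: on the cone itself, or anywhere if the cone is full-dimensional.\<close>

definition lform :: "(real ^ 3) set \<Rightarrow> real ^ 3 \<Rightarrow> real" where
  "lform \<sigma> = (SOME l. linear l \<and> (\<forall>v\<in>ray_gens \<sigma>. l v = 1))"

definition shed :: "(real ^ 3) set \<Rightarrow> (real ^ 3) set" where
  "shed \<sigma> = {x \<in> \<sigma>. 0 \<le> lform \<sigma> x \<and> lform \<sigma> x \<le> 1}"

definition terminal_fan :: "(real ^ 3) set set \<Rightarrow> bool" where
  "terminal_fan \<Sigma> \<longleftrightarrow> (\<forall>\<sigma>\<in>\<Sigma>. shed \<sigma> \<inter> lattice3 = insert 0 (ray_gens \<sigma>))"

definition maximal_cone :: "(real ^ 3) set set \<Rightarrow> (real ^ 3) set \<Rightarrow> bool" where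
  "maximal_cone \<Sigma> \<sigma> \<longleftrightarrow> \<sigma> \<in> \<Sigma> \<and> (\<forall>\<sigma>'\<in>\<Sigma>. \<sigma> \<subseteq> \<sigma>' \<longrightarrow> \<sigma>' = \<sigma>)"

definition adjacent_cones :: "(real ^ 3) set \<Rightarrow> (real ^ 3) set \<Rightarrow> bool" where
  "adjacent_cones \<sigma> \<sigma>' \<longleftrightarrow> (\<sigma> \<inter> \<sigma>') facet_of \<sigma> \<and> (\<sigma> \<inter> \<sigma>') facet_of \<sigma>'"

definition canonical_nef :: "(real ^ 3) set set \<Rightarrow> bool" where
  "canonical_nef \<Sigma> \<longleftrightarrow>
     (\<forall>\<sigma> \<sigma>'. maximal_cone \<Sigma> \<sigma> \<and> maximal_cone \<Sigma> \<sigma>' \<and> adjacent_cones \<sigma> \<sigma>' \<longrightarrow>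
        (\<forall>v \<in> ray_gens \<sigma>' - \<sigma>. lform \<sigma> v \<ge> 1))"


section \<open>Birational models and toric \<open>A\<close>-schemes\<close>

text \<open>
  A separated integral scheme with function field \<open>K\<close> is determined by the set of its local rings,
  as subrings of \<open>K\<close> (the models of Zariski, or schemata of Chevalley). An open cover corresponds
  to a union of such sets, and \<open>Spec B\<close>, for a subring \<open>B\<close> of \<open>K\<close>, to the set of the localizations
  of \<open>B\<close> at its prime ideals. All schemes below are represented in this way; morphisms between them
  are the ones inducing the identity on \<open>K\<close>.
\<close>

definition is_subring :: "'a::comm_ring_1 set \<Rightarrow> bool" where
  "is_subring B \<longleftrightarrow> 1 \<in> B \<and> (\<forall>x\<in>B. \<forall>y\<in>B. x - y \<in> B \<and> x * y \<in> B)"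

definition is_prime_ideal :: "'a::comm_ring_1 set \<Rightarrow> 'a set \<Rightarrow> bool" where
  "is_prime_ideal P B \<longleftrightarrow> P \<subseteq> B \<and> 0 \<in> P \<and> 1 \<notin> P \<and> (\<forall>x\<in>P. \<forall>y\<in>P. x + y \<in> P) \<and>
     (\<forall>b\<in>B. \<forall>x\<in>P. b * x \<in> P) \<and> (\<forall>a\<in>B. \<forall>b\<in>B. a * b \<in> P \<longrightarrow> a \<in> P \<or> b \<in> P)"

definition localize_at :: "'a::field set \<Rightarrow> 'a set \<Rightarrow> 'a set" where
  "localize_at B P = {b / s | b s. b \<in> B \<and> s \<in> B - P}"

definition Spec_model :: "'a::field set \<Rightarrow> 'a set set" where
  "Spec_model B = {localize_at B P | P. is_prime_ideal P B}"

text \<open>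
  \<open>X\<close> is projective over \<open>Spec B\<close> (where \<open>B\<close> has fraction field \<open>K\<close>) iff it is isomorphic over
  \<open>Spec B\<close> to a closed subscheme of some projective space over \<open>B\<close>. As \<open>X\<close> is integral with
  function field \<open>K\<close>, this subscheme is the closure of the image of a \<open>K\<close>-valued point; after
  dropping the homogeneous coordinates vanishing on it, let \<open>F\<close> be the set of coordinates of that
  point. Then the closure is covered by the affine schemes \<open>Spec B[g / f. g \<in> F]\<close> for \<open>f \<in> F\<close>.
\<close>

definition projective_over :: "'a::field set set \<Rightarrow> 'a set \<Rightarrow> bool" where
  "projective_over X B \<longleftrightarrow>
     (\<exists>F. finite F \<and> F \<noteq> {} \<and> 0 \<notin> F \<and>
        X = (\<Union>f\<in>F. Spec_model (is_subring hull (B \<union> {g / f | g. g \<in> F}))))"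

text \<open>
  Here \<open>'k\<close> is the finite field and \<open>'k poly\<close> is \<open>A\<close>. The function field of the torus is
  the fraction field of \<open>A[X\<^sub>1][X\<^sub>2][X\<^sub>3]\<close>, with \<open>X\<^sub>3\<close> the variable of the outermost polynomial ring.
\<close>

type_synonym 'k torus_field = "'k poly poly poly poly fract"

definition base_const :: "'k::field poly \<Rightarrow> 'k torus_field" where
  "base_const a = Fract [:[:[:a:]:]:] 1"

definition character :: "int ^ 3 \<Rightarrow> ('k::field) torus_field" where
  "character m = Fract [:[:[:0, 1:]:]:] 1 powi (m $ 1)
     * Fract [:[:0, 1:]:] 1 powi (m $ 2) * Fract [:0, 1:] 1 powi (m $ 3)"

text \<open>\<open>(\<int>\<^sup>3)\<^sup>*\<close> is identified with \<open>\<int>\<^sup>3\<close> by means of the standard scalar product.\<close>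

definition dual_lattice_points :: "(real ^ 3) set \<Rightarrow> (int ^ 3) set" where
  "dual_lattice_points \<sigma> = {m. \<forall>x\<in>\<sigma>. 0 \<le> (\<Sum>i\<in>UNIV. real_of_int (m $ i) * x $ i)}"

definition toric_ring :: "(real ^ 3) set \<Rightarrow> ('k::field) torus_field set" where
  "toric_ring \<sigma> =
     {\<Sum>m\<in>S. base_const (c m) * character m | S c. finite S \<and> S \<subseteq> dual_lattice_points \<sigma>}"

definition toric_scheme :: "(real ^ 3) set set \<Rightarrow> ('k::field) torus_field set set" where
  "toric_scheme \<Sigma> = (\<Union>\<sigma>\<in>\<Sigma>. Spec_model (toric_ring \<sigma>))"


section \<open>Minimal terminal models\<close>

definition minimal_terminal_model ::
    "'k::{field,finite} itself \<Rightarrow> (real ^ 3) set \<Rightarrow> (real ^ 3) set set \<Rightarrow> bool" where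
  "minimal_terminal_model _ \<sigma> \<Sigma> \<longleftrightarrow>
     simplicial_fan \<Sigma> \<and> subdivision_of \<Sigma> \<sigma> \<and>
     projective_over (toric_scheme \<Sigma> :: 'k torus_field set set) (toric_ring \<sigma>) \<and>
     terminal_fan \<Sigma> \<and> canonical_nef \<Sigma>"

text \<open>The cone for which \<open>Spec_model (toric_ring (sigma_M q))\<close> is the coarse moduli scheme
  \<open>M\<^sup>4(1)\<close> of Drinfeld modules of rank 4 (a known result, taken here as the description
  of \<open>M\<^sup>4(1)\<close>).\<close>

definition sigma_M :: "nat \<Rightarrow> (real ^ 3) set" where
  "sigma_M q = convex_cone hull
     {vector [real q ^ 3 + real q ^ 2 + real q + 1, - (real q) - 1, - (real q ^ 2) - real q - 1],
      vector [0, 1, 0], vector [0, 0, 1]}"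

end

theory Submission
  imports Defs
begin

text \<open>
  For a simplicial subdivision \<open>\<Sigma>\<close> of \<open>\<sigma>\<^sub>M\<close> let \<open>\<phi>\<close> be the function that is linear on the cones of
  \<open>\<Sigma>\<close> and equal to \<open>1\<close> at the primitive generators of its rays. If \<open>\<Sigma>\<close> is terminal, then \<open>\<phi> \<ge> 1\<close>
  at all nonzero lattice points of \<open>\<sigma>\<^sub>M\<close>; if the canonical divisor is nef, then \<open>\<phi>\<close> is concave. So
  the inequality \<open>\<phi> \<ge> 1\<close> describes the convex hull of the nonzero lattice points of \<open>\<sigma>\<^sub>M\<close>, and
  \<open>\<phi>\<close> does not depend on \<open>\<Sigma>\<close>. For the fan obtained by the two star subdivisions the inequalities in
  the nef condition are strict. Hence its maximal cones are the domains of linearity of \<open>\<phi>\<close>; as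
  they are terminal, no other fan is possible. Strict concavity also makes the toric scheme
  projective over \<open>M\<^sup>4(1)\<close>.
\<close>

section \<open>Cones over linearly independent sets\<close>

text \<open>All that concerns the particular fan is condensed into one finite certificate: for each
  maximal cone \<open>G\<close> an integral form \<open>m G\<close> with value \<open>M\<close> on
  the generators in \<open>G\<close> and a larger value on all other generators, and for each wall
  of each cone an integral equation. Every such equation is either nonnegative on all of
  \<open>sigma_M q\<close> or a difference \<open>m H - m G\<close>. This dichotomy yields the
  covering property, and the same equations yield the localizations at faces and the relations
  behind projectivity. The scale \<open>M = q (q^2 + 1)\<close> clears denominators: two of the four
  maximal cones are unimodular, the generators of the other two span sublattices of index
  \<open>q\<close> and \<open>q^2 + 1\<close>. That \<phi> is the same for all models is exploited
  at a single point. Let \<open>x\<close> be the sum of the generators of a maximal cone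
  \<open>S\<close> of another model, and let \<open>x\<close> lie in the cone over \<open>G\<close>.
  As \<open>m G\<close> is at least \<open>M\<close> on \<open>S\<close>, its value at
  \<open>x\<close> is at least \<open>3 M\<close>; as the form of \<open>S\<close> is at least 1 on
  \<open>G\<close>, that value is at most \<open>3 M\<close>. Equality puts \<open>S\<close> inside
  \<open>G\<close>.\<close>

lemma zero_in_convex_cone_hull [simp]: "0 \<in> convex_cone hull S"
  by (rule convex_cone_hull_contains_0)

lemma convex_cone_hull_subset_span: "convex_cone hull S \<subseteq> span S"
  by (rule hull_minimal) (auto intro: span_base convex_cone_span)

lemma convex_cone_hull_sum:
  assumes "\<And>s. s \<in> T \<Longrightarrow> s \<in> convex_cone hull S" "\<And>s. s \<in> T \<Longrightarrow> 0 \<le> c s"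
  shows "(\<Sum>s\<in>T. c s *\<^sub>R s) \<in> convex_cone hull S"
  using assms
  by (induction T rule: infinite_finite_induct)
     (auto intro!: convex_cone_add convex_cone_scaleR convex_cone_convex_cone_hull)

lemma linear_nonneg_on_convex_cone_hull:
  fixes f :: "'a::real_vector \<Rightarrow> real"
  assumes "linear f" "\<And>s. s \<in> S \<Longrightarrow> 0 \<le> f s" "x \<in> convex_cone hull S"
  shows "0 \<le> f x"
proof -
  have "convex_cone {x. 0 \<le> f x}"
    using assms(1) by (auto simp: convex_cone_iff linear_add linear_scale linear_0)
  then have "convex_cone hull S \<subseteq> {x. 0 \<le> f x}"
    using assms(2) by (intro hull_minimal) auto
  then show ?thesis using assms(3) by auto
qed

lemma representation_expansion:
  fixes S :: "'a::euclidean_space set"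
  assumes "independent S" "x \<in> span S"
  shows "x = (\<Sum>s\<in>S. representation S x s *\<^sub>R s)"
  using sum_representation_eq[OF assms independent_imp_finite[OF assms(1)] subset_refl] by simp

lemma linear_eq_sum_representation:
  fixes S :: "'a::euclidean_space set" and f :: "'a \<Rightarrow> real"
  assumes "independent S" "x \<in> span S" "linear f"
  shows "f x = (\<Sum>s\<in>S. representation S x s * f s)"
proof -
  have "f x = f (\<Sum>s\<in>S. representation S x s *\<^sub>R s)"
    using representation_expansion[OF assms(1,2)] by simp
  also have "\<dots> = (\<Sum>s\<in>S. representation S x s * f s)"
    using assms(3) by (simp add: linear_sum linear_scale)
  finally show ?thesis .
qed

lemma simplicial_hull_eq:
  fixes S :: "'a::euclidean_space set"
  assumes S: "independent S"
  shows "convex_cone hull S = {x \<in> span S. \<forall>s\<in>S. 0 \<le> representation S x s}" (is "_ = ?C")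
proof
  have "convex_cone ?C"
    by (auto simp: convex_cone_iff S representation_zero representation_add representation_scale
        span_zero span_add span_scale)
  moreover have "S \<subseteq> ?C"
    using S by (auto simp: representation_basis intro: span_base)
  ultimately show "convex_cone hull S \<subseteq> ?C"
    by (rule hull_minimal[rotated])
  show "?C \<subseteq> convex_cone hull S"
  proof
    fix x assume x: "x \<in> ?C"
    then have "x = (\<Sum>s\<in>S. representation S x s *\<^sub>R s)"
      using representation_expansion[OF S] by auto
    also have "\<dots> \<in> convex_cone hull S"
      using x by (intro convex_cone_hull_sum) (auto intro: hull_inc)
    finally show "x \<in> convex_cone hull S" .
  qed
qed

lemma simplicial_hull_subset_iff:
  fixes S :: "'a::euclidean_space set"
  assumes S: "independent S" and T: "T \<subseteq> S"
  shows "x \<in> convex_cone hull T \<longleftrightarrow>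
    x \<in> convex_cone hull S \<and> (\<forall>s\<in>S - T. representation S x s = 0)"
proof
  assume x: "x \<in> convex_cone hull T"
  then have "x \<in> span T" using convex_cone_hull_subset_span by blast
  then have "representation S x = representation T x"
    using S T by (intro representation_extend) 
  then have "\<forall>s\<in>S - T. representation S x s = 0"
    using representation_ne_zero[of T x] by auto
  then show "x \<in> convex_cone hull S \<and> (\<forall>s\<in>S - T. representation S x s = 0)"
    using x hull_mono[OF T, of convex_cone] by auto
next
  assume x: "x \<in> convex_cone hull S \<and> (\<forall>s\<in>S - T. representation S x s = 0)"
  then have xs: "x \<in> span S" and pos: "\<forall>s\<in>S. 0 \<le> representation S x s"
    using simplicial_hull_eq[OF S] by auto
  have "x = (\<Sum>s\<in>S. representation S x s *\<^sub>R s)"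
    using representation_expansion[OF S xs] .
  also have "\<dots> = (\<Sum>s\<in>T. representation S x s *\<^sub>R s)"
    using x T independent_imp_finite[OF S] by (intro sum.mono_neutral_right) auto
  also have "\<dots> \<in> convex_cone hull T"
    using pos T by (intro convex_cone_hull_sum) (auto intro: hull_inc)
  finally show "x \<in> convex_cone hull T" .
qed

text \<open>Each of the three memberships says which coordinates of \<open>representation S\<close>
  vanish, and the conditions for \<open>T\<close> and \<open>U\<close> together are those for
  \<open>T \<inter> U\<close>.\<close>

lemma simplicial_hull_Int:
  fixes S :: "'a::euclidean_space set"
  assumes "independent S" "T \<subseteq> S" "U \<subseteq> S"
  shows "convex_cone hull T \<inter> convex_cone hull U = convex_cone hull (T \<inter> U)"
proof -
  have "x \<in> convex_cone hull T \<inter> convex_cone hull U \<longleftrightarrow> x \<in> convex_cone hull (T \<inter> U)" for x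
    using assms simplicial_hull_subset_iff[of S T x] simplicial_hull_subset_iff[of S U x]
      simplicial_hull_subset_iff[of S "T \<inter> U" x] by blast
  then show ?thesis by blast
qed

lemma generator_in_hull_iff:
  fixes S :: "'a::euclidean_space set"
  assumes "independent S" "T \<subseteq> S" "s \<in> S"
  shows "s \<in> convex_cone hull T \<longleftrightarrow> s \<in> T"
  using assms simplicial_hull_subset_iff[of S T s] representation_basis[of S s]
  by (auto intro: hull_inc)

text \<open>A coordinate that is nonnegative at both ends of a segment and zero at a point in
  between is zero at both ends.\<close>

lemma simplicial_hull_face:
  fixes S :: "'a::euclidean_space set"
  assumes S: "independent S" and T: "T \<subseteq> S"
  shows "convex_cone hull T face_of convex_cone hull S"
  unfolding face_of_def
proof (intro conjI ballI impI)
  show "convex_cone hull T \<subseteq> convex_cone hull S" by (rule hull_mono[OF T])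
  show "convex (convex_cone hull T)" by (rule convex_convex_cone_hull)
  fix a b x
  assume a: "a \<in> convex_cone hull S" and b: "b \<in> convex_cone hull S"
    and x: "x \<in> convex_cone hull T" and "x \<in> open_segment a b"
  then obtain u where u: "0 < u" "u < 1" "x = (1 - u) *\<^sub>R a + u *\<^sub>R b"
    by (auto simp: in_segment)
  have "representation S a s = 0 \<and> representation S b s = 0" if s: "s \<in> S - T" for s
  proof -
    have "a \<in> span S" "b \<in> span S"
      using a b convex_cone_hull_subset_span by blast+
    then have "representation S x s = (1 - u) * representation S a s + u * representation S b s"
      by (simp add: u(3) S representation_add representation_scale span_scale)
    moreover have "representation S x s = 0"
      using x s simplicial_hull_subset_iff[OF S T] by blast
    moreover have "0 \<le> representation S a s" "0 \<le> representation S b s"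
      using a b s simplicial_hull_eq[OF S] by auto
    ultimately show ?thesis
      using u(1,2) by (smt (verit) mult_nonneg_nonneg mult_pos_pos)
  qed
  then show "a \<in> convex_cone hull T" "b \<in> convex_cone hull T"
    using a b simplicial_hull_subset_iff[OF S T] by blast+
qed

text \<open>Extremality is used for midpoints only. It makes a face closed under doubling, hence a
  cone; and splitting a point of the face into one term and the rest shows that the generators with
  nonzero coefficient belong to the face.\<close>

lemma cone_faces_simplicial_hull:
  fixes S :: "(real ^ 3) set"
  assumes S: "independent S"
  shows "cone_faces (convex_cone hull S) = (\<lambda>T. convex_cone hull T) ` Pow S"
proof (intro equalityI subsetI)
  fix \<tau> assume "\<tau> \<in> cone_faces (convex_cone hull S)"
  then have face: "\<tau> face_of convex_cone hull S" and ne: "\<tau> \<noteq> {}"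
    by (auto simp: cone_faces_def)
  have sub: "\<tau> \<subseteq> convex_cone hull S" using face by (rule face_of_imp_subset)
  have ext: "a \<in> \<tau> \<and> b \<in> \<tau>"
    if "a \<in> convex_cone hull S" "b \<in> convex_cone hull S" "(1/2) *\<^sub>R (a + b) \<in> \<tau>" for a b
  proof (cases "a = b")
    case True
    then show ?thesis using that(3) by (simp flip: scaleR_2)
  next
    case False
    then have "midpoint a b \<in> open_segment a b" by simp
    then show ?thesis
      using face that by (auto simp: face_of_def midpoint_def)
  qed
  have dbl: "2 *\<^sub>R x \<in> convex_cone hull S" if "x \<in> convex_cone hull S" for x
    using that by (simp add: convex_cone_convex_cone_hull convex_cone_scaleR)
  have zero: "0 \<in> \<tau>"
    using ne ext[of 0 "2 *\<^sub>R x" for x] dbl sub by fastforce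
  have scale: "c *\<^sub>R x \<in> \<tau>" if x: "x \<in> \<tau>" and c: "0 \<le> c" for c x
  proof -
    have pow: "2 ^ n *\<^sub>R x \<in> \<tau>" for n
    proof (induction n)
      case (Suc n)
      then have "0 \<in> \<tau> \<and> 2 *\<^sub>R (2 ^ n *\<^sub>R x) \<in> \<tau>"
        using dbl[of "2 ^ n *\<^sub>R x"] sub by (intro ext) auto
      then show ?case by simp
    qed (use x in simp)
    obtain n where n: "c < 2 ^ n" using real_arch_pow[of 2 c] by auto
    \<comment> \<open>Doubling goes beyond \<open>c *\<^sub>R x\<close>, and convexity with the
      origin comes back to it.\<close>
    have "c *\<^sub>R x = (1 - c / 2 ^ n) *\<^sub>R 0 + (c / 2 ^ n) *\<^sub>R (2 ^ n *\<^sub>R x)" by simp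
    also have "\<dots> \<in> \<tau>"
      using n c zero pow[of n] face_of_imp_convex[OF face] 
      by (intro convexD) (auto simp: face_of_def)
    finally show ?thesis .
  qed
  define T where "T = S \<inter> \<tau>"
  have "\<tau> \<subseteq> convex_cone hull T"
  proof
    fix x assume x: "x \<in> \<tau>"
    then have xS: "x \<in> convex_cone hull S" using sub by auto
    then have xs: "x \<in> span S" and pos: "\<And>s. s \<in> S \<Longrightarrow> 0 \<le> representation S x s"
      using simplicial_hull_eq[OF S] by auto
    have "s \<in> \<tau>" if s: "s \<in> S" and nz: "representation S x s \<noteq> 0" for s
    proof -
      define a where "a = representation S x s"
      have a: "0 < a" using pos[OF s] nz a_def by simp
      have "x = (\<Sum>t\<in>S. representation S x t *\<^sub>R t)"
        by (rule representation_expansion[OF S xs])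
      also have "\<dots> = a *\<^sub>R s + (\<Sum>t\<in>S - {s}. representation S x t *\<^sub>R t)"
        using s independent_imp_finite[OF S] by (simp add: sum.remove a_def)
      finally have x_eq: "x = a *\<^sub>R s + (\<Sum>t\<in>S - {s}. representation S x t *\<^sub>R t)" .
      define y where "y = (\<Sum>t\<in>S - {s}. representation S x t *\<^sub>R t)"
      have y: "y \<in> convex_cone hull S"
        unfolding y_def using pos by (intro convex_cone_hull_sum) (auto intro: hull_inc)
      have s': "a *\<^sub>R s \<in> convex_cone hull S"
        using s a by (auto intro: convex_cone_scaleR convex_cone_convex_cone_hull hull_inc)
      \<comment> \<open>\<open>x\<close> is the midpoint of these two points.\<close>
      have "2 *\<^sub>R (a *\<^sub>R s) \<in> \<tau> \<and> 2 *\<^sub>R y \<in> \<tau>"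
      proof (rule ext)
        show "(1 / 2) *\<^sub>R (2 *\<^sub>R a *\<^sub>R s + 2 *\<^sub>R y) \<in> \<tau>"
          using x x_eq by (simp add: y_def scaleR_add_right)
      qed (use y s' dbl[of y] dbl[of "a *\<^sub>R s"] in auto)
      then have "(1 / (2 * a)) *\<^sub>R (2 *\<^sub>R (a *\<^sub>R s)) \<in> \<tau>"
        using scale[of "2 *\<^sub>R (a *\<^sub>R s)" "1 / (2 * a)"] a by simp
      then show "s \<in> \<tau>" using a by simp
    qed
    then show "x \<in> convex_cone hull T"
      using xS simplicial_hull_subset_iff[OF S, of T x] by (auto simp: T_def)
  qed
  moreover have "convex_cone hull T \<subseteq> \<tau>"
  proof (rule hull_minimal)
    show "convex_cone \<tau>"
      unfolding convex_cone_def conic_def using ne scale face_of_imp_convex[OF face] face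
      by (auto simp: face_of_def)
  qed (auto simp: T_def)
  ultimately show "\<tau> \<in> (\<lambda>T. convex_cone hull T) ` Pow S"
    by (auto simp: T_def)
next
  fix \<tau> assume "\<tau> \<in> (\<lambda>T. convex_cone hull T) ` Pow S"
  then show "\<tau> \<in> cone_faces (convex_cone hull S)"
    using simplicial_hull_face[OF S] by (auto simp: cone_faces_def convex_cone_hull_nonempty)
qed

lemma simplicial_hull_pointed:
  fixes S :: "(real ^ 3) set"
  assumes S: "independent S"
  shows "convex_cone hull S \<inter> uminus ` (convex_cone hull S) = {0}"
proof -
  have "x = 0" if x: "x \<in> convex_cone hull S" "- x \<in> convex_cone hull S" for x
  proof -
    have xs: "x \<in> span S" using x convex_cone_hull_subset_span by blast
    have "representation S x s = 0" if "s \<in> S" for s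
      using x that simplicial_hull_eq[OF S] representation_neg[OF S xs] by fastforce
    then show "x = 0" using representation_expansion[OF S xs] by simp
  qed
  then show ?thesis by force
qed

section \<open>Primitive vectors, ray generators and the form \<open>lform\<close>\<close>

lemma primitive_vec_ne_0: "primitive_vec v \<Longrightarrow> v \<noteq> 0"
  by (simp add: primitive_vec_def)

text \<open>The largest \<open>k\<close> that divides \<open>v\<close> in the lattice leaves a
  primitive quotient. It exists because any such \<open>k\<close> is bounded by the absolute value
  of a nonzero coordinate of \<open>v\<close>.\<close>

lemma primitive_vec_scaling:
  assumes v: "v \<in> lattice3" "v \<noteq> 0"
  obtains w k where "primitive_vec w" "0 < (k::nat)" "v = real k *\<^sub>R w"
proof -
  obtain i where i: "v $ i \<noteq> 0" using v(2) by (auto simp: vec_eq_iff)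
  define K where "K = {k::nat. \<exists>w\<in>lattice3. v = real k *\<^sub>R w}"
  have "k \<le> nat \<lceil>\<bar>v $ i\<bar>\<rceil>" if kK: "k \<in> K" for k
  proof -
    obtain w where w: "w \<in> lattice3" "v = real k *\<^sub>R w" using kK unfolding K_def by blast
    have "w $ i \<noteq> 0" using i w(2) by auto
    moreover have "w $ i \<in> \<int>" using w(1) by (simp add: lattice3_def)
    ultimately have "1 \<le> \<bar>w $ i\<bar>" by (rule Ints_nonzero_abs_ge1[rotated])
    then have "real k \<le> \<bar>v $ i\<bar>" by (simp add: w(2) abs_mult mult_le_cancel_left1)
    then show ?thesis by linarith
  qed
  then have fin: "finite K" by (meson finite_nat_set_iff_bounded_le)
  have one: "1 \<in> K" using v by (auto simp: K_def)
  define k where "k = Max K"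
  have kK: "k \<in> K" using fin one Max_in k_def by blast
  have k0: "0 < k" using fin one Max_ge[of K 1] unfolding k_def by linarith
  obtain w where w: "w \<in> lattice3" "v = real k *\<^sub>R w" using kK unfolding K_def by blast
  have "primitive_vec w"
    unfolding primitive_vec_def
  proof (intro conjI ballI allI impI)
    show "w \<noteq> 0" using v w by auto
    fix u j assume u: "u \<in> lattice3" "w = real j *\<^sub>R u"
    then have "k * j \<in> K" using w by (auto simp: K_def)
    then have "k * j \<le> k" using fin k_def by simp
    moreover have "j \<noteq> 0" using u \<open>w \<noteq> 0\<close> by auto
    ultimately show "j = 1" using k0 by (cases j) auto
  qed (rule w)
  then show thesis using that k0 w by blast
qed

text \<open>The factor is rational, say \<open>a / b\<close> in lowest terms. Then \<open>b\<close>
  divides \<open>v\<close> and \<open>a\<close> divides \<open>w\<close> in the lattice, and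
  primitivity makes both equal to 1.\<close>

lemma primitive_vec_eqI:
  assumes v: "primitive_vec v" and w: "primitive_vec w" and c: "w = c *\<^sub>R v" "0 \<le> c"
  shows "w = v"
proof -
  obtain i where i: "v $ i \<noteq> 0"
    using primitive_vec_ne_0[OF v] by (auto simp: vec_eq_iff)
  have int: "v $ j \<in> \<int>" "w $ j \<in> \<int>" for j
    using v w by (auto simp: primitive_vec_def lattice3_def)
  have "c = w $ i / v $ i" using c i by simp
  then have "c \<in> \<rat>" using int Ints_subset_Rats by (metis Rats_divide subsetD)
  then obtain a b :: nat where ab: "b \<noteq> 0" "\<bar>c\<bar> = real a / real b" "coprime a b"
    by (rule Rats_abs_nat_div_natE)
  have eq: "real b * w $ j = real a * v $ j" for j
    using ab c by (simp add: field_simps)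
  have div: "x / real n \<in> \<int>"
    if xy: "x \<in> \<int>" "y \<in> \<int>" and eq: "real n * y = real m * x" and cop: "coprime n m" "n \<noteq> 0"
    for x y and n m :: nat
  proof -
    obtain x' y' where xy: "x = of_int x'" "y = of_int y'" using xy by (metis Ints_cases)
    have "int n * y' = int m * x'"
      using eq unfolding xy by (metis of_int_eq_iff of_int_mult of_int_of_nat_eq)
    then have "int n dvd int m * x'" by (metis dvd_triv_left)
    then have "int n dvd x'" using cop by (simp add: coprime_dvd_mult_right_iff)
    then obtain z where "x' = int n * z" by auto
    then show ?thesis using cop by (simp add: xy)
  qed
  have "(1 / real b) *\<^sub>R v \<in> lattice3"
    using div[OF int(1) int(2) eq] ab by (auto simp: lattice3_def coprime_commute)
  moreover have "v = real b *\<^sub>R ((1 / real b) *\<^sub>R v)" using ab by simp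
  ultimately have b: "b = 1" using v by (metis primitive_vec_def)
  have a0: "a \<noteq> 0" using ab c primitive_vec_ne_0[OF w] by auto
  have "(1 / real a) *\<^sub>R w \<in> lattice3"
    using div[OF int(2) int(1) eq[symmetric]] ab a0 by (auto simp: lattice3_def)
  moreover have "w = real a *\<^sub>R ((1 / real a) *\<^sub>R w)" using a0 by simp
  ultimately have "a = 1" using w by (metis primitive_vec_def)
  then show ?thesis using ab b c by simp
qed

lemma ray_eq: "ray v = {c *\<^sub>R v | c. 0 \<le> c}"
proof
  have "convex_cone {c *\<^sub>R v | c. 0 \<le> c}"
    unfolding convex_cone_iff
  proof (intro conjI ballI allI impI)
    show "0 \<in> {c *\<^sub>R v | c. 0 \<le> c}" by (auto intro: exI[of _ 0])
    fix x y assume "x \<in> {c *\<^sub>R v | c. 0 \<le> c}" "y \<in> {c *\<^sub>R v | c. 0 \<le> c}"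
    then show "x + y \<in> {c *\<^sub>R v | c. 0 \<le> c}"
      by (auto simp: scaleR_left_distrib[symmetric] intro: add_nonneg_nonneg)
  next
    fix x and b :: real assume "x \<in> {c *\<^sub>R v | c. 0 \<le> c}" "0 \<le> b"
    then show "b *\<^sub>R x \<in> {c *\<^sub>R v | c. 0 \<le> c}" by auto
  qed
  moreover have "v \<in> {c *\<^sub>R v | c. 0 \<le> c}" by (auto intro: exI[of _ 1])
  ultimately show "ray v \<subseteq> {c *\<^sub>R v | c. 0 \<le> c}"
    unfolding ray_def by (intro hull_minimal) auto
  show "{c *\<^sub>R v | c. 0 \<le> c} \<subseteq> ray v"
    unfolding ray_def by (auto intro: convex_cone_scaleR convex_cone_convex_cone_hull hull_inc)
qed

text \<open>Recovers the generating set from the cone, so that simplicial cones and their sets of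
  primitive generators determine each other.\<close>

lemma ray_gens_simplicial_hull:
  assumes S: "independent S" and prim: "\<And>s. s \<in> S \<Longrightarrow> primitive_vec s"
  shows "ray_gens (convex_cone hull S) = S"
proof (intro equalityI subsetI)
  fix s assume "s \<in> S"
  then show "s \<in> ray_gens (convex_cone hull S)"
    using prim cone_faces_simplicial_hull[OF S] by (auto simp: ray_gens_def ray_def)
next
  fix v assume "v \<in> ray_gens (convex_cone hull S)"
  then obtain T where v: "primitive_vec v" and T: "T \<subseteq> S" "ray v = convex_cone hull T"
    using cone_faces_simplicial_hull[OF S] by (auto simp: ray_gens_def)
  have "T \<noteq> {}"
  proof
    assume "T = {}"
    then have "ray v = {0}" using T by simp
    moreover have "v \<in> ray v" by (simp add: ray_def hull_inc)
    ultimately show False using primitive_vec_ne_0[OF v] by auto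
  qed
  then obtain t where t: "t \<in> T" by auto
  then have "t \<in> ray v" using T by (simp add: hull_inc)
  then obtain c where "0 \<le> c" "t = c *\<^sub>R v" by (auto simp: ray_eq)
  then have "t = v" using primitive_vec_eqI[OF v] prim t T by blast
  then show "v \<in> S" using t T by auto
qed

lemma simplicial_cone_primitive_generators:
  assumes "simplicial_cone \<sigma>"
  obtains S where "independent S" "\<And>s. s \<in> S \<Longrightarrow> primitive_vec s" "\<sigma> = convex_cone hull S"
proof -
  obtain S where S: "S \<subseteq> lattice3" "independent S" "\<sigma> = convex_cone hull S"
    using assms by (auto simp: simplicial_cone_def)
  have "\<exists>w k. primitive_vec w \<and> 0 < k \<and> real k *\<^sub>R w = s" if "s \<in> S" for s
    using primitive_vec_scaling[of s] S that by (metis dependent_zero subsetD)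
  then obtain f g where fg: "\<And>s. s \<in> S \<Longrightarrow> primitive_vec (f s) \<and> 0 < g s \<and> real (g s) *\<^sub>R f s = s"
    by metis
  have fin: "finite S" by (rule independent_imp_finite[OF S(2)])
  have f_eq: "f s = (1 / real (g s)) *\<^sub>R s" if "s \<in> S" for s
  proof -
    have eq: "w = (1 / real k) *\<^sub>R v" if "0 < k" "real k *\<^sub>R w = v" for k and v w :: "real ^ 3"
      using that by auto
    show ?thesis using fg[OF that] by (intro eq) auto
  qed
  \<comment> \<open>A spanning set of \<open>span S\<close> with no more elements than
    \<open>S\<close> is independent.\<close>
  have "independent (f ` S)"
  proof (rule card_le_dim_spanning)
    show "f ` S \<subseteq> span S" using f_eq by (auto intro!: span_scale intro: span_base)
    have "s \<in> span (f ` S)" if "s \<in> S" for s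
      using fg[OF that] span_scale[OF span_base[OF imageI[OF that, of f]], of "real (g s)"] by simp
    then show "span S \<subseteq> span (f ` S)" by (intro span_minimal) auto
    show "finite (f ` S)" using fin by simp
    show "card (f ` S) \<le> dim (span S)"
      using S(2) fin card_image_le[of S f] by (simp add: dim_eq_card_independent)
  qed
  moreover have "convex_cone hull S = convex_cone hull (f ` S)"
  proof
    have "s \<in> convex_cone hull (f ` S)" if "s \<in> S" for s
      using fg[OF that] that
        convex_cone_scaleR[OF convex_cone_convex_cone_hull, of "real (g s)" "f s" "f ` S"]
      by (simp add: hull_inc)
    then show "convex_cone hull S \<subseteq> convex_cone hull (f ` S)"
      by (intro hull_minimal convex_cone_convex_cone_hull) auto
    have "f s \<in> convex_cone hull S" if "s \<in> S" for s
      unfolding f_eq[OF that]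
      using that by (intro convex_cone_scaleR convex_cone_convex_cone_hull hull_inc) auto
    then show "convex_cone hull (f ` S) \<subseteq> convex_cone hull S"
      by (intro hull_minimal convex_cone_convex_cone_hull) auto
  qed
  ultimately show thesis using that[of "f ` S"] fg S(3) by blast
qed

lemma
  assumes "independent S" "\<And>s. s \<in> S \<Longrightarrow> primitive_vec s"
  shows linear_lform: "linear (lform (convex_cone hull S))"
    and lform_generator: "s \<in> S \<Longrightarrow> lform (convex_cone hull S) s = 1"
proof -
  obtain l :: "real ^ 3 \<Rightarrow> real" where "linear l" "\<forall>s\<in>S. l s = 1"
    using linear_independent_extend[OF assms(1), of "\<lambda>_. 1"] by auto
  then have "\<exists>l :: real ^ 3 \<Rightarrow> real. linear l \<and> (\<forall>v\<in>ray_gens (convex_cone hull S). l v = 1)"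
    using ray_gens_simplicial_hull[OF assms] by auto
  then have "linear (lform (convex_cone hull S)) \<and>
      (\<forall>v\<in>ray_gens (convex_cone hull S). lform (convex_cone hull S) v = 1)"
    unfolding lform_def by (rule someI_ex)
  then show "linear (lform (convex_cone hull S))" "s \<in> S \<Longrightarrow> lform (convex_cone hull S) s = 1"
    using ray_gens_simplicial_hull[OF assms] by auto
qed

text \<open>A point of the cone with smaller value would lie in the shed, so terminality would make
  it a generator, where the value is 1.\<close>

lemma terminal_fan_lform_ge_1:
  assumes S: "independent S" "\<And>s. s \<in> S \<Longrightarrow> primitive_vec s"
    and "terminal_fan \<Sigma>" "convex_cone hull S \<in> \<Sigma>"
    and x: "x \<in> convex_cone hull S" "x \<in> lattice3" "x \<noteq> 0"
  shows "1 \<le> lform (convex_cone hull S) x"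
proof (rule ccontr)
  assume less: "\<not> ?thesis"
  moreover have gen: "lform (convex_cone hull S) s = 1" if "s \<in> S" for s
    by (rule lform_generator) (use S that in auto)
  moreover have "0 \<le> lform (convex_cone hull S) x"
    by (rule linear_nonneg_on_convex_cone_hull[OF linear_lform[OF S] _ x(1)]) (simp_all add: gen)
  ultimately have "x \<in> shed (convex_cone hull S) \<inter> lattice3"
    using x by (auto simp: shed_def)
  then have "x \<in> S"
    using assms(3,4) x ray_gens_simplicial_hull[OF S] by (auto simp: terminal_fan_def)
  then show False using less gen by auto
qed

section \<open>Concavity of the canonical support function of a nef fan\<close>

text \<open>Cones are handled through these sets from here on; by
  \<open>ray_gens_simplicial_hull\<close> each of them is determined by its cone.\<close>

definition simplicial_gens :: "(real ^ 3) set \<Rightarrow> bool" where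
  "simplicial_gens S \<longleftrightarrow> independent S \<and> (\<forall>s\<in>S. primitive_vec s)"

lemma simplicial_gensD:
  assumes "simplicial_gens S"
  shows "independent S" "finite S" "card S \<le> 3"
    "\<And>s. s \<in> S \<Longrightarrow> primitive_vec s" "\<And>s. s \<in> S \<Longrightarrow> s \<in> lattice3" "\<And>s. s \<in> S \<Longrightarrow> s \<noteq> 0"
    "ray_gens (convex_cone hull S) = S" "linear (lform (convex_cone hull S))"
    "\<And>s. s \<in> S \<Longrightarrow> lform (convex_cone hull S) s = 1"
proof -
  show 1: "independent S" "\<And>s. s \<in> S \<Longrightarrow> primitive_vec s"
    using assms by (auto simp: simplicial_gens_def)
  show "finite S" "card S \<le> 3"
    using 1(1) independent_imp_finite independent_card_le[OF 1(1)] by auto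
  show "\<And>s. s \<in> S \<Longrightarrow> s \<in> lattice3" "\<And>s. s \<in> S \<Longrightarrow> s \<noteq> 0"
    using 1(2) by (auto simp: primitive_vec_def)
  show "ray_gens (convex_cone hull S) = S" "linear (lform (convex_cone hull S))"
    "\<And>s. s \<in> S \<Longrightarrow> lform (convex_cone hull S) s = 1"
    using ray_gens_simplicial_hull[OF 1] linear_lform[OF 1] lform_generator[OF 1] by auto
qed

lemma simplicial_gens_subset: "simplicial_gens S \<Longrightarrow> T \<subseteq> S \<Longrightarrow> simplicial_gens T"
  unfolding simplicial_gens_def using independent_mono by blast

lemma simplicial_gens_hull_inj:
  "simplicial_gens S \<Longrightarrow> simplicial_gens T \<Longrightarrow> convex_cone hull S = convex_cone hull T \<Longrightarrow> S = T"
  using simplicial_gensD(7) by metis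

lemma simplicial_fan_gens:
  assumes "simplicial_fan \<Sigma>" "\<sigma> \<in> \<Sigma>"
  obtains S where "simplicial_gens S" "\<sigma> = convex_cone hull S"
  using assms simplicial_cone_primitive_generators[of \<sigma>]
  unfolding simplicial_fan_def simplicial_gens_def by blast

lemma span_convex_cone_hull: "span (convex_cone hull S) = span S"
  by (meson antisym convex_cone_hull_subset_span hull_subset span_minimal span_mono subspace_span)

lemma aff_dim_simplicial_hull:
  fixes S :: "'a::euclidean_space set"
  assumes "independent S"
  shows "aff_dim (convex_cone hull S) = int (card S)"
proof -
  have "aff_dim (convex_cone hull S) = int (dim (convex_cone hull S))"
    by (intro aff_dim_zero hull_inc zero_in_convex_cone_hull)
  also have "dim (convex_cone hull S) = card S"
    using assms by (metis dim_span dim_eq_card_independent span_convex_cone_hull)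
  finally show ?thesis .
qed

lemma span_eq_UNIV_3:
  fixes S :: "(real ^ 3) set"
  assumes "independent S" "card S = 3"
  shows "span S = UNIV"
  using assms dim_eq_card_independent[OF assms(1)] by (simp flip: dim_eq_full)

lemma representation_sum_generators:
  fixes S :: "'a::euclidean_space set"
  assumes S: "independent S" "t \<in> S"
  shows "representation S (\<Sum>s\<in>S. s) t = 1"
proof -
  have "representation S (\<Sum>s\<in>S. s) t = (\<Sum>s\<in>S. representation S s t)"
    using S(1) by (simp add: representation_sum span_base)
  also have "\<dots> = (\<Sum>s\<in>S. if s = t then 1 else 0)"
    using S(1) by (intro sum.cong) (auto simp: representation_basis)
  also have "\<dots> = 1" using independent_imp_finite[OF S(1)] S(2) by simp
  finally show ?thesis .
qed

text \<open>Positivity of all coordinates defines a nonempty open set, which finitely many sets of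
  dimension at most two, being null sets, cannot cover.\<close>

lemma simplicial_hull_generic_point:
  fixes S :: "(real ^ 3) set"
  assumes S: "independent S" "card S = 3"
    and V: "finite V" "\<And>U. U \<in> V \<Longrightarrow> dim U \<le> 2"
  obtains y where "y \<in> convex_cone hull S" "\<And>s. s \<in> S \<Longrightarrow> 0 < representation S y s" "y \<notin> \<Union>V"
proof -
  have span: "span S = UNIV" by (rule span_eq_UNIV_3[OF S])
  have fin: "finite S" by (rule independent_imp_finite[OF S(1)])
  define P where "P = (\<Inter>s\<in>S. {y. 0 < representation S y s})"
  have "linear (\<lambda>v. representation S v s)" for s
    by (rule linearI) (simp_all add: representation_add representation_scale S span)
  then have "continuous_on UNIV (\<lambda>v. representation S v s)" for s
    by (rule linear_continuous_on[OF linear_conv_bounded_linear[THEN iffD1]])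
  then have "open P"
    unfolding P_def using fin by (intro open_INT ballI open_Collect_less continuous_on_const) auto
  moreover have "(\<Sum>s\<in>S. s) \<in> P"
    using representation_sum_generators[OF S(1)] by (simp add: P_def)
  ultimately have "\<not> negligible P" using open_not_negligible by blast
  moreover have "negligible (\<Union>V)"
    using V by (intro negligible_Union negligible_lowdim) fastforce+
  ultimately obtain y where y: "y \<in> P" "y \<notin> \<Union>V"
    by (meson negligible_subset subsetI)
  show thesis
  proof (rule that[OF _ _ y(2)])
    show "y \<in> convex_cone hull S"
      using y(1) span by (auto simp: simplicial_hull_eq[OF S(1)] P_def less_imp_le)
  qed (use y(1) in \<open>auto simp: P_def\<close>)
qed

lemma face_of_simplicial_hullE:
  assumes "independent S" "\<tau> \<in> cone_faces (convex_cone hull S)"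
  obtains T where "T \<subseteq> S" "\<tau> = convex_cone hull T"
  using assms cone_faces_simplicial_hull[OF assms(1)] by auto

text \<open>In a larger cone of the fan the given one would be a face, generated by some of the
  generators; but three is the largest possible number of them.\<close>

lemma maximal_cone_full_dim:
  assumes fan: "simplicial_fan \<Sigma>" and R: "simplicial_gens R" "card R = 3" "convex_cone hull R \<in> \<Sigma>"
  shows "maximal_cone \<Sigma> (convex_cone hull R)"
  unfolding maximal_cone_def
proof (intro conjI ballI impI)
  fix \<sigma> assume \<sigma>: "\<sigma> \<in> \<Sigma>" "convex_cone hull R \<subseteq> \<sigma>"
  obtain S where S: "simplicial_gens S" "\<sigma> = convex_cone hull S"
    using simplicial_fan_gens[OF fan \<sigma>(1)] .
  have "convex_cone hull R \<inter> \<sigma> \<in> cone_faces \<sigma>"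
    using fan R(3) \<sigma>(1) by (auto simp: simplicial_fan_def fan_def)
  then have "convex_cone hull R \<in> (\<lambda>T. convex_cone hull T) ` Pow S"
    using \<sigma>(2) cone_faces_simplicial_hull[OF simplicial_gensD(1)[OF S(1)]] S(2) by (simp add: Int_absorb2)
  then obtain T where T: "T \<subseteq> S" "convex_cone hull R = convex_cone hull T" by auto
  then have "R = T"
    using simplicial_gens_hull_inj R(1) S(1) simplicial_gens_subset by blast
  then have "R = S"
    using T(1) R(2) simplicial_gensD(2,3)[OF S(1)] by (metis card_seteq)
  then show "\<sigma> = convex_cone hull R" using S by simp
qed (rule R)

text \<open>Local concavity of the piecewise linear function \<open>lform\<close> along walls implies global
  concavity: move from \<open>S\<close> to \<open>x\<close> along a segment that avoids the cones of dimension at most one,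
  and consider the last point of the segment lying in a cone on which the form has not increased.\<close>

lemma nef_lform_le:
  assumes fan: "simplicial_fan \<Sigma>" and nef: "canonical_nef \<Sigma>" and conv: "convex (\<Union>\<Sigma>)"
    and S: "simplicial_gens S" "card S = 3" "convex_cone hull S \<in> \<Sigma>" and x: "x \<in> \<Union>\<Sigma>"
  obtains R where "simplicial_gens R" "card R = 3" "convex_cone hull R \<in> \<Sigma>"
    "x \<in> convex_cone hull R" "lform (convex_cone hull R) x \<le> lform (convex_cone hull S) x"
proof -
  have fin: "finite \<Sigma>" using fan by (simp add: simplicial_fan_def fan_def)
  \<comment> \<open>Together with \<open>x\<close> such a cone spans at most a plane. A
    \<open>y\<close> off all these planes makes the segment avoid the small cones until it reaches
    \<open>x\<close>.\<close>
  define low where "low = {\<sigma> \<in> \<Sigma>. dim \<sigma> \<le> 1}"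
  have "dim U \<le> 2" if "U \<in> (\<lambda>\<sigma>. span (insert x \<sigma>)) ` low" for U
    using that by (auto simp: low_def dim_insert)
  moreover have "finite ((\<lambda>\<sigma>. span (insert x \<sigma>)) ` low)" using fin by (simp add: low_def)
  ultimately obtain y where
    y: "y \<in> convex_cone hull S" "y \<notin> \<Union>((\<lambda>\<sigma>. span (insert x \<sigma>)) ` low)"
    using simplicial_hull_generic_point[OF simplicial_gensD(1)[OF S(1)] S(2)] by metis
  define p where "p t = (1 - t) *\<^sub>R y + t *\<^sub>R x" for t
  have p_union: "p t \<in> \<Union>\<Sigma>" if "0 \<le> t" "t \<le> 1" for t
    unfolding p_def using that y(1) S(3) x by (intro convexD[OF conv]) auto
  have avoid: "p t \<notin> \<sigma>" if \<sigma>: "\<sigma> \<in> \<Sigma>" "dim \<sigma> \<le> 1" and t: "t < 1" for t \<sigma>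
  proof
    assume "p t \<in> \<sigma>"
    then have "p t \<in> span (insert x \<sigma>)" by (simp add: span_base)
    then have "(1 / (1 - t)) *\<^sub>R (p t - t *\<^sub>R x) \<in> span (insert x \<sigma>)"
      by (intro span_scale span_diff) (auto intro: span_base)
    moreover have "(1 / (1 - t)) *\<^sub>R (p t - t *\<^sub>R x) = y" using t by (simp add: p_def)
    ultimately show False using y(2) \<sigma> by (auto simp: low_def)
  qed
  \<comment> \<open>The cones among which the last point of the segment is sought. They are finitely
    many and closed, so a last parameter \<open>t0\<close> exists.\<close>
  define G where "G = {R. simplicial_gens R \<and> card R = 3 \<and> convex_cone hull R \<in> \<Sigma> \<and>
    lform (convex_cone hull R) x \<le> lform (convex_cone hull S) x}"
  have "G \<subseteq> ray_gens ` \<Sigma>"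
  proof
    fix R assume "R \<in> G"
    then show "R \<in> ray_gens ` \<Sigma>"
      using simplicial_gensD(7)[of R] by (auto simp: G_def intro!: image_eqI[of R ray_gens "convex_cone hull R"])
  qed
  then have finG: "finite G" using fin finite_surj by blast
  have "S \<in> G" using S by (simp add: G_def)
  have closed: "closed \<sigma>" if "\<sigma> \<in> \<Sigma>" for \<sigma>
    using simplicial_fan_gens[OF fan that] simplicial_gensD(2) closed_convex_cone_hull by metis
  have cont: "continuous_on T p" for T unfolding p_def by (intro continuous_intros)
  define A where "A = (\<Union>R\<in>G. {0..1} \<inter> p -` (convex_cone hull R))"
  have "compact A"
    unfolding A_def using finG closed cont
    by (intro compact_UN) (auto simp: G_def compact_eq_bounded_closed intro!: continuous_closed_preimage bounded_Int)
  moreover have "0 \<in> A" using \<open>S \<in> G\<close> y(1) by (auto simp: A_def p_def)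
  ultimately obtain t0 where t0: "t0 \<in> A" "\<And>t. t \<in> A \<Longrightarrow> t \<le> t0"
    using compact_attains_sup[of A] by auto
  obtain R where R: "R \<in> G" "p t0 \<in> convex_cone hull R" and t01: "0 \<le> t0" "t0 \<le> 1"
    using t0(1) by (auto simp: A_def)
  have R': "simplicial_gens R" "card R = 3" "convex_cone hull R \<in> \<Sigma>"
    "lform (convex_cone hull R) x \<le> lform (convex_cone hull S) x"
    using R(1) by (auto simp: G_def)
  show thesis
  proof (cases "t0 = 1")
    case True
    then have "x \<in> convex_cone hull R" using R(2) by (simp add: p_def)
    then show thesis using that R' by blast
  next
    case False
    then have t0_less: "t0 < 1" using t01 by simp
    \<comment> \<open>Parameters decreasing to \<open>t0\<close>. One cone contains infinitely many
      of the corresponding points and, being closed, also \<open>p t0\<close>.\<close>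
    define s where "s n = t0 + (1 - t0) / real (Suc n)" for n
    have s: "t0 < s n" "s n \<le> 1" for n
    proof -
      have "(1 - t0) / real (Suc n) \<le> 1 - t0"
        using t0_less by (simp add: divide_le_eq mult_le_cancel_left1)
      then show "t0 < s n" "s n \<le> 1" using t0_less by (auto simp: s_def)
    qed
    have "s \<longlonglongrightarrow> t0 + 0"
      unfolding s_def using LIMSEQ_Suc[OF lim_const_over_n, of "1 - t0"] by (intro tendsto_intros) auto
    then have s_lim: "(\<lambda>n. p (s n)) \<longlonglongrightarrow> p t0"
      unfolding p_def by (auto intro!: tendsto_eq_intros)
    have "\<exists>\<sigma>\<in>\<Sigma>. p (s n) \<in> \<sigma>" for n
      using p_union[of "s n"] s[of n] t01 by auto
    then obtain f where f: "\<And>n. f n \<in> \<Sigma>" "\<And>n. p (s n) \<in> f n" by metis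
    have "finite (range f)" using f(1) fin by (meson finite_subset image_subsetI)
    then obtain n0 where inf: "infinite {n. f n = f n0}"
      using pigeonhole_infinite[of UNIV f] by auto
    define \<omega> where "\<omega> = f n0"
    have \<omega>: "\<omega> \<in> \<Sigma>" "p (s n0) \<in> \<omega>" using f by (auto simp: \<omega>_def)
    have "p t0 \<in> \<omega>"
    proof -
      obtain r :: "nat \<Rightarrow> nat" where r: "strict_mono r" "\<And>n. r n \<in> {n. f n = f n0}"
        using infinite_enumerate[OF inf] by auto
      have "(\<lambda>n. p (s (r n))) \<longlonglongrightarrow> p t0"
        using LIMSEQ_subseq_LIMSEQ[OF s_lim r(1)] by (simp add: o_def)
      moreover have "p (s (r n)) \<in> \<omega>" for n using f(2)[of "r n"] r(2) by (auto simp: \<omega>_def)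
      ultimately show ?thesis
        using Lim_in_closed_set[OF closed[OF \<omega>(1)], of "\<lambda>n. p (s (r n))" sequentially] by simp
    qed
    obtain Q where Q: "simplicial_gens Q" "\<omega> = convex_cone hull Q"
      using simplicial_fan_gens[OF fan \<omega>(1)] .
    have "Q \<notin> G"
    proof
      assume "Q \<in> G"
      then have "s n0 \<in> A" using \<omega>(2) Q s[of n0] t01 by (auto simp: A_def)
      then show False using t0(2) s(1)[of n0] by fastforce
    qed
    have "convex_cone hull R \<inter> \<omega> \<in> cone_faces (convex_cone hull R) \<inter> cone_faces \<omega>"
      using fan R'(3) \<omega>(1) by (auto simp: simplicial_fan_def fan_def)
    then have faces: "convex_cone hull R \<inter> \<omega> \<in> cone_faces (convex_cone hull R)"
        "convex_cone hull R \<inter> \<omega> \<in> cone_faces (convex_cone hull Q)"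
      and face_in: "convex_cone hull R \<inter> \<omega> \<in> \<Sigma>"
      using fan R'(3) Q(2) by (auto simp: simplicial_fan_def fan_def)
    obtain U where U1: "U \<subseteq> R" "convex_cone hull R \<inter> \<omega> = convex_cone hull U"
      using face_of_simplicial_hullE[OF simplicial_gensD(1)[OF R'(1)] faces(1)] .
    obtain U' where U2: "U' \<subseteq> Q" "convex_cone hull R \<inter> \<omega> = convex_cone hull U'"
      using face_of_simplicial_hullE[OF simplicial_gensD(1)[OF Q(1)] faces(2)] .
    note U = U1 U2
    have "U = U'"
      using U simplicial_gens_hull_inj simplicial_gens_subset R'(1) Q(1) by metis
    have UQ: "U \<subseteq> Q" using U \<open>U = U'\<close> by simp
    have gensU: "simplicial_gens U" using U R'(1) simplicial_gens_subset by blast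
    have z: "p t0 \<in> convex_cone hull U" using R(2) \<open>p t0 \<in> \<omega>\<close> U by blast
    \<comment> \<open>A common face of dimension at most one would contain \<open>p t0\<close>,
      which the choice of \<open>y\<close> excludes.\<close>
    have card_U_ge: "2 \<le> card U"
    proof (rule ccontr)
      assume "\<not> 2 \<le> card U"
      then have "dim (convex_cone hull U) \<le> 1"
        using simplicial_gensD(1)[OF gensU]
        by (metis dim_span dim_eq_card_independent span_convex_cone_hull not_less_eq_eq Suc_1 le_less_Suc_eq not_less One_nat_def)
      then show False using avoid[of "convex_cone hull U" t0] face_in U(2) z t0_less by simp
    qed
    have finR: "finite R" "finite Q" using R'(1) Q(1) simplicial_gensD by auto
    have "U \<noteq> R"
    proof
      assume "U = R"
      then have "R = Q" using UQ R'(2) finR simplicial_gensD(3)[OF Q(1)] by (metis card_seteq)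
      then show False using \<open>Q \<notin> G\<close> R by simp
    qed
    then have "U \<subset> R" using U1 by blast
    then have "card U < 3" using psubset_card_mono[of R U] finR R'(2) by simp
    then have cardU: "card U = 2" using card_U_ge by simp
    have "U \<noteq> Q"
    proof
      assume "U = Q"
      then have "p (s n0) \<in> convex_cone hull R" using \<omega> Q U by blast
      then have "s n0 \<in> A" using R s[of n0] t01 by (auto simp: A_def)
      then show False using t0(2) s(1)[of n0] by fastforce
    qed
    then have "U \<subset> Q" using UQ by blast
    then have "2 < card Q" using psubset_card_mono[of Q U] finR cardU by simp
    then have cardQ: "card Q = 3" using simplicial_gensD(3)[OF Q(1)] by simp
    obtain v where v: "v \<in> Q" "v \<notin> U" using UQ \<open>U \<noteq> Q\<close> by blast
    have Q_eq: "Q = insert v U"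
    proof (rule card_subset_eq[symmetric, OF finR(2)])
      show "insert v U \<subseteq> Q" using v UQ by simp
      show "card (insert v U) = card Q"
        using v cardU cardQ finite_subset[OF UQ finR(2)] by simp
    qed
    have "v \<notin> convex_cone hull R"
    proof
      assume "v \<in> convex_cone hull R"
      then have "v \<in> convex_cone hull U" using v Q U by (metis IntI hull_inc)
      then show False using generator_in_hull_iff[OF simplicial_gensD(1)[OF Q(1)] UQ v(1)] v by simp
    qed
    moreover have "adjacent_cones (convex_cone hull R) \<omega>"
      unfolding adjacent_cones_def facet_of_def U1(2) unfolding Q(2)
      using simplicial_hull_face[OF simplicial_gensD(1)[OF R'(1)] U1(1)]
        simplicial_hull_face[OF simplicial_gensD(1)[OF Q(1)] UQ]
        aff_dim_simplicial_hull[OF simplicial_gensD(1)] gensU R'(1) Q(1) cardU cardQ R'(2)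
      by (simp add: convex_cone_hull_nonempty)
    moreover have "maximal_cone \<Sigma> (convex_cone hull R)" "maximal_cone \<Sigma> \<omega>"
      using maximal_cone_full_dim[OF fan] R' Q cardQ \<omega> by auto
    moreover have "v \<in> ray_gens \<omega>" using v Q simplicial_gensD(7) by auto
    ultimately have v_ge: "1 \<le> lform (convex_cone hull R) v"
      using nef unfolding canonical_nef_def by blast
    \<comment> \<open>The drop of the form across the wall: zero on the wall and, by the nef
      condition, nonnegative at the new generator, hence on \<open>\<omega>\<close>. Along the
      segment it is affine, zero at \<open>t0\<close> and nonnegative at the later parameter
      \<open>s n0\<close>, hence nonnegative at \<open>x\<close>. This puts \<open>Q\<close> into
      \<open>G\<close>, against the maximality of \<open>t0\<close>.\<close>
    define D where "D u = lform (convex_cone hull R) u - lform \<omega> u" for u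
    have linD: "linear D"
      unfolding D_def using simplicial_gensD(8) R' Q by (intro linear_compose_sub) auto
    have DU: "D u = 0" if "u \<in> U" for u
      using simplicial_gensD(9)[OF R'(1) subsetD[OF U1(1) that]]
        simplicial_gensD(9)[OF Q(1) subsetD[OF UQ that]] by (simp add: D_def Q(2))
    have Dv: "0 \<le> D v" using v_ge simplicial_gensD(9)[OF Q(1) v(1)] by (simp add: D_def Q(2))
    have "D (p t0) = 0"
    proof -
      have "0 \<le> D (p t0)"
        by (rule linear_nonneg_on_convex_cone_hull[OF linD _ z]) (simp add: DU)
      moreover have "0 \<le> - D (p t0)"
        by (rule linear_nonneg_on_convex_cone_hull[OF linear_compose_neg[OF linD] _ z]) (simp add: DU)
      ultimately show ?thesis by simp
    qed
    moreover have "0 \<le> D (p (s n0))"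
      by (rule linear_nonneg_on_convex_cone_hull[OF linD _ \<omega>(2)[unfolded Q(2)]])
         (use DU Dv Q_eq in auto)
    moreover have "D (p t) = (1 - t) * D y + t * D x" for t
      using linD by (simp add: p_def linear_add linear_scale)
    ultimately have "0 \<le> D x"
    proof -
      assume a: "D (p t0) = 0" "0 \<le> D (p (s n0))" "\<And>t. D (p t) = (1 - t) * D y + t * D x"
      have "(1 - t0) * D (p (s n0)) = (1 - s n0) * D (p t0) + (s n0 - t0) * D x"
        unfolding a(3) by (simp add: algebra_simps)
      moreover have "0 \<le> (1 - t0) * D (p (s n0))" using a(2) t0_less by simp
      ultimately have "0 \<le> (s n0 - t0) * D x" using a(1) by simp
      then show ?thesis using s(1)[of n0] by (simp add: zero_le_mult_iff)
    qed
    then have "Q \<in> G" using R' Q cardQ \<omega> by (auto simp: G_def D_def)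
    then show thesis using \<open>Q \<notin> G\<close> by simp
  qed
qed

section \<open>Spectra of monoid rings\<close>

lemma is_subringD:
  assumes "is_subring B"
  shows "1 \<in> B" "0 \<in> B" "\<And>x y. x \<in> B \<Longrightarrow> y \<in> B \<Longrightarrow> x - y \<in> B"
    "\<And>x y. x \<in> B \<Longrightarrow> y \<in> B \<Longrightarrow> x * y \<in> B" "\<And>x y. x \<in> B \<Longrightarrow> y \<in> B \<Longrightarrow> x + y \<in> B"
    "\<And>x n. x \<in> B \<Longrightarrow> x ^ n \<in> B"
proof -
  show 1: "1 \<in> B" and diff: "\<And>x y. x \<in> B \<Longrightarrow> y \<in> B \<Longrightarrow> x - y \<in> B"
    and mult: "\<And>x y. x \<in> B \<Longrightarrow> y \<in> B \<Longrightarrow> x * y \<in> B"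
    using assms by (auto simp: is_subring_def)
  show 0: "0 \<in> B" using diff[OF 1 1] by simp
  show "x + y \<in> B" if "x \<in> B" "y \<in> B" for x y
    using diff[OF that(1) diff[OF 0 that(2)]] by simp
  show "x ^ n \<in> B" if "x \<in> B" for x n
    using that by (induction n) (auto intro: 1 mult)
qed

lemma is_subring_hull: "is_subring (is_subring hull X)"
  by (rule hull_in) (auto simp: is_subring_def)

lemma is_subring_sum:
  assumes "is_subring B" "\<And>i. i \<in> I \<Longrightarrow> f i \<in> B"
  shows "sum f I \<in> B"
  using assms(2)
  by (induction I rule: infinite_finite_induct) (auto intro: is_subringD[OF assms(1)])

text \<open>For \<open>s \<noteq> 0\<close> this set is the localization of \<open>B\<close> at the
  powers of \<open>s\<close>. As it is a subring, bounds on denominators have to be checked on ring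
  generators only.\<close>

lemma is_subring_denominators:
  fixes B :: "'a::field set"
  assumes B: "is_subring B" and s: "s \<in> B"
  shows "is_subring {b. \<exists>n. b * s ^ n \<in> B}"
  unfolding is_subring_def
proof (intro conjI ballI)
  show "1 \<in> {b. \<exists>n. b * s ^ n \<in> B}" using is_subringD(1)[OF B] by (auto intro: exI[of _ 0])
  fix x y assume "x \<in> {b. \<exists>n. b * s ^ n \<in> B}" "y \<in> {b. \<exists>n. b * s ^ n \<in> B}"
  then obtain n k where nk: "x * s ^ n \<in> B" "y * s ^ k \<in> B" by auto
  have "(x - y) * s ^ (n + k) = (x * s ^ n) * s ^ k - (y * s ^ k) * s ^ n"
    by (simp add: power_add algebra_simps)
  also have "\<dots> \<in> B" using nk s is_subringD(3,4,6)[OF B] by blast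
  finally show "x - y \<in> {b. \<exists>n. b * s ^ n \<in> B}" by blast
  have "x * y * s ^ (n + k) = (x * s ^ n) * (y * s ^ k)" by (simp add: power_add algebra_simps)
  also have "\<dots> \<in> B" using nk by (rule is_subringD(4)[OF B])
  finally show "x * y \<in> {b. \<exists>n. b * s ^ n \<in> B}" by blast
qed

text \<open>The assumptions say that \<open>B' = B[1/s]\<close>, so this is the inclusion of a
  principal open subset. A prime \<open>P\<close> of \<open>B'\<close> contains no power of
  \<open>s\<close>; clearing denominators by such powers identifies the local ring at
  \<open>P\<close> with that of \<open>B\<close> at \<open>P \<inter> B\<close>.\<close>

lemma Spec_model_localization:
  fixes B B' :: "'a::field set"
  assumes B: "is_subring B" and B': "is_subring B'" and sub: "B \<subseteq> B'"
    and s: "s \<in> B" "s \<noteq> 0" "1 / s \<in> B'" and den: "\<And>b. b \<in> B' \<Longrightarrow> \<exists>n. b * s ^ n \<in> B"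
  shows "Spec_model B' \<subseteq> Spec_model B"
proof
  fix X assume "X \<in> Spec_model B'"
  then obtain P where P: "is_prime_ideal P B'" and X: "X = localize_at B' P"
    by (auto simp: Spec_model_def)
  note Pdef = P[unfolded is_prime_ideal_def]
  have Pmult: "\<And>b x. b \<in> B' \<Longrightarrow> x \<in> P \<Longrightarrow> b * x \<in> P" and one: "1 \<notin> P"
    and Pprime: "\<And>a b. a \<in> B' \<Longrightarrow> b \<in> B' \<Longrightarrow> a * b \<in> P \<Longrightarrow> a \<in> P \<or> b \<in> P"
    and P0: "0 \<in> P"
    using Pdef by auto
  have "s \<notin> P"
    using Pmult[OF s(3), of s] one s(2) by auto
  have pow: "s ^ n \<notin> P" for n
  proof (induction n)
    case (Suc n)
    then show ?case
      using Pprime[of s "s ^ n"] \<open>s \<notin> P\<close> sub s(1) is_subringD(6)[OF B'] by auto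
  qed (use one in simp)
  have "is_prime_ideal (P \<inter> B) B"
    unfolding is_prime_ideal_def
  proof (intro conjI ballI impI)
    fix a b assume "a \<in> B" "b \<in> B" "a * b \<in> P \<inter> B"
    then show "a \<in> P \<inter> B \<or> b \<in> P \<inter> B" using Pprime sub by blast
  next
    fix b x assume "b \<in> B" "x \<in> P \<inter> B"
    then show "b * x \<in> P \<inter> B" using Pmult sub is_subringD(4)[OF B] by blast
  next
    fix x y assume "x \<in> P \<inter> B" "y \<in> P \<inter> B"
    then show "x + y \<in> P \<inter> B" using Pdef is_subringD(5)[OF B] by blast
  qed (use one P0 is_subringD(2)[OF B] in auto)
  moreover have "localize_at B' P = localize_at B (P \<inter> B)"
  proof (intro equalityI subsetI)
    fix z assume "z \<in> localize_at B' P"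
    then obtain b t where bt: "b \<in> B'" "t \<in> B'" "t \<notin> P" "z = b / t"
      by (auto simp: localize_at_def)
    obtain n k where n: "b * s ^ n \<in> B" and k: "t * s ^ k \<in> B" using den bt by blast
    have "b * s ^ (n + k) = (b * s ^ n) * s ^ k" "t * s ^ (n + k) = (t * s ^ k) * s ^ n"
      by (simp_all add: power_add algebra_simps)
    then have "b * s ^ (n + k) \<in> B" "t * s ^ (n + k) \<in> B"
      using n k s(1) is_subringD(4,6)[OF B] by metis+
    moreover have "t * s ^ (n + k) \<notin> P"
      using Pprime[OF bt(2), of "s ^ (n + k)"] pow bt(3) sub s(1) is_subringD(6)[OF B'] by blast
    moreover have "z = (b * s ^ (n + k)) / (t * s ^ (n + k))" using s(2) bt by simp
    ultimately show "z \<in> localize_at B (P \<inter> B)"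
      unfolding localize_at_def by blast
  next
    fix z assume "z \<in> localize_at B (P \<inter> B)"
    then show "z \<in> localize_at B' P" using sub by (auto simp: localize_at_def)
  qed
  ultimately show "X \<in> Spec_model B" by (auto simp: X Spec_model_def)
qed

section \<open>Constants, characters and monoid rings\<close>

lemma
  shows base_const_0 [simp]: "base_const 0 = 0"
    and base_const_1 [simp]: "base_const 1 = 1"
    and base_const_add: "base_const (a + b) = base_const a + base_const b"
    and base_const_minus: "base_const (- a) = - base_const a"
    and base_const_mult: "base_const (a * b) = base_const a * base_const b"
  by (simp_all add: base_const_def Zero_fract_def One_fract_def one_pCons mult.commute)

lemma
  shows character_0 [simp]: "character 0 = (1 :: ('k::field) torus_field)"
    and character_add: "character (m + n) = (character m * character n :: 'k torus_field)"
    and character_nonzero [simp]: "character m \<noteq> (0 :: 'k torus_field)"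
proof -
  have nz: "Fract [:[:[:0, 1:]:]:] 1 \<noteq> (0 :: 'k torus_field)"
    "Fract [:[:0, 1:]:] 1 \<noteq> (0 :: 'k torus_field)" "Fract [:0, 1:] 1 \<noteq> (0 :: 'k torus_field)"
    by (simp_all add: Zero_fract_def eq_fract)
  show "character 0 = (1 :: 'k torus_field)" by (simp add: character_def)
  show "character (m + n) = (character m * character n :: 'k torus_field)"
    using nz by (simp add: character_def power_int_add mult_ac)
  show "character m \<noteq> (0 :: 'k torus_field)"
    using nz by (simp add: character_def)
qed

lemma character_minus: "character (- m) = 1 / character m"
  using character_add[of m "- m"] by (simp add: field_simps)

lemma character_diff: "character (m - n) = character m / character n"
  using character_add[of m "- n"] by (simp add: character_minus)

definition submonoid3 :: "(int ^ 3) set \<Rightarrow> bool" where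
  "submonoid3 M \<longleftrightarrow> 0 \<in> M \<and> (\<forall>m\<in>M. \<forall>n\<in>M. m + n \<in> M)"

lemma submonoid3D:
  assumes "submonoid3 M"
  shows "0 \<in> M" "\<And>m n. m \<in> M \<Longrightarrow> n \<in> M \<Longrightarrow> m + n \<in> M"
    "\<And>m k. m \<in> M \<Longrightarrow> int k *s m \<in> M"
    "\<And>I f. (\<And>i. i \<in> I \<Longrightarrow> f i \<in> M) \<Longrightarrow> sum f I \<in> M"
proof -
  show zero: "0 \<in> M" and add: "\<And>m n. m \<in> M \<Longrightarrow> n \<in> M \<Longrightarrow> m + n \<in> M"
    using assms by (auto simp: submonoid3_def)
  show "int k *s m \<in> M" if "m \<in> M" for m k
  proof (induction k)
    case (Suc k)
    have "int (Suc k) *s m = m + int k *s m" by (simp add: vec_eq_iff algebra_simps)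
    then show ?case using Suc that add by simp
  qed (use zero in simp)
  show "sum f I \<in> M" if "\<And>i. i \<in> I \<Longrightarrow> f i \<in> M" for I f
    using that by (induction I rule: infinite_finite_induct) (auto intro: zero add)
qed

text \<open>The ring \<open>toric_ring\<close> for an arbitrary set of exponents; this separates the
  algebra of the charts from the geometry of the cones.\<close>

definition monoid_ring :: "(int ^ 3) set \<Rightarrow> ('k::field) torus_field set" where
  "monoid_ring M = {\<Sum>m\<in>S. base_const (c m) * character m | S c. finite S \<and> S \<subseteq> M}"

lemma toric_ring_eq_monoid_ring: "toric_ring \<sigma> = monoid_ring (dual_lattice_points \<sigma>)"
  by (simp add: toric_ring_def monoid_ring_def)

lemma monoid_ring_monomial:
  assumes "m \<in> M"
  shows "base_const a * character m \<in> monoid_ring M"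
  unfolding monoid_ring_def using assms
  by (intro CollectI exI[of _ "{m}"] exI[of _ "\<lambda>_. a"]) auto

lemma monoid_ring_character: "m \<in> M \<Longrightarrow> character m \<in> monoid_ring M"
  using monoid_ring_monomial[of m M 1] by simp

lemma monoid_ring_base_const: "submonoid3 M \<Longrightarrow> base_const a \<in> monoid_ring M"
  using monoid_ring_monomial[of 0 M a] submonoid3D(1) by simp

lemma monoid_ring_0: "0 \<in> monoid_ring M"
  unfolding monoid_ring_def by (intro CollectI exI[of _ "{}"]) auto

lemma monoid_ring_add:
  assumes "x \<in> monoid_ring M" "y \<in> monoid_ring M"
  shows "x + y \<in> monoid_ring M"
proof -
  obtain S c where S: "finite S" "S \<subseteq> M" "x = (\<Sum>m\<in>S. base_const (c m) * character m)"
    using assms(1) by (auto simp: monoid_ring_def)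
  obtain T d where T: "finite T" "T \<subseteq> M" "y = (\<Sum>m\<in>T. base_const (d m) * character m)"
    using assms(2) by (auto simp: monoid_ring_def)
  define e where "e m = (if m \<in> S then c m else 0) + (if m \<in> T then d m else 0)" for m
  have "(\<Sum>m\<in>S \<union> T. base_const (e m) * character m) =
      (\<Sum>m\<in>S \<union> T. base_const (if m \<in> S then c m else 0) * character m) +
      (\<Sum>m\<in>S \<union> T. base_const (if m \<in> T then d m else 0) * character m)"
    by (simp add: e_def base_const_add distrib_right sum.distrib)
  also have "(\<Sum>m\<in>S \<union> T. base_const (if m \<in> S then c m else 0) * character m) = x"
    unfolding S(3) using S(1) T(1) by (intro sum.mono_neutral_cong_right) auto
  also have "(\<Sum>m\<in>S \<union> T. base_const (if m \<in> T then d m else 0) * character m) = y"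
    unfolding T(3) using S(1) T(1) by (intro sum.mono_neutral_cong_right) auto
  finally have "x + y = (\<Sum>m\<in>S \<union> T. base_const (e m) * character m)" by simp
  then show ?thesis unfolding monoid_ring_def using S(1,2) T(1,2) by blast
qed

lemma monoid_ring_sum: "(\<And>i. i \<in> I \<Longrightarrow> f i \<in> monoid_ring M) \<Longrightarrow> sum f I \<in> monoid_ring M"
  by (induction I rule: infinite_finite_induct) (auto intro: monoid_ring_0 monoid_ring_add)

lemma is_subring_monoid_ring:
  assumes M: "submonoid3 M"
  shows "is_subring (monoid_ring M)"
  unfolding is_subring_def
proof (intro conjI ballI)
  show "1 \<in> monoid_ring M" using monoid_ring_base_const[OF M, of 1] by simp
  fix x y :: "'a torus_field" assume x: "x \<in> monoid_ring M" and y: "y \<in> monoid_ring M"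
  obtain S c where S: "finite S" "S \<subseteq> M" "x = (\<Sum>m\<in>S. base_const (c m) * character m)"
    using x by (auto simp: monoid_ring_def)
  obtain T d where T: "finite T" "T \<subseteq> M" "y = (\<Sum>m\<in>T. base_const (d m) * character m)"
    using y by (auto simp: monoid_ring_def)
  have "- y = (\<Sum>m\<in>T. base_const (- d m) * character m)"
    by (simp add: T(3) base_const_minus sum_negf)
  also have "\<dots> \<in> monoid_ring M"
    using T(2) by (intro monoid_ring_sum monoid_ring_monomial) auto
  finally show "x - y \<in> monoid_ring M" using monoid_ring_add[OF x, of "- y"] by simp
  have "x * y = (\<Sum>m\<in>S. \<Sum>n\<in>T. base_const (c m * d n) * character (m + n))"
    by (simp add: S(3) T(3) sum_product base_const_mult character_add mult_ac)
  also have "\<dots> \<in> monoid_ring M"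
    using S(2) T(2) submonoid3D(2)[OF M] by (intro monoid_ring_sum monoid_ring_monomial) auto
  finally show "x * y \<in> monoid_ring M" .
qed

text \<open>Together with \<open>submonoid3_characters\<close> this reduces inclusions of rings to
  inclusions of exponent monoids.\<close>

lemma monoid_ring_least:
  fixes B :: "('k::field) torus_field set"
  assumes "is_subring B" "\<And>a. base_const a \<in> B" "\<And>m. m \<in> M \<Longrightarrow> character m \<in> B"
  shows "monoid_ring M \<subseteq> B"
proof
  fix x :: "'k torus_field" assume "x \<in> monoid_ring M"
  then obtain S c where S: "S \<subseteq> M" "x = (\<Sum>m\<in>S. base_const (c m) * character m)"
    by (auto simp: monoid_ring_def)
  show "x \<in> B"
    unfolding S(2) using S(1) assms
    by (intro is_subring_sum is_subringD(4)[OF assms(1)]) auto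
qed

lemma submonoid3_characters:
  assumes "is_subring B"
  shows "submonoid3 {m. character m \<in> B}"
  using is_subringD(1,4)[OF assms] by (auto simp: submonoid3_def character_add)

text \<open>By the assumptions \<open>M'\<close> arises from \<open>M\<close> by inverting
  \<open>u\<close>, so the larger ring is the localization of the smaller one at the character of
  \<open>u\<close>.\<close>

lemma Spec_model_monoid_ring_face:
  assumes M: "submonoid3 M" and M': "submonoid3 M'" and sub: "M \<subseteq> M'"
    and u: "u \<in> M" "- u \<in> M'" and den: "\<And>m. m \<in> M' \<Longrightarrow> \<exists>n. m + int n *s u \<in> M"
  shows "Spec_model (monoid_ring M') \<subseteq> Spec_model (monoid_ring M :: ('k::field) torus_field set)"
proof (rule Spec_model_localization)
  let ?B = "monoid_ring M :: 'k torus_field set" and ?B' = "monoid_ring M' :: 'k torus_field set"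
  show B: "is_subring ?B" and B': "is_subring ?B'"
    using M M' by (auto intro: is_subring_monoid_ring)
  show "?B \<subseteq> ?B'"
    using sub by (intro monoid_ring_least B' monoid_ring_base_const M' monoid_ring_character) auto
  show s: "character u \<in> ?B" "character u \<noteq> (0 :: 'k torus_field)" "1 / character u \<in> ?B'"
    using u by (auto intro: monoid_ring_character simp flip: character_minus)
  have pow: "character (int n *s m) = (character m ^ n :: 'k torus_field)" for n m
  proof (induction n)
    case (Suc n)
    have "int (Suc n) *s m = m + int n *s m" by (simp add: vec_eq_iff algebra_simps)
    then show ?case using Suc by (simp add: character_add)
  qed simp
  have "?B' \<subseteq> {b. \<exists>n. b * character u ^ n \<in> ?B}"
  proof (rule monoid_ring_least[OF is_subring_denominators[OF B s(1)]])
    show "base_const a \<in> {b. \<exists>n. b * character u ^ n \<in> ?B}" for a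
      using monoid_ring_base_const[OF M, of a] by (intro CollectI exI[of _ 0]) simp
    show "character m \<in> {b. \<exists>n. b * character u ^ n \<in> ?B}" if m: "m \<in> M'" for m
    proof -
      obtain n where "m + int n *s u \<in> M" using den[OF m] by blast
      then have "character m * character u ^ n \<in> ?B"
        using monoid_ring_character by (metis character_add pow)
      then show ?thesis by blast
    qed
  qed
  then show "\<exists>n. b * character u ^ n \<in> ?B" if "b \<in> ?B'" for b using that by blast
qed

text \<open>After multiplication by \<open>k\<close>, the exponent \<open>N m_i + u\<close> becomes
  a combination of the \<open>m_l\<close> of total weight \<open>k N\<close> plus \<open>s\<close>.
  The weight left for \<open>m_i\<close> is \<open>k N\<close> minus the sum of the
  \<open>c l\<close>, nonnegative by assumption, so the differences to \<open>m_j\<close> add up to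
  an element of \<open>M\<close>.\<close>

lemma submonoid3_convex_combination:
  assumes M: "submonoid3 M" and k: "(\<Sum>l\<in>I. c l) \<le> k * N"
    and m: "d \<in> M" "\<And>l. l \<in> I \<Longrightarrow> m l - m j \<in> M" "s \<in> M" "m i - m j = d"
    and eq: "int k *s u = (\<Sum>l\<in>I. int (c l) *s (m l - m i)) + s"
  shows "int k *s (int N *s m i + u - int N *s m j) \<in> M"
proof -
  have "int k *s (int N *s m i + u - int N *s m j) =
      int (k * N - (\<Sum>l\<in>I. c l)) *s d + (\<Sum>l\<in>I. int (c l) *s (m l - m j)) + s" (is "_ = ?r")
  proof (subst vec_eq_iff, rule allI)
    fix x
    have "(int k *s u) $ x = ((\<Sum>l\<in>I. int (c l) *s (m l - m i)) + s) $ x" by (simp only: eq)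
    then have "int k * u $ x = (\<Sum>l\<in>I. int (c l) * m l $ x) - (\<Sum>l\<in>I. int (c l)) * m i $ x + s $ x"
      by (simp add: algebra_simps sum_subtractf sum_distrib_left sum_distrib_right)
    moreover have "?r $ x = (int k * int N - (\<Sum>l\<in>I. int (c l))) * (m i $ x - m j $ x) +
        ((\<Sum>l\<in>I. int (c l) * m l $ x) - (\<Sum>l\<in>I. int (c l)) * m j $ x) + s $ x"
      using k by (simp add: of_nat_diff m(4)[symmetric] algebra_simps sum_subtractf sum_distrib_left sum_distrib_right)
    ultimately show "(int k *s (int N *s m i + u - int N *s m j)) $ x = ?r $ x"
      by (simp add: algebra_simps)
  qed
  also have "\<dots> \<in> M"
    using m by (intro submonoid3D[OF M]) auto
  finally show ?thesis .
qed

text \<open>The coordinates are the characters \<open>N m\<^sub>i + u\<close>, where \<open>u\<close> is \<open>0\<close> or one of the finitely many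
  generators of \<open>M\<^sub>i\<close>. The chart of \<open>N m\<^sub>i\<close> is the spectrum of the \<open>i\<close>th monoid ring. For large
  \<open>N\<close> a multiple of \<open>N m\<^sub>i + u\<close> is a convex combination of the \<open>N m\<^sub>j\<close>, up to an element of \<open>M\<close>,
  in which \<open>N m\<^sub>i\<close> occurs; hence the character of \<open>u\<close> is invertible on the chart of \<open>N m\<^sub>i + u\<close>.\<close>

lemma projective_over_monoid_rings:
  fixes M' :: "'i \<Rightarrow> (int ^ 3) set" and m :: "'i \<Rightarrow> int ^ 3" and Gen :: "'i \<Rightarrow> (int ^ 3) set"
  assumes I: "finite I" "I \<noteq> {}"
    and M: "submonoid3 M" and M': "\<And>i. i \<in> I \<Longrightarrow> submonoid3 (M' i)"
    and sub: "\<And>i. i \<in> I \<Longrightarrow> M \<subseteq> M' i"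
    and sat: "\<And>i u k. i \<in> I \<Longrightarrow> 0 < k \<Longrightarrow> int k *s u \<in> M' i \<Longrightarrow> u \<in> M' i"
    and diff: "\<And>i j. i \<in> I \<Longrightarrow> j \<in> I \<Longrightarrow> m j - m i \<in> M' i"
    and fin: "\<And>i. i \<in> I \<Longrightarrow> finite (Gen i)" and Gen_sub: "\<And>i. i \<in> I \<Longrightarrow> Gen i \<subseteq> M' i"
    and Gen: "\<And>i X. i \<in> I \<Longrightarrow> submonoid3 X \<Longrightarrow> Gen i \<subseteq> X \<Longrightarrow> M' i \<subseteq> X"
    and rat: "\<And>i u. i \<in> I \<Longrightarrow> u \<in> M' i \<Longrightarrow> \<exists>k>0. \<exists>c. \<exists>s\<in>M.
      int k *s u = (\<Sum>j\<in>I. int (c j) *s (m j - m i)) + s"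
  shows "projective_over (\<Union>i\<in>I. Spec_model (monoid_ring (M' i)))
    (monoid_ring M :: ('k::field) torus_field set)"
proof -
  \<comment> \<open>Multiplier, coefficients and remainder of a relation from \<open>rat\<close> are
    packed into one tuple, so that they are chosen together.\<close>
  define rel where "rel i u t \<longleftrightarrow> 0 < fst t \<and> snd (snd t) \<in> M \<and>
      int (fst t) *s u = (\<Sum>j\<in>I. int (fst (snd t) j) *s (m j - m i)) + snd (snd t)"
    for i u and t :: "nat \<times> ('i \<Rightarrow> nat) \<times> (int ^ 3)"
  define t where "t i u = (SOME t. rel i u t)" for i u
  define k c s where "k i u = fst (t i u)" and "c i u = fst (snd (t i u))"
    and "s i u = snd (snd (t i u))" for i u
  have kcs: "0 < k i u \<and> s i u \<in> M \<and>
      int (k i u) *s u = (\<Sum>j\<in>I. int (c i u j) *s (m j - m i)) + s i u"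
    if "i \<in> I" "u \<in> M' i" for i u
  proof -
    have "\<exists>t. rel i u t" using rat[OF that] by (force simp: rel_def)
    then have "rel i u (t i u)" unfolding t_def by (rule someI_ex)
    then show ?thesis by (simp add: rel_def k_def c_def s_def)
  qed
  \<comment> \<open>Exceeds the total weight of every chosen relation for a generator. As the
    multiplier is at least 1, \<open>k i u * N\<close> exceeds it as well.\<close>
  define N where "N = Suc (\<Sum>i\<in>I. \<Sum>u\<in>Gen i. \<Sum>j\<in>I. c i u j)"
  have N_gt: "(\<Sum>j\<in>I. c i u j) < N" if "i \<in> I" "u \<in> Gen i" for i u
  proof -
    have "(\<Sum>j\<in>I. c i u j) \<le> (\<Sum>u\<in>Gen i. \<Sum>j\<in>I. c i u j)"
      using that fin by (intro member_le_sum[where f = "\<lambda>u. \<Sum>j\<in>I. c i u j"]) auto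
    also have "\<dots> \<le> (\<Sum>i\<in>I. \<Sum>u\<in>Gen i. \<Sum>j\<in>I. c i u j)"
      using that I by (intro member_le_sum[where f = "\<lambda>i. \<Sum>u\<in>Gen i. \<Sum>j\<in>I. c i u j"]) auto
    finally show ?thesis by (simp add: N_def)
  qed
  have N_gt': "(\<Sum>j\<in>I. c i u j) < k i u * N" if "i \<in> I" "u \<in> Gen i" for i u
  proof -
    have "0 < k i u" using kcs[OF that(1)] Gen_sub that by blast
    then have "N \<le> k i u * N" by simp
    then show ?thesis using N_gt[OF that] by linarith
  qed
  \<comment> \<open>The inserted \<open>0\<close> contributes the vertices
    \<open>int N *s m i\<close>.\<close>
  define E where "E = (\<Union>i\<in>I. (\<lambda>u. int N *s m i + u) ` insert 0 (Gen i))"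
  define F where "F = (character ` E :: 'k torus_field set)"
  define chart where "chart e = is_subring hull (monoid_ring M \<union> {g / character e | g. g \<in> F})" for e
  have vertex_E: "int N *s m i \<in> E" if "i \<in> I" for i
    using that by (auto simp: E_def)
  have E_sub: "e - int N *s m j \<in> M' j" if "e \<in> E" "j \<in> I" for e j
  proof -
    obtain i u where iu: "i \<in> I" "u \<in> insert 0 (Gen i)" "e = int N *s m i + u"
      using \<open>e \<in> E\<close> unfolding E_def by blast
    show ?thesis
    proof (cases "u \<in> Gen i")
      case True
      then have u: "u \<in> M' i" using Gen_sub iu by blast
      have "int (k i u) *s (int N *s m i + u - int N *s m j) \<in> M' j"
      proof (rule submonoid3_convex_combination[OF M'[OF \<open>j \<in> I\<close>], where m = m and i = i
            and I = I and c = "c i u" and s = "s i u" and d = "m i - m j"])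
        show "(\<Sum>l\<in>I. c i u l) \<le> k i u * N" using N_gt'[OF iu(1) True] by simp
        show "int (k i u) *s u = (\<Sum>l\<in>I. int (c i u l) *s (m l - m i)) + s i u" "s i u \<in> M' j"
          using kcs[OF iu(1) u] sub[OF \<open>j \<in> I\<close>] by auto
      qed (use diff iu \<open>j \<in> I\<close> in auto)
      then show ?thesis using sat[OF \<open>j \<in> I\<close>] kcs[OF iu(1) u] iu(3) by blast
    next
      case False
      then have "e - int N *s m j = int N *s (m i - m j)"
        using iu by (simp add: vec_eq_iff algebra_simps)
      then show ?thesis
        using submonoid3D(3)[OF M'[OF \<open>j \<in> I\<close>] diff[OF \<open>j \<in> I\<close> iu(1)], of N] by metis
    qed
  qed
  have chart_subring: "is_subring (chart e)" for e
    unfolding chart_def by (rule is_subring_hull)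
  have chart_base: "monoid_ring M \<subseteq> chart e" for e
    unfolding chart_def by (meson hull_subset le_sup_iff)
  \<comment> \<open>The exponents of the characters in a chart: membership in the chart becomes
    arithmetic in this monoid.\<close>
  define X where "X e = {v. character v \<in> chart e}" for e
  have X: "submonoid3 (X e)" for e
    unfolding X_def by (rule submonoid3_characters[OF chart_subring])
  have MX: "M \<subseteq> X e" for e
    using chart_base monoid_ring_character unfolding X_def by blast
  have EX: "e' - e \<in> X e" if "e' \<in> E" for e e'
  proof -
    have "character e' / character e \<in> chart e"
      unfolding chart_def using that by (intro hull_inc) (auto simp: F_def)
    then show ?thesis by (simp add: X_def character_diff)
  qed
  have ring_sub_chart: "monoid_ring (M' i) \<subseteq> chart e" if "i \<in> I" "Gen i \<subseteq> X e" for i e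
  proof (rule monoid_ring_least[OF chart_subring])
    show "base_const a \<in> chart e" for a
      using monoid_ring_base_const[OF M] chart_base by blast
    show "character v \<in> chart e" if "v \<in> M' i" for v
      using Gen[OF \<open>i \<in> I\<close> X \<open>Gen i \<subseteq> X e\<close>] that by (auto simp: X_def)
  qed
  have base_sub: "monoid_ring M \<subseteq> (monoid_ring (M' i) :: 'k torus_field set)" if "i \<in> I" for i
    using that sub M' by (intro monoid_ring_least is_subring_monoid_ring)
      (auto intro: monoid_ring_base_const monoid_ring_character)
  have chart_vertex: "chart (int N *s m i) = monoid_ring (M' i)" if i: "i \<in> I" for i
  proof
    have "g / character (int N *s m i) \<in> monoid_ring (M' i)" if "g \<in> F" for g
      using that E_sub[OF _ i] by (auto simp: F_def monoid_ring_character simp flip: character_diff)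
    then show "chart (int N *s m i) \<subseteq> monoid_ring (M' i)"
      unfolding chart_def using base_sub[OF i] is_subring_monoid_ring[OF M'[OF i]]
      by (intro hull_minimal) auto
    have "Gen i \<subseteq> X (int N *s m i)"
    proof
      fix u assume "u \<in> Gen i"
      then have "int N *s m i + u \<in> E" using i by (auto simp: E_def)
      from EX[OF this, of "int N *s m i"] show "u \<in> X (int N *s m i)" by simp
    qed
    then show "monoid_ring (M' i) \<subseteq> chart (int N *s m i)" by (rule ring_sub_chart[OF i])
  qed
  have chart_other: "Spec_model (chart e) \<subseteq> Spec_model (monoid_ring (M' i))"
    if i: "i \<in> I" and u: "u \<in> Gen i" and e: "e = int N *s m i + u" for i u e
  proof (rule Spec_model_localization)
    have uM': "u \<in> M' i" using Gen_sub i u by blast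
    \<comment> \<open>Multiplying the relation for \<open>u\<close> by \<open>N\<close> and
      measuring from \<open>e\<close> instead of from the vertex leaves \<open>D u\<close> on the
      left, whence \<open>D u \<in> X e\<close>. Since \<open>D\<close> is positive and
      \<open>- u \<in> X e\<close>, adding \<open>D - 1\<close> copies of \<open>- u\<close> gives
      \<open>u \<in> X e\<close>.\<close>
    define D where "D = k i u * N - (\<Sum>j\<in>I. c i u j)"
    have D: "0 < D" using N_gt'[OF i u] by (simp add: D_def)
    have neg: "- u \<in> X e"
      using EX[OF vertex_E[OF i], of e] by (simp add: e)
    have "int D *s u = (\<Sum>j\<in>I. int (c i u j) *s (int N *s m j - e)) + int N *s s i u"
    proof (subst vec_eq_iff, rule allI)
      fix x
      have "(int (k i u) *s u) $ x = ((\<Sum>l\<in>I. int (c i u l) *s (m l - m i)) + s i u) $ x"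
        using kcs[OF i uM'] by simp
      then have "int (k i u) * u $ x =
          (\<Sum>l\<in>I. int (c i u l) * m l $ x) - (\<Sum>l\<in>I. int (c i u l)) * m i $ x + s i u $ x"
        by (simp add: algebra_simps sum_subtractf sum_distrib_left sum_distrib_right)
      then have "int N * (int (k i u) * u $ x) = int N *
          ((\<Sum>l\<in>I. int (c i u l) * m l $ x) - (\<Sum>l\<in>I. int (c i u l)) * m i $ x + s i u $ x)"
        by simp
      then show "(int D *s u) $ x =
          ((\<Sum>j\<in>I. int (c i u j) *s (int N *s m j - e)) + int N *s s i u) $ x"
        using N_gt'[OF i u]
        by (simp add: D_def e of_nat_diff algebra_simps sum_subtractf sum.distrib sum_distrib_left sum_distrib_right)
    qed
    also have "\<dots> \<in> X e"
      using EX[OF vertex_E, of _ e] kcs[OF i uM'] MX by (intro submonoid3D[OF X]) auto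
    finally have "int D *s u \<in> X e" .
    then have "int D *s u + int (D - 1) *s (- u) \<in> X e"
      by (rule submonoid3D(2)[OF X _ submonoid3D(3)[OF X neg]])
    moreover have "int D *s u + int (D - 1) *s (- u) = u"
      using D by (simp add: vec_eq_iff of_nat_diff algebra_simps)
    ultimately have uX: "u \<in> X e" by simp
    show B: "is_subring (monoid_ring (M' i) :: 'k torus_field set)"
      by (rule is_subring_monoid_ring[OF M'[OF i]])
    show "is_subring (chart e)" by (rule chart_subring)
    show s: "character u \<in> (monoid_ring (M' i) :: 'k torus_field set)" "character u \<noteq> (0 :: 'k torus_field)"
      using uM' by (auto intro: monoid_ring_character)
    show "1 / character u \<in> chart e"
      using neg by (simp add: X_def character_minus)
    show "monoid_ring (M' i) \<subseteq> chart e"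
    proof (rule ring_sub_chart[OF i], rule)
      fix v assume "v \<in> Gen i"
      then have "int N *s m i + v \<in> E" using i by (auto simp: E_def)
      then have "(int N *s m i + v - e) + u \<in> X e" using EX uX submonoid3D(2)[OF X] by blast
      then show "v \<in> X e" by (simp add: e)
    qed
    have "chart e \<subseteq> {b. \<exists>n. b * character u ^ n \<in> monoid_ring (M' i)}"
      unfolding chart_def
    proof (rule hull_minimal, rule)
      show "is_subring {b. \<exists>n. b * character u ^ n \<in> (monoid_ring (M' i) :: 'k torus_field set)}"
        by (rule is_subring_denominators[OF B s(1)])
      fix b assume "b \<in> monoid_ring M \<union> {g / character e |g. g \<in> F}"
      then consider "b \<in> monoid_ring M" | e' where "e' \<in> E" "b = character e' / character e"
        by (auto simp: F_def)
      then show "b \<in> {b. \<exists>n. b * character u ^ n \<in> monoid_ring (M' i)}"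
      proof cases
        case 1
        then show ?thesis using base_sub[OF i] by (intro CollectI exI[of _ 0]) auto
      next
        case 2
        \<comment> \<open>\<open>e\<close> is the vertex plus \<open>u\<close>, so one factor
          \<open>character u\<close> turns a quotient by \<open>character e\<close> into a quotient
          by the character of the vertex.\<close>
        have "b * character u ^ 1 = character (e' - int N *s m i)"
          by (simp add: 2 e character_add character_diff)
        then have "b * character u ^ 1 \<in> monoid_ring (M' i)"
          using E_sub[OF 2(1) i] by (simp add: monoid_ring_character)
        then show ?thesis by blast
      qed
    qed
    then show "\<exists>n. b * character u ^ n \<in> monoid_ring (M' i)" if "b \<in> chart e" for b
      using that by blast
  qed
  have "(\<Union>i\<in>I. Spec_model (monoid_ring (M' i))) = (\<Union>e\<in>E. Spec_model (chart e))"
  proof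
    show "(\<Union>i\<in>I. Spec_model (monoid_ring (M' i))) \<subseteq> (\<Union>e\<in>E. Spec_model (chart e))"
    proof (rule UN_least)
      fix i assume i: "i \<in> I"
      show "Spec_model (monoid_ring (M' i)) \<subseteq> (\<Union>e\<in>E. Spec_model (chart e))"
        unfolding chart_vertex[OF i, symmetric] by (rule UN_upper[OF vertex_E[OF i]])
    qed
    show "(\<Union>e\<in>E. Spec_model (chart e)) \<subseteq> (\<Union>i\<in>I. Spec_model (monoid_ring (M' i)))"
    proof (rule UN_least)
      fix e assume "e \<in> E"
      then obtain i u where iu: "i \<in> I" "u \<in> insert 0 (Gen i)" "e = int N *s m i + u"
        unfolding E_def by blast
      show "Spec_model (chart e) \<subseteq> (\<Union>i\<in>I. Spec_model (monoid_ring (M' i)))"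
      proof (cases "u \<in> Gen i")
        case True
        show ?thesis
          by (rule order_trans[OF chart_other[OF iu(1) True iu(3)]]) (rule UN_upper[OF iu(1)])
      next
        case False
        then have "e = int N *s m i" using iu by simp
        then show ?thesis using UN_upper[OF iu(1), of "\<lambda>i. Spec_model (monoid_ring (M' i))"]
          by (simp only: chart_vertex[OF iu(1)])
      qed
    qed
  qed
  also have "\<dots> = (\<Union>f\<in>F. Spec_model (is_subring hull (monoid_ring M \<union> {g / f | g. g \<in> F})))"
    by (simp add: F_def chart_def)
  finally have "(\<Union>i\<in>I. Spec_model (monoid_ring (M' i))) =
      (\<Union>f\<in>F. Spec_model (is_subring hull (monoid_ring M \<union> {g / f | g. g \<in> F})))" .
  moreover have "finite F" "F \<noteq> {}" "0 \<notin> F"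
    using I fin vertex_E by (auto simp: F_def E_def)
  ultimately show ?thesis unfolding projective_over_def by blast
qed

section \<open>Regular triangulations by terminal cones\<close>

definition pair :: "int ^ 3 \<Rightarrow> real ^ 3 \<Rightarrow> real" where
  "pair m x = (\<Sum>i\<in>UNIV. real_of_int (m $ i) * x $ i)"

lemma linear_pair: "linear (pair m)"
  by (rule linearI) (simp_all add: pair_def algebra_simps sum.distrib sum_distrib_left)

lemma pair_simps [simp]:
  "pair 0 x = 0" "pair (- m) x = - pair m x"
  "pair (m + n) x = pair m x + pair n x" "pair (m - n) x = pair m x - pair n x"
  "pair (int k *s m) x = real k * pair m x" "pair m 0 = 0"
  by (simp_all add: pair_def algebra_simps sum.distrib sum_distrib_left sum_subtractf sum_negf)

lemma pair_sum: "pair (sum f I) x = (\<Sum>i\<in>I. pair (f i) x)"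
  by (induction I rule: infinite_finite_induct) auto

lemma pair_Ints: "x \<in> lattice3 \<Longrightarrow> pair m x \<in> \<int>"
  by (auto simp: pair_def lattice3_def)

lemma pair_eqI:
  assumes "span S = UNIV" "\<And>s. s \<in> S \<Longrightarrow> pair m s = pair n s"
  shows "m = n"
proof -
  have "pair m x = pair n x" for x
    using linear_eq_on_span[OF linear_pair linear_pair, of S m n x] assms by auto
  from this[of "axis i 1" for i] have "m $ i = n $ i" for i
    by (simp add: pair_def axis_def if_distrib sum.delta cong: if_cong)
  then show ?thesis by (simp add: vec_eq_iff)
qed

lemma dual_lattice_points_hull:
  "dual_lattice_points (convex_cone hull S) = {m. \<forall>s\<in>S. 0 \<le> pair m s}"
  unfolding dual_lattice_points_def pair_def[symmetric]
  using linear_nonneg_on_convex_cone_hull[OF linear_pair] by (blast intro: hull_inc)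

lemma submonoid3_dual_lattice_points: "submonoid3 (dual_lattice_points \<sigma>)"
  by (auto simp: submonoid3_def dual_lattice_points_def pair_def[symmetric])

lemma saturated_dual_lattice_points:
  "0 < k \<Longrightarrow> int k *s u \<in> dual_lattice_points \<sigma> \<Longrightarrow> u \<in> dual_lattice_points \<sigma>"
  by (simp add: dual_lattice_points_def pair_def[symmetric] zero_le_mult_iff)

lemma sum_generators_in_hull: "(\<Sum>s\<in>S. s) \<in> convex_cone hull S"
  using convex_cone_hull_sum[of S S "\<lambda>_. 1"] by (simp add: hull_inc)

text \<open>The form \<open>t w\<close> vanishes on the other generators, so subtracting it lowers
  only the value at \<open>w\<close>. Doing so while some value is too large ends in
  \<open>Gen\<close>. This set is finite because a form is determined by its values on
  \<open>S\<close>, which are integral and bounded here.\<close>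

lemma Gordan_simplicial:
  assumes S: "finite S" "span S = UNIV" "S \<subseteq> lattice3"
    and t: "\<And>w. w \<in> S \<Longrightarrow> 0 < pair (t w) w"
      "\<And>w w'. w \<in> S \<Longrightarrow> w' \<in> S \<Longrightarrow> w' \<noteq> w \<Longrightarrow> pair (t w) w' = 0"
  defines "Gen \<equiv> {u. \<forall>w\<in>S. 0 \<le> pair u w \<and> pair u w \<le> pair (t w) w}"
  shows "finite Gen" "Gen \<subseteq> dual_lattice_points (convex_cone hull S)"
    "\<And>X. submonoid3 X \<Longrightarrow> Gen \<subseteq> X \<Longrightarrow> dual_lattice_points (convex_cone hull S) \<subseteq> X"
proof -
  show sub: "Gen \<subseteq> dual_lattice_points (convex_cone hull S)"
    by (auto simp: Gen_def dual_lattice_points_hull)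
  have "(\<lambda>u. restrict (pair u) S) ` Gen \<subseteq> (\<Pi>\<^sub>E w\<in>S. {k \<in> \<int>. 0 \<le> k \<and> k \<le> pair (t w) w})"
    using S(3) by (auto simp: Gen_def intro!: pair_Ints)
  moreover have "finite (\<Pi>\<^sub>E w\<in>S. {k \<in> \<int>. 0 \<le> k \<and> k \<le> pair (t w) w})"
    using S(1) by (intro finite_PiE finite_int_segment)
  moreover have "inj_on (\<lambda>u. restrict (pair u) S) Gen"
    by (rule inj_onI, rule pair_eqI[OF S(2)]) (metis restrict_apply')
  ultimately show "finite Gen"
    by (meson finite_imageD finite_subset)
  fix X assume X: "submonoid3 X" "Gen \<subseteq> X"
  have "u \<in> X" if "\<forall>w\<in>S. 0 \<le> pair u w" for u
    using that
  \<comment> \<open>Each subtraction lowers the sum of the values by a positive integer, so the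
    floor of the sum decreases.\<close>
  proof (induction "nat \<lfloor>\<Sum>w\<in>S. pair u w\<rfloor>" arbitrary: u rule: less_induct)
    case less
    show ?case
    proof (cases "u \<in> Gen")
      case True
      then show ?thesis using X by auto
    next
      case False
      then obtain v where v: "v \<in> S" "pair (t v) v < pair u v"
        using less.prems by (auto simp: Gen_def not_le)
      have tv: "t v \<in> Gen"
        unfolding Gen_def
      proof (intro CollectI ballI)
        fix w assume "w \<in> S"
        then show "0 \<le> pair (t v) w \<and> pair (t v) w \<le> pair (t w) w"
          using t(1)[of w] t(2)[OF v(1), of w] by (cases "w = v") simp_all
      qed
      have nonneg: "\<forall>w\<in>S. 0 \<le> pair (u - t v) w"
      proof
        fix w assume "w \<in> S"
        then show "0 \<le> pair (u - t v) w"
          using less.prems v(2) t(2)[OF v(1), of w] by (cases "w = v") simp_all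
      qed
      have "(\<Sum>w\<in>S. pair (t v) w) = pair (t v) v"
        using S(1) v(1) t(2)[OF v(1)] by (subst sum.remove[OF _ v(1)]) auto
      moreover have "1 \<le> pair (t v) v"
        using t(1)[OF v(1)] pair_Ints[of v "t v"] v(1) S(3) Ints_nonzero_abs_ge1[of "pair (t v) v"]
        by fastforce
      ultimately have "(\<Sum>w\<in>S. pair (u - t v) w) \<le> (\<Sum>w\<in>S. pair u w) - 1"
        by (simp add: sum_subtractf)
      moreover have "0 \<le> (\<Sum>w\<in>S. pair (u - t v) w)" using nonneg by (intro sum_nonneg) auto
      ultimately have "nat \<lfloor>\<Sum>w\<in>S. pair (u - t v) w\<rfloor> < nat \<lfloor>\<Sum>w\<in>S. pair u w\<rfloor>" by linarith
      then have "u - t v \<in> X" using nonneg by (rule less.hyps)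
      then have "(u - t v) + t v \<in> X" using tv X(2) by (intro submonoid3D(2)[OF X(1)]) auto
      then show ?thesis by simp
    qed
  qed
  then show "dual_lattice_points (convex_cone hull S) \<subseteq> X"
    by (auto simp: dual_lattice_points_hull)
qed

text \<open>An integral certificate for a regular subdivision of the cone over \<open>E\<close> into
  terminal simplicial cones. The forms \<open>m G\<close> are \<open>M\<close> times the forms
  \<open>lform\<close> of the maximal cones, and \<open>m_off\<close> is strict concavity. The
  equations in \<open>walls\<close> are of the two kinds whose sign is known at a point where
  \<open>m G\<close> is minimal among the forms; hence no separate covering assumption
  occurs.\<close>

locale regular_triangulation =
  fixes E :: "(real ^ 3) set" and \<G> :: "(real ^ 3) set set" and m :: "(real ^ 3) set \<Rightarrow> int ^ 3"
    and M :: real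
  assumes finite_G: "finite \<G>" "\<G> \<noteq> {}"
    and gens: "G \<in> \<G> \<Longrightarrow> simplicial_gens G" "G \<in> \<G> \<Longrightarrow> card G = 3"
      "G \<in> \<G> \<Longrightarrow> G \<subseteq> convex_cone hull E"
    and M_pos: "0 < M"
    and m_on: "G \<in> \<G> \<Longrightarrow> w \<in> G \<Longrightarrow> pair (m G) w = M"
    and m_off: "G \<in> \<G> \<Longrightarrow> H \<in> \<G> \<Longrightarrow> w \<in> H \<Longrightarrow> w \<notin> G \<Longrightarrow> M < pair (m G) w"
    and walls: "G \<in> \<G> \<Longrightarrow> w \<in> G \<Longrightarrow> \<exists>t. 0 < pair t w \<and> (\<forall>w'\<in>G - {w}. pair t w' = 0) \<and>
      (t \<in> dual_lattice_points (convex_cone hull E) \<or> (\<exists>H\<in>\<G>. t = m H - m G))"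
    and terminal: "G \<in> \<G> \<Longrightarrow> x \<in> convex_cone hull G \<Longrightarrow> x \<in> lattice3 \<Longrightarrow> pair (m G) x \<le> M \<Longrightarrow>
      x = 0 \<or> x \<in> G"
begin

definition fan_of :: "(real ^ 3) set set" where
  "fan_of = (\<Union>G\<in>\<G>. (\<lambda>T. convex_cone hull T) ` Pow G)"

lemma indep: "G \<in> \<G> \<Longrightarrow> independent G"
  and span_G: "G \<in> \<G> \<Longrightarrow> span G = UNIV"
  and finite_gens: "G \<in> \<G> \<Longrightarrow> finite G"
  using simplicial_gensD(1,2)[OF gens(1)] span_eq_UNIV_3[OF simplicial_gensD(1)[OF gens(1)] gens(2)]
  by simp_all

lemma wall_form:
  assumes "G \<in> \<G>"
  obtains t where "\<And>w. w \<in> G \<Longrightarrow> 0 < pair (t w) w"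
    "\<And>w w'. w \<in> G \<Longrightarrow> w' \<in> G \<Longrightarrow> w' \<noteq> w \<Longrightarrow> pair (t w) w' = 0"
    "\<And>w. w \<in> G \<Longrightarrow> t w \<in> dual_lattice_points (convex_cone hull E) \<or> (\<exists>H\<in>\<G>. t w = m H - m G)"
proof -
  define Q where "Q w t \<longleftrightarrow> 0 < pair t w \<and> (\<forall>w'\<in>G - {w}. pair t w' = 0) \<and>
      (t \<in> dual_lattice_points (convex_cone hull E) \<or> (\<exists>H\<in>\<G>. t = m H - m G))" for w t
  have "\<forall>w\<in>G. \<exists>t. Q w t" unfolding Q_def using walls[OF assms] by blast
  then obtain t where "\<forall>w\<in>G. Q w (t w)" by metis
  then show thesis using that[of t] unfolding Q_def by blast
qed

lemma m_le: "G \<in> \<G> \<Longrightarrow> H \<in> \<G> \<Longrightarrow> w \<in> H \<Longrightarrow> M \<le> pair (m G) w"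
  using m_on m_off by (metis less_eq_real_def)

lemma m_diff_nonneg:
  assumes "G \<in> \<G>" "H \<in> \<G>" "x \<in> convex_cone hull H"
  shows "pair (m H) x \<le> pair (m G) x"
proof -
  have "0 \<le> pair (m G - m H) x"
    by (rule linear_nonneg_on_convex_cone_hull[OF linear_pair _ assms(3)])
       (use assms m_le m_on in auto)
  then show ?thesis by simp
qed

lemma hull_gens_subset: "G \<in> \<G> \<Longrightarrow> T \<subseteq> G \<Longrightarrow> convex_cone hull T \<subseteq> convex_cone hull E"
  using gens(3) by (intro hull_minimal convex_cone_convex_cone_hull) blast

text \<open>The cone containing \<open>x\<close> is the one whose form is minimal at \<open>x\<close>.\<close>

lemma hull_cover:
  assumes x: "x \<in> convex_cone hull E"
  obtains G where "G \<in> \<G>" "x \<in> convex_cone hull G"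
proof -
  obtain G where G: "G \<in> \<G>" "\<And>H. H \<in> \<G> \<Longrightarrow> pair (m G) x \<le> pair (m H) x"
  proof
    show "arg_min_on (\<lambda>G. pair (m G) x) \<G> \<in> \<G>" by (rule arg_min_if_finite(1)[OF finite_G])
    show "pair (m (arg_min_on (\<lambda>G. pair (m G) x) \<G>)) x \<le> pair (m H) x" if "H \<in> \<G>" for H
      using arg_min_least[OF finite_G that] .
  qed
  obtain t where t: "\<And>w. w \<in> G \<Longrightarrow> 0 < pair (t w) w"
    "\<And>w w'. w \<in> G \<Longrightarrow> w' \<in> G \<Longrightarrow> w' \<noteq> w \<Longrightarrow> pair (t w) w' = 0"
    "\<And>w. w \<in> G \<Longrightarrow> t w \<in> dual_lattice_points (convex_cone hull E) \<or> (\<exists>H\<in>\<G>. t w = m H - m G)"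
    using wall_form[OF G(1)] by blast
  have "0 \<le> representation G x w" if w: "w \<in> G" for w
  proof -
    have "pair (t w) x = (\<Sum>s\<in>G. representation G x s * pair (t w) s)"
      using span_G[OF G(1)] by (intro linear_eq_sum_representation linear_pair indep G) auto
    also have "\<dots> = representation G x w * pair (t w) w"
      using w t(2)[OF w] finite_gens[OF G(1)] by (subst sum.remove[OF _ w]) auto
    finally have "pair (t w) x = representation G x w * pair (t w) w" .
    \<comment> \<open>A supporting form of the whole cone is nonnegative at \<open>x\<close> anyway;
      a difference \<open>m H - m G\<close> is so because \<open>G\<close> minimizes the value at
      \<open>x\<close>.\<close>
    moreover have "0 \<le> pair (t w) x"
      using t(3)[OF w] x G(2) by (auto simp: dual_lattice_points_def pair_def[symmetric])
    ultimately show ?thesis using t(1)[OF w] by (simp add: zero_le_mult_iff)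
  qed
  then have "x \<in> convex_cone hull G"
    using simplicial_hull_eq[OF indep[OF G(1)]] span_G[OF G(1)] by auto
  then show thesis using that G(1) by blast
qed

text \<open>At a common point the forms of \<open>G\<close> and \<open>H\<close> agree. Their
  difference is nonnegative on the generators in \<open>G\<close> and positive on those outside
  \<open>H\<close>, so the coordinates of the point at the latter vanish.\<close>

lemma hull_Int_facets:
  assumes G: "G \<in> \<G>" and H: "H \<in> \<G>" and x: "x \<in> convex_cone hull G" "x \<in> convex_cone hull H"
  shows "x \<in> convex_cone hull (G \<inter> H)"
proof -
  let ?h = "\<lambda>s. representation G x s * pair (m H - m G) s"
  have rep: "0 \<le> representation G x s" if "s \<in> G" for s
    using x(1) that simplicial_hull_eq[OF indep[OF G]] by auto
  have "(\<Sum>s\<in>G. ?h s) = pair (m H - m G) x"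
    using span_G[OF G] by (intro linear_eq_sum_representation[symmetric] linear_pair indep G) auto
  also have "\<dots> = 0" using m_diff_nonneg[OF G H x(2)] m_diff_nonneg[OF H G x(1)] by simp
  finally have "\<forall>s\<in>G. ?h s = 0"
    using rep m_le[OF H G] m_on[OF G] finite_gens[OF G]
    by (subst (asm) sum_nonneg_eq_0_iff) auto
  then have "representation G x s = 0" if "s \<in> G - G \<inter> H" for s
    using that m_off[OF H G] m_on[OF G] by force
  then show ?thesis using x(1) simplicial_hull_subset_iff[OF indep[OF G], of "G \<inter> H" x] by auto
qed

text \<open>\<open>T\<close> and \<open>U\<close> need not lie in one simplex. Once
  \<open>hull_Int_facets\<close> has moved the point into the common face, one intersection inside
  \<open>G\<close> and one inside \<open>H\<close> suffice.\<close>

lemma hull_Int: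
  assumes G: "G \<in> \<G>" "T \<subseteq> G" and H: "H \<in> \<G>" "U \<subseteq> H"
  shows "convex_cone hull T \<inter> convex_cone hull U = convex_cone hull (T \<inter> U)"
proof
  show "convex_cone hull (T \<inter> U) \<subseteq> convex_cone hull T \<inter> convex_cone hull U"
    by (simp add: hull_mono)
  show "convex_cone hull T \<inter> convex_cone hull U \<subseteq> convex_cone hull (T \<inter> U)"
  proof
    fix x assume x: "x \<in> convex_cone hull T \<inter> convex_cone hull U"
    then have "x \<in> convex_cone hull G" "x \<in> convex_cone hull H"
      using hull_mono[OF G(2), of convex_cone] hull_mono[OF H(2), of convex_cone] by auto
    then have "x \<in> convex_cone hull T \<inter> convex_cone hull (G \<inter> H)"
      using hull_Int_facets[OF G(1) H(1)] x by auto
    then have "x \<in> convex_cone hull (T \<inter> H)"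
      using simplicial_hull_Int[OF indep[OF G(1)] G(2), of "G \<inter> H"] G(2)
      by (simp add: Int_absorb2 flip: Int_assoc)
    then have "x \<in> convex_cone hull (T \<inter> H) \<inter> convex_cone hull U" using x by auto
    then have "x \<in> convex_cone hull (T \<inter> H \<inter> U)"
      using simplicial_hull_Int[OF indep[OF H(1)] _ H(2), of "T \<inter> H"] by auto
    moreover have "T \<inter> H \<inter> U = T \<inter> U" using H(2) by auto
    ultimately show "x \<in> convex_cone hull (T \<inter> U)" by simp
  qed
qed

lemma fan_ofE:
  assumes "\<sigma> \<in> fan_of"
  obtains G T where "G \<in> \<G>" "T \<subseteq> G" "\<sigma> = convex_cone hull T" "simplicial_gens T"
  using assms gens(1) simplicial_gens_subset unfolding fan_of_def by blast

lemma fan_ofI: "G \<in> \<G> \<Longrightarrow> T \<subseteq> G \<Longrightarrow> convex_cone hull T \<in> fan_of"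
  unfolding fan_of_def by blast

lemma simplicial_fan_fan_of: "simplicial_fan fan_of"
  unfolding simplicial_fan_def fan_def
proof (intro conjI ballI)
  show "finite fan_of"
    unfolding fan_of_def using finite_G(1) finite_gens by (intro finite_UN_I finite_imageI) simp_all
next
  fix \<sigma> assume "\<sigma> \<in> fan_of"
  then obtain G T where T: "G \<in> \<G>" "T \<subseteq> G" "\<sigma> = convex_cone hull T" "simplicial_gens T"
    by (rule fan_ofE)
  note S = simplicial_gensD[OF T(4)]
  show "rational_cone \<sigma>"
    unfolding rational_cone_def T(3) using simplicial_hull_pointed[OF S(1)] S(2,5) by blast
  show "cone_faces \<sigma> \<subseteq> fan_of"
    unfolding T(3) cone_faces_simplicial_hull[OF S(1)] using fan_ofI[OF T(1)] T(2) by blast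
  show "simplicial_cone \<sigma>"
    unfolding simplicial_cone_def using S(1,5) T(3) by blast
  fix \<sigma>' assume "\<sigma>' \<in> fan_of"
  then obtain H U where U: "H \<in> \<G>" "U \<subseteq> H" "\<sigma>' = convex_cone hull U" "simplicial_gens U"
    by (rule fan_ofE)
  show "\<sigma> \<inter> \<sigma>' \<in> cone_faces \<sigma>" "\<sigma> \<inter> \<sigma>' \<in> cone_faces \<sigma>'"
    unfolding T(3) U(3) hull_Int[OF T(1,2) U(1,2)] cone_faces_simplicial_hull[OF S(1)]
      cone_faces_simplicial_hull[OF simplicial_gensD(1)[OF U(4)]]
    by auto
qed

lemma subdivision_fan_of: "subdivision_of fan_of (convex_cone hull E)"
  unfolding subdivision_of_def
proof
  show "fan fan_of" using simplicial_fan_fan_of by (simp add: simplicial_fan_def)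
  show "\<Union>fan_of = convex_cone hull E"
  proof (intro equalityI subsetI)
    fix x assume "x \<in> \<Union>fan_of"
    then show "x \<in> convex_cone hull E" using hull_gens_subset by (auto simp: fan_of_def)
  next
    fix x assume "x \<in> convex_cone hull E"
    then show "x \<in> \<Union>fan_of" using hull_cover fan_ofI by (metis UnionI order_refl)
  qed
qed

text \<open>Two linear forms that agree on \<open>T\<close> agree on its span. For a cone of lower
  dimension \<open>lform\<close> is an arbitrary choice outside the span.\<close>

lemma lform_fan_of:
  assumes G: "G \<in> \<G>" and T: "T \<subseteq> G" and x: "x \<in> span T"
  shows "lform (convex_cone hull T) x = pair (m G) x / M"
proof -
  have S: "simplicial_gens T" using gens(1)[OF G] simplicial_gens_subset T by blast
  have "linear (\<lambda>x. pair (m G) x / M)"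
    using linear_compose_scale_right[OF linear_pair, of "1 / M"] by simp
  then show ?thesis
    using T m_on[OF G] M_pos
    by (intro linear_eq_on_span[OF simplicial_gensD(8)[OF S] _ _ x])
       (simp_all add: simplicial_gensD(9)[OF S] subset_eq)
qed

lemma terminal_fan_of: "terminal_fan fan_of"
  unfolding terminal_fan_def
proof
  fix \<sigma> assume "\<sigma> \<in> fan_of"
  then obtain G T where T: "G \<in> \<G>" "T \<subseteq> G" "\<sigma> = convex_cone hull T" "simplicial_gens T"
    by (rule fan_ofE)
  note S = simplicial_gensD[OF T(4)]
  have "x = 0 \<or> x \<in> T" if x: "x \<in> shed \<sigma>" "x \<in> lattice3" for x
  proof -
    have xT: "x \<in> convex_cone hull T" and le: "lform \<sigma> x \<le> 1"
      using x T(3) by (auto simp: shed_def)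
    then have "x \<in> span T" using convex_cone_hull_subset_span by blast
    then have "pair (m G) x \<le> M"
      using le lform_fan_of[OF T(1,2)] T(3) M_pos by simp
    then have "x = 0 \<or> x \<in> G"
      using terminal[OF T(1)] x(2) xT hull_mono[OF T(2), of convex_cone] by blast
    then show ?thesis
      using generator_in_hull_iff[OF indep[OF T(1)] T(2)] xT by blast
  qed
  moreover have "t \<in> shed \<sigma>" "t \<in> lattice3" if "t \<in> T" for t
    using S(5,9)[OF that] that T(3) by (auto simp: shed_def hull_inc)
  moreover have "0 \<in> shed \<sigma>" "0 \<in> lattice3"
    using linear_0[OF S(8)] T(3) by (auto simp: shed_def lattice3_def)
  ultimately show "shed \<sigma> \<inter> lattice3 = insert 0 (ray_gens \<sigma>)"
    using S(7) T(3) by blast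
qed

lemma canonical_nef_fan_of: "canonical_nef fan_of"
  unfolding canonical_nef_def
proof (intro allI impI ballI)
  fix \<sigma> \<sigma>' v
  assume *: "maximal_cone fan_of \<sigma> \<and> maximal_cone fan_of \<sigma>' \<and> adjacent_cones \<sigma> \<sigma>'"
    and v: "v \<in> ray_gens \<sigma>' - \<sigma>"
  have max: "\<exists>G\<in>\<G>. \<tau> = convex_cone hull G" if \<tau>: "maximal_cone fan_of \<tau>" for \<tau>
  proof -
    have "\<tau> \<in> fan_of" using \<tau> by (simp add: maximal_cone_def)
    then obtain G T where T: "G \<in> \<G>" "T \<subseteq> G" "\<tau> = convex_cone hull T" by (rule fan_ofE)
    then have "convex_cone hull G = \<tau>"
      using \<tau> fan_ofI[OF T(1) order_refl] hull_mono[OF T(2), of convex_cone]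
      by (simp add: maximal_cone_def)
    then show ?thesis using T(1) by blast
  qed
  obtain G H where G: "G \<in> \<G>" "\<sigma> = convex_cone hull G" and H: "H \<in> \<G>" "\<sigma>' = convex_cone hull H"
    using max * by blast
  have "v \<in> H" using v simplicial_gensD(7)[OF gens(1)[OF H(1)]] by (simp add: H(2))
  moreover have "lform \<sigma> v = pair (m G) v / M"
    using lform_fan_of[OF G(1) order_refl, of v] span_G[OF G(1)] by (simp add: G(2))
  ultimately show "1 \<le> lform \<sigma> v" using m_le[OF G(1) H(1)] M_pos by simp
qed

end

section \<open>Projectivity of the toric scheme\<close>

context regular_triangulation
begin

abbreviation dual :: "(real ^ 3) set \<Rightarrow> (int ^ 3) set" where
  "dual T \<equiv> dual_lattice_points (convex_cone hull T)"

text \<open>The sum of the wall equations at the generators outside \<open>T\<close> is nonnegative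
  on the cone over \<open>G\<close> and vanishes there exactly on the face over \<open>T\<close>.
  Inverting its character gives the chart of the face.\<close>

lemma Spec_model_face:
  assumes G: "G \<in> \<G>" and T: "T \<subseteq> G"
  shows "Spec_model (toric_ring (convex_cone hull T)) \<subseteq>
    Spec_model (toric_ring (convex_cone hull G) :: ('k::field) torus_field set)"
proof -
  obtain t where t: "\<And>w. w \<in> G \<Longrightarrow> 0 < pair (t w) w"
    "\<And>w w'. w \<in> G \<Longrightarrow> w' \<in> G \<Longrightarrow> w' \<noteq> w \<Longrightarrow> pair (t w) w' = 0"
    "\<And>w. w \<in> G \<Longrightarrow> t w \<in> dual E \<or> (\<exists>H\<in>\<G>. t w = m H - m G)"
    using wall_form[OF G] by blast
  define u where "u = (\<Sum>w\<in>G - T. t w)"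
  have u_on: "pair u w = 0" if "w \<in> T" for w
    using that T t(2) by (auto simp: u_def pair_sum intro!: sum.neutral)
  have u_off: "pair u w = pair (t w) w" if w: "w \<in> G - T" for w
  proof -
    have "pair u w = pair (t w) w + (\<Sum>v\<in>G - T - {w}. pair (t v) w)"
      using w finite_gens[OF G] by (simp add: u_def pair_sum sum.remove[OF _ w])
    also have "(\<Sum>v\<in>G - T - {w}. pair (t v) w) = 0"
      using w t(2) by (intro sum.neutral) auto
    finally show ?thesis by simp
  qed
  have "\<exists>n. v + int n *s u \<in> dual G" if v: "v \<in> dual T" for v
  proof -
    \<comment> \<open>Large enough, because \<open>u\<close> has a positive integral value at each
      generator outside \<open>T\<close>.\<close>
    define n where "n = (\<Sum>w\<in>G. nat \<lceil>\<bar>pair v w\<bar>\<rceil>)"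
    have "0 \<le> pair (v + int n *s u) w" if w: "w \<in> G" for w
    proof (cases "w \<in> T")
      case True
      then show ?thesis using v u_on by (auto simp: dual_lattice_points_hull)
    next
      case False
      have "pair (t w) w \<in> \<int>" using w simplicial_gensD(5)[OF gens(1)[OF G]] by (intro pair_Ints)
      then have "1 \<le> pair (t w) w"
        using t(1)[OF w] Ints_nonzero_abs_ge1[of "pair (t w) w"] by fastforce
      then have "real n \<le> real n * pair (t w) w" by (simp add: mult_le_cancel_left1)
      moreover have "nat \<lceil>\<bar>pair v w\<bar>\<rceil> \<le> n"
        unfolding n_def using w finite_gens[OF G] by (intro member_le_sum) auto
      ultimately show ?thesis using u_off w False by simp
    qed
    then show ?thesis by (auto simp: dual_lattice_points_hull)
  qed
  moreover have "dual G \<subseteq> dual T" using T by (auto simp: dual_lattice_points_hull)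
  moreover have "u \<in> dual G"
  proof -
    have "0 \<le> pair u w" if "w \<in> G" for w
      using that u_on u_off t(1) by (cases "w \<in> T") (auto simp: less_imp_le)
    then show ?thesis by (auto simp: dual_lattice_points_hull)
  qed
  moreover have "- u \<in> dual T" using u_on by (auto simp: dual_lattice_points_hull)
  ultimately show ?thesis
    unfolding toric_ring_eq_monoid_ring
    by (intro Spec_model_monoid_ring_face submonoid3_dual_lattice_points) auto
qed

lemma toric_scheme_fan_of:
  "toric_scheme fan_of =
    (\<Union>G\<in>\<G>. Spec_model (monoid_ring (dual G) :: ('k::field) torus_field set))"
proof
  show "toric_scheme fan_of \<subseteq>
      (\<Union>G\<in>\<G>. Spec_model (monoid_ring (dual G) :: 'k torus_field set))"
    unfolding toric_scheme_def
  proof (rule UN_least)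
    fix \<sigma> assume "\<sigma> \<in> fan_of"
    then obtain G T where T: "G \<in> \<G>" "T \<subseteq> G" "\<sigma> = convex_cone hull T" by (rule fan_ofE)
    show "Spec_model (toric_ring \<sigma>) \<subseteq>
        (\<Union>G\<in>\<G>. Spec_model (monoid_ring (dual G) :: 'k torus_field set))"
      unfolding T(3)
      by (rule order_trans[OF Spec_model_face[OF T(1,2)]], unfold toric_ring_eq_monoid_ring)
         (rule UN_upper[OF T(1)])
  qed
  show "(\<Union>G\<in>\<G>. Spec_model (monoid_ring (dual G) :: 'k torus_field set)) \<subseteq> toric_scheme fan_of"
    unfolding toric_scheme_def toric_ring_eq_monoid_ring
  proof (rule UN_least)
    fix G assume "G \<in> \<G>"
    then show "Spec_model (monoid_ring (dual G)) \<subseteq>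
        (\<Union>\<sigma>\<in>fan_of. Spec_model (monoid_ring (dual_lattice_points \<sigma>) :: 'k torus_field set))"
      using fan_ofI[of G G] by (intro UN_upper) simp
  qed
qed

text \<open>The right-hand sides of assumption \<open>rat\<close> in
  \<open>projective_over_monoid_rings\<close>. As they form a monoid, it is enough to find the wall
  equations among them.\<close>

definition wall_monoid :: "(real ^ 3) set \<Rightarrow> (int ^ 3) set" where
  "wall_monoid G = {(\<Sum>H\<in>\<G>. int (c H) *s (m H - m G)) + s | c s. s \<in> dual E}"

lemma wall_monoidI:
  "s \<in> dual E \<Longrightarrow> x = (\<Sum>H\<in>\<G>. int (c H) *s (m H - m G)) + s \<Longrightarrow> x \<in> wall_monoid G"
  unfolding wall_monoid_def by blast

lemma submonoid3_wall_monoid: "submonoid3 (wall_monoid G)"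
  unfolding submonoid3_def
proof (intro conjI ballI)
  note D = submonoid3D[OF submonoid3_dual_lattice_points[of "convex_cone hull E"]]
  show "0 \<in> wall_monoid G" by (rule wall_monoidI[OF D(1), where c = "\<lambda>_. 0"]) simp
  fix x y assume "x \<in> wall_monoid G" "y \<in> wall_monoid G"
  then obtain c s d r where s: "s \<in> dual E" "x = (\<Sum>H\<in>\<G>. int (c H) *s (m H - m G)) + s"
    and r: "r \<in> dual E" "y = (\<Sum>H\<in>\<G>. int (d H) *s (m H - m G)) + r"
    unfolding wall_monoid_def by blast
  show "x + y \<in> wall_monoid G"
    by (rule wall_monoidI[OF D(2)[OF s(1) r(1)], where c = "\<lambda>H. c H + d H"])
       (simp add: s(2) r(2) vec_eq_iff algebra_simps sum.distrib sum_subtractf)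
qed

text \<open>Up to the positive integral factors \<open>d w\<close> the wall equations are the basis
  dual to \<open>G\<close>, so they generate \<open>dual G\<close> over the nonnegative rationals.
  The product of all \<open>d w\<close> clears the denominators.\<close>

lemma wall_monoid_multiple:
  assumes G: "G \<in> \<G>" and u: "u \<in> dual G"
  shows "\<exists>k>0. int k *s u \<in> wall_monoid G"
proof -
  obtain t where t: "\<And>w. w \<in> G \<Longrightarrow> 0 < pair (t w) w"
    "\<And>w w'. w \<in> G \<Longrightarrow> w' \<in> G \<Longrightarrow> w' \<noteq> w \<Longrightarrow> pair (t w) w' = 0"
    "\<And>w. w \<in> G \<Longrightarrow> t w \<in> dual E \<or> (\<exists>H\<in>\<G>. t w = m H - m G)"
    using wall_form[OF G] by blast
  have t_in: "t w \<in> wall_monoid G" if w: "w \<in> G" for w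
  proof (cases "t w \<in> dual E")
    case True
    then show ?thesis by (rule wall_monoidI[where c = "\<lambda>_. 0"]) simp
  next
    case False
    then obtain H where H: "H \<in> \<G>" "t w = m H - m G" using t(3)[OF w] by blast
    have "(\<Sum>K\<in>\<G>. int (if K = H then 1 else 0) *s (m K - m G)) =
        (\<Sum>K\<in>\<G>. if K = H then m K - m G else 0)"
      by (intro sum.cong) auto
    also have "\<dots> = t w" using H finite_G by simp
    finally show ?thesis
      by (intro wall_monoidI[OF submonoid3D(1)[OF submonoid3_dual_lattice_points],
            where c = "\<lambda>K. if K = H then 1 else 0"]) simp
  qed
  have nat_val: "pair v w = real (nat \<lfloor>pair v w\<rfloor>)" if "w \<in> G" "0 \<le> pair v w" for v w
    using pair_Ints[of w v] simplicial_gensD(5)[OF gens(1)[OF G] that(1)] that(2)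
    by (auto elim!: Ints_cases)
  define d where "d w = nat \<lfloor>pair (t w) w\<rfloor>" for w
  define a where "a w = nat \<lfloor>pair u w\<rfloor>" for w
  have d: "pair (t w) w = real (d w)" if "w \<in> G" for w
    unfolding d_def using nat_val[OF that] t(1)[OF that] by simp
  have a: "pair u w = real (a w)" if "w \<in> G" for w
    unfolding a_def using nat_val[OF that] u that by (simp add: dual_lattice_points_hull)
  define k where "k = (\<Prod>w\<in>G. d w)"
  have "0 < d w" if "w \<in> G" for w using t(1)[OF that] d[OF that] by simp
  then have "0 < k" unfolding k_def by (intro prod_pos) auto
  have "int k *s u = (\<Sum>w\<in>G. int (a w * (\<Prod>v\<in>G - {w}. d v)) *s t w)"
  proof (rule pair_eqI[OF span_G[OF G]])
    fix v assume v: "v \<in> G"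
    have "pair (\<Sum>w\<in>G. int (a w * (\<Prod>v\<in>G - {w}. d v)) *s t w) v =
        (\<Sum>w\<in>G. real (a w * (\<Prod>v\<in>G - {w}. d v)) * pair (t w) v)"
      by (simp only: pair_sum pair_simps)
    also have "\<dots> = real (a v * (\<Prod>v\<in>G - {v}. d v)) * pair (t v) v"
    proof -
      have "(\<Sum>w\<in>G - {v}. real (a w * (\<Prod>v\<in>G - {w}. d v)) * pair (t w) v) = 0"
        using t(2)[OF _ v] by (intro sum.neutral ballI) fastforce
      then show ?thesis using finite_gens[OF G] by (subst sum.remove[OF _ v]) auto
    qed
    also have "\<dots> = real (a v) * real (d v * (\<Prod>v\<in>G - {v}. d v))"
      by (simp only: d[OF v] of_nat_mult mult_ac)
    also have "d v * (\<Prod>v\<in>G - {v}. d v) = k"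
      unfolding k_def using finite_gens[OF G] v by (simp add: prod.remove)
    finally show "pair (int k *s u) v = pair (\<Sum>w\<in>G. int (a w * (\<Prod>v\<in>G - {w}. d v)) *s t w) v"
      by (simp add: a[OF v])
  qed
  also have "\<dots> \<in> wall_monoid G"
    using t_in by (intro submonoid3D(3,4)[OF submonoid3_wall_monoid])
  finally show ?thesis using \<open>0 < k\<close> by blast
qed

lemma projective_fan_of:
  "projective_over (toric_scheme fan_of :: ('k::field) torus_field set set)
    (toric_ring (convex_cone hull E))"
proof -
  have "\<exists>Gen. finite Gen \<and> Gen \<subseteq> dual G \<and> (\<forall>X. submonoid3 X \<longrightarrow> Gen \<subseteq> X \<longrightarrow> dual G \<subseteq> X)"
    if G: "G \<in> \<G>" for G
  proof -
    obtain t where t: "\<And>w. w \<in> G \<Longrightarrow> 0 < pair (t w) w"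
      "\<And>w w'. w \<in> G \<Longrightarrow> w' \<in> G \<Longrightarrow> w' \<noteq> w \<Longrightarrow> pair (t w) w' = 0"
      "\<And>w. w \<in> G \<Longrightarrow> t w \<in> dual E \<or> (\<exists>H\<in>\<G>. t w = m H - m G)"
      using wall_form[OF G] by blast
    have "G \<subseteq> lattice3" using simplicial_gensD(5)[OF gens(1)[OF G]] by blast
    note Gordan = Gordan_simplicial[OF finite_gens[OF G] span_G[OF G] this, of t]
    let ?Gen = "{u. \<forall>w\<in>G. 0 \<le> pair u w \<and> pair u w \<le> pair (t w) w}"
    have "finite ?Gen" by (rule Gordan(1)) (simp_all add: t(1,2))
    moreover have "?Gen \<subseteq> dual G" by (rule Gordan(2)) (simp_all add: t(1,2))
    moreover have "dual G \<subseteq> X" if "submonoid3 X" "?Gen \<subseteq> X" for X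
      by (rule Gordan(3)[OF _ _ that]) (simp_all add: t(1,2))
    ultimately show ?thesis by blast
  qed
  then obtain Gen where Gen: "\<And>G. G \<in> \<G> \<Longrightarrow> finite (Gen G)" "\<And>G. G \<in> \<G> \<Longrightarrow> Gen G \<subseteq> dual G"
    "\<And>G X. G \<in> \<G> \<Longrightarrow> submonoid3 X \<Longrightarrow> Gen G \<subseteq> X \<Longrightarrow> dual G \<subseteq> X"
    by metis
  show ?thesis
    unfolding toric_scheme_fan_of toric_ring_eq_monoid_ring
  proof (rule projective_over_monoid_rings[where m = m and Gen = Gen])
    fix G assume G: "G \<in> \<G>"
    show "dual E \<subseteq> dual G"
      using gens(3)[OF G] by (auto simp: dual_lattice_points_def intro: subsetD[OF hull_gens_subset[OF G order_refl]])
    show "m H - m G \<in> dual G" if "H \<in> \<G>" for H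
      using m_on[OF G] m_le[OF that G] by (auto simp: dual_lattice_points_hull)
    fix u assume "u \<in> dual G"
    from wall_monoid_multiple[OF G this]
    show "\<exists>k>0. \<exists>c. \<exists>s\<in>dual E. int k *s u = (\<Sum>H\<in>\<G>. int (c H) *s (m H - m G)) + s"
      by (simp add: wall_monoid_def) blast
  qed (use finite_G Gen saturated_dual_lattice_points in \<open>auto intro: submonoid3_dual_lattice_points\<close>)
qed

lemma minimal_terminal_model_fan_of:
  "minimal_terminal_model TYPE('k::{field,finite}) (convex_cone hull E) fan_of"
  unfolding minimal_terminal_model_def
  using simplicial_fan_fan_of subdivision_fan_of projective_fan_of terminal_fan_of canonical_nef_fan_of
  by blast

section \<open>Uniqueness of the minimal terminal model\<close>

lemma m_lattice_ge:
  assumes G: "G \<in> \<G>" and v: "v \<in> lattice3" "v \<noteq> 0" "v \<in> convex_cone hull E"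
  shows "M \<le> pair (m G) v" and "pair (m G) v \<le> M \<Longrightarrow> v \<in> G"
proof -
  obtain H where H: "H \<in> \<G>" "v \<in> convex_cone hull H" using hull_cover[OF v(3)] .
  \<comment> \<open>Terminality speaks about points of one cone at a time; passing to the cone
    \<open>H\<close> that contains \<open>v\<close> makes it applicable, and the form of
    \<open>G\<close> can only be larger there.\<close>
  have le: "pair (m H) v \<le> pair (m G) v" by (rule m_diff_nonneg[OF G H])
  show "M \<le> pair (m G) v"
  proof (cases "pair (m H) v \<le> M")
    case True
    then have "v \<in> H" using terminal[OF H v(1)] v(2) by blast
    then show ?thesis by (rule m_le[OF G H(1)])
  qed (use le in simp)
  assume "pair (m G) v \<le> M"
  then have "v \<in> H" using terminal[OF H v(1)] v(2) le by simp
  then show "v \<in> G" using m_off[OF G H(1)] \<open>pair (m G) v \<le> M\<close> by force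
qed

lemma dim_simplicial_hull: "simplicial_gens S \<Longrightarrow> dim (convex_cone hull S) = card S"
  using simplicial_gensD(1) by (metis dim_span dim_eq_card_independent span_convex_cone_hull)

lemma minimal_terminal_model_unique:
  assumes "minimal_terminal_model TYPE('k::{field,finite}) (convex_cone hull E) \<Sigma>"
  shows "\<Sigma> = fan_of"
proof -
  have fan: "simplicial_fan \<Sigma>" and union: "\<Union>\<Sigma> = convex_cone hull E"
    and tfan: "terminal_fan \<Sigma>" and nef: "canonical_nef \<Sigma>"
    using assms by (auto simp: minimal_terminal_model_def subdivision_of_def)
  have fin: "finite \<Sigma>" and faces: "\<And>\<sigma>. \<sigma> \<in> \<Sigma> \<Longrightarrow> cone_faces \<sigma> \<subseteq> \<Sigma>"
    using fan by (auto simp: simplicial_fan_def fan_def)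
  have conv: "convex (\<Union>\<Sigma>)" unfolding union by (rule convex_convex_cone_hull)
  have sub: "convex_cone hull S \<subseteq> convex_cone hull E" if "convex_cone hull S \<in> \<Sigma>" for S
    using that union by blast
  have full: "S \<in> \<G>" if S: "simplicial_gens S" "card S = 3" "convex_cone hull S \<in> \<Sigma>" for S
  proof -
    note SD = simplicial_gensD[OF S(1)]
    let ?l = "lform (convex_cone hull S)"
    have l_ge: "1 \<le> ?l w" if w: "w \<in> lattice3" "w \<noteq> 0" "w \<in> convex_cone hull E" for w
    proof -
      have "w \<in> \<Union>\<Sigma>" using w(3) union by simp
      then obtain R where R: "simplicial_gens R" "card R = 3" "convex_cone hull R \<in> \<Sigma>"
        "w \<in> convex_cone hull R" "lform (convex_cone hull R) w \<le> ?l w"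
        by (rule nef_lform_le[OF fan nef conv S])
      have "1 \<le> lform (convex_cone hull R) w"
        by (rule terminal_fan_lform_ge_1[OF simplicial_gensD(1,4)[OF R(1)] tfan R(3,4) w(1,2)])
      then show ?thesis using R(5) by simp
    qed
    define x where "x = (\<Sum>s\<in>S. s)"
    have "x \<in> convex_cone hull E"
      using sum_generators_in_hull[of S] sub[OF S(3)] by (auto simp: x_def)
    then obtain G where G: "G \<in> \<G>" "x \<in> convex_cone hull G" by (rule hull_cover)
    have SE: "s \<in> convex_cone hull E" if "s \<in> S" for s
      using that sub[OF S(3)] by (auto intro: hull_inc)
    have rep: "0 \<le> representation G x w" if "w \<in> G" for w
      using G that simplicial_hull_eq[OF indep[OF G(1)]] by auto
    have xG: "x \<in> span G" using span_G[OF G(1)] by simp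
    have "(\<Sum>s\<in>S. pair (m G) s) = pair (m G) x"
      by (simp add: x_def linear_sum[OF linear_pair])
    also have "\<dots> = (\<Sum>w\<in>G. representation G x w * pair (m G) w)"
      by (rule linear_eq_sum_representation[OF indep[OF G(1)] xG linear_pair])
    also have "\<dots> = M * (\<Sum>w\<in>G. representation G x w)"
      using m_on[OF G(1)] by (simp add: sum_distrib_left mult.commute)
    \<comment> \<open>The nef condition and terminality of \<open>\<Sigma>\<close> enter here: they
      make the form of \<open>S\<close> at least 1 on the generators in \<open>G\<close>.\<close>
    also have "(\<Sum>w\<in>G. representation G x w) \<le> (\<Sum>w\<in>G. representation G x w * ?l w)"
    proof (rule sum_mono)
      fix w assume w: "w \<in> G"
      have "1 \<le> ?l w"
        using l_ge simplicial_gensD(5,6)[OF gens(1)[OF G(1)] w] gens(3)[OF G(1)] w by blast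
      then show "representation G x w \<le> representation G x w * ?l w"
        using rep[OF w] by (simp add: mult_le_cancel_left1)
    qed
    also have "\<dots> = ?l x"
      by (rule linear_eq_sum_representation[OF indep[OF G(1)] xG SD(8), symmetric])
    also have "\<dots> = (\<Sum>s\<in>S. 1)"
      using SD(9) by (simp add: x_def linear_sum[OF SD(8)])
    finally have sum_le: "(\<Sum>s\<in>S. pair (m G) s) \<le> (\<Sum>s\<in>S. M)"
      using M_pos by (simp add: mult.commute)
    have "S \<subseteq> G"
    proof
      fix s assume s: "s \<in> S"
      have ge: "M \<le> pair (m G) r" if "r \<in> S" for r
        using m_lattice_ge(1)[OF G(1) SD(5,6)[OF that] SE[OF that]] .
      \<comment> \<open>All values on \<open>S\<close> are at least \<open>M\<close> and their sum
        is at most that of the bounds, so none of them exceeds \<open>M\<close>.\<close>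
      have "pair (m G) s \<le> M"
      proof (rule ccontr)
        assume "\<not> pair (m G) s \<le> M"
        then have "(\<Sum>s\<in>S. M) < (\<Sum>s\<in>S. pair (m G) s)"
          using s ge by (intro sum_strict_mono_ex1[OF SD(2)] ballI bexI[of _ s]) auto
        then show False using sum_le by simp
      qed
      then show "s \<in> G" by (rule m_lattice_ge(2)[OF G(1) SD(5,6)[OF s] SE[OF s]])
    qed
    then have "S = G" using card_subset_eq[OF finite_gens[OF G(1)]] S(2) gens(2)[OF G(1)] by simp
    then show ?thesis using G(1) by simp
  qed
  have facet: "convex_cone hull G \<in> \<Sigma>" if G: "G \<in> \<G>" for G
  proof -
    \<comment> \<open>A point off these spans lies in full-dimensional cones of
      \<open>\<Sigma>\<close> only, and these are already known to be cones over members of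
      \<open>\<G>\<close>.\<close>
    define V where "V = span ` {\<sigma> \<in> \<Sigma>. dim \<sigma> \<le> 2}"
    have "finite V" "\<And>U. U \<in> V \<Longrightarrow> dim U \<le> 2" using fin by (auto simp: V_def)
    then obtain y where y: "y \<in> convex_cone hull G" "\<And>s. s \<in> G \<Longrightarrow> 0 < representation G y s"
      "y \<notin> \<Union>V"
      using simplicial_hull_generic_point[OF indep[OF G] gens(2)[OF G]] by metis
    have "y \<in> \<Union>\<Sigma>" using y(1) hull_gens_subset[OF G order_refl] union by auto
    then obtain \<sigma> where \<sigma>: "\<sigma> \<in> \<Sigma>" "y \<in> \<sigma>" by blast
    obtain S where S: "simplicial_gens S" "\<sigma> = convex_cone hull S"
      using simplicial_fan_gens[OF fan \<sigma>(1)] .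
    have "\<not> dim \<sigma> \<le> 2"
    proof
      assume "dim \<sigma> \<le> 2"
      then have "span \<sigma> \<in> V" using \<sigma>(1) by (auto simp: V_def)
      then show False using y(3) \<sigma>(2) by (auto intro: span_base)
    qed
    then have "card S = 3"
      using dim_simplicial_hull[OF S(1)] S(2) simplicial_gensD(3)[OF S(1)] by simp
    then have "S \<in> \<G>" using full S \<sigma>(1) by simp
    have "y \<in> convex_cone hull (G \<inter> S)"
      using hull_Int_facets[OF G \<open>S \<in> \<G>\<close> y(1)] \<sigma>(2) S(2) by simp
    then have "\<forall>s\<in>G - G \<inter> S. representation G y s = 0"
      using simplicial_hull_subset_iff[OF indep[OF G], of "G \<inter> S" y] by simp
    then have "G \<subseteq> S" using y(2) by force
    then have "G = S"
      using card_subset_eq[OF finite_gens[OF \<open>S \<in> \<G>\<close>]] gens(2)[OF G] \<open>card S = 3\<close> by simp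
    then show ?thesis using \<sigma>(1) S(2) by simp
  qed
  show ?thesis
  proof (intro equalityI subsetI)
    fix \<tau> assume "\<tau> \<in> fan_of"
    then obtain G T where T: "G \<in> \<G>" "T \<subseteq> G" "\<tau> = convex_cone hull T" by (rule fan_ofE)
    then have "\<tau> \<in> cone_faces (convex_cone hull G)"
      using cone_faces_simplicial_hull[OF indep[OF T(1)]] by blast
    then show "\<tau> \<in> \<Sigma>" using faces[OF facet[OF T(1)]] by blast
  next
    fix \<tau> assume \<tau>: "\<tau> \<in> \<Sigma>"
    obtain T where T: "simplicial_gens T" "\<tau> = convex_cone hull T"
      using simplicial_fan_gens[OF fan \<tau>] .
    note TD = simplicial_gensD[OF T(1)]
    \<comment> \<open>A point on no proper face of \<open>\<tau>\<close>. The face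
      \<open>\<tau> \<inter> convex_cone hull G\<close> that contains it is therefore all of
      \<open>\<tau>\<close>.\<close>
    define x where "x = (\<Sum>s\<in>T. s)"
    have x\<tau>: "x \<in> \<tau>" unfolding x_def T(2) by (rule sum_generators_in_hull)
    then have "x \<in> convex_cone hull E" using \<tau> union by blast
    then obtain G where G: "G \<in> \<G>" "x \<in> convex_cone hull G" by (rule hull_cover)
    have Int: "\<tau> \<inter> convex_cone hull G \<in> cone_faces \<tau>"
      "\<tau> \<inter> convex_cone hull G \<in> cone_faces (convex_cone hull G)"
      using fan \<tau> facet[OF G(1)] by (auto simp: simplicial_fan_def fan_def)
    obtain U where U: "U \<subseteq> T" "\<tau> \<inter> convex_cone hull G = convex_cone hull U"
      using face_of_simplicial_hullE[OF TD(1) Int(1)[unfolded T(2)]] T(2) by metis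
    have "x \<in> convex_cone hull U" using U(2) x\<tau> G(2) by blast
    then have "\<forall>s\<in>T - U. representation T x s = 0"
      using simplicial_hull_subset_iff[OF TD(1) U(1)] by blast
    then have "T \<subseteq> U" using representation_sum_generators[OF TD(1)] x_def by force
    then have "\<tau> = \<tau> \<inter> convex_cone hull G" using U T(2) by auto
    then have "\<tau> \<in> cone_faces (convex_cone hull G)" using Int(2) by simp
    then show "\<tau> \<in> fan_of"
      using cone_faces_simplicial_hull[OF indep[OF G(1)]] fan_ofI[OF G(1)] by auto
  qed
qed

end

section \<open>Star subdivisions and the cone of \<open>M\<^sup>4(1)\<close>\<close>

lemma ray_subset_iff: "ray v \<subseteq> convex_cone hull T \<longleftrightarrow> v \<in> convex_cone hull T"
proof
  assume "v \<in> convex_cone hull T"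
  then show "ray v \<subseteq> convex_cone hull T"
    unfolding ray_def by (intro hull_minimal convex_cone_convex_cone_hull) simp
qed (auto simp: ray_def intro: hull_inc)

lemma ray_plus_hull:
  "{x + y | x y. x \<in> ray v \<and> y \<in> convex_cone hull T} = convex_cone hull (insert v T)"
  using convex_cone_hull_Un[of "{v}" T] by (auto simp: ray_def)

text \<open>A simplicial fan is encoded by the simplicial complex of the generating sets of its cones;
  \<open>V\<close> is the set of generators of the smallest cone containing the new ray.\<close>

lemma star_subdivision_complex:
  assumes K: "\<And>T. T \<in> K \<Longrightarrow> independent T" "\<And>T U. T \<in> K \<Longrightarrow> U \<subseteq> T \<Longrightarrow> U \<in> K"
    and V: "\<And>T. T \<in> K \<Longrightarrow> v \<in> convex_cone hull T \<longleftrightarrow> V \<subseteq> T"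
  shows "star_subdivision ((\<lambda>T. convex_cone hull T) ` K) (ray v) =
    (\<lambda>T. convex_cone hull T) ` ({T \<in> K. \<not> V \<subseteq> T} \<union>
      {insert v T | T U. U \<in> K \<and> V \<subseteq> U \<and> T \<subseteq> U \<and> \<not> V \<subseteq> T})" (is "?L = ?R")
proof -
  have rayV: "ray v \<subseteq> convex_cone hull T \<longleftrightarrow> V \<subseteq> T" if "T \<in> K" for T
    using V[OF that] by (simp add: ray_subset_iff)
  have "{\<sigma> \<in> (\<lambda>T. convex_cone hull T) ` K. \<not> ray v \<subseteq> \<sigma>} =
      (\<lambda>T. convex_cone hull T) ` {T \<in> K. \<not> V \<subseteq> T}"
    using rayV by blast
  moreover have "{{x + y | x y. x \<in> ray v \<and> y \<in> \<tau>} | \<sigma> \<tau>. \<sigma> \<in> (\<lambda>T. convex_cone hull T) ` K \<and>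
        ray v \<subseteq> \<sigma> \<and> \<tau> \<in> cone_faces \<sigma> \<and> \<not> ray v \<subseteq> \<tau>} =
      (\<lambda>T. convex_cone hull T) ` {insert v T | T U. U \<in> K \<and> V \<subseteq> U \<and> T \<subseteq> U \<and> \<not> V \<subseteq> T}"
    (is "?A = ?B")
  proof (intro equalityI subsetI)
    fix \<omega> assume "\<omega> \<in> ?A"
    then obtain U \<tau> where U: "U \<in> K" "ray v \<subseteq> convex_cone hull U"
      and \<tau>: "\<tau> \<in> cone_faces (convex_cone hull U)" "\<not> ray v \<subseteq> \<tau>"
      and \<omega>: "\<omega> = {x + y | x y. x \<in> ray v \<and> y \<in> \<tau>}"
      by blast
    obtain T where T: "T \<subseteq> U" "\<tau> = convex_cone hull T"
      using face_of_simplicial_hullE[OF K(1)[OF U(1)] \<tau>(1)] .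
    have "V \<subseteq> U" "\<not> V \<subseteq> T"
      using U \<tau>(2) T K(2)[OF U(1) T(1)] rayV by auto
    moreover have "\<omega> = convex_cone hull (insert v T)" by (simp add: \<omega> T(2) ray_plus_hull)
    ultimately show "\<omega> \<in> ?B" using U(1) T(1) by blast
  next
    fix \<omega> assume "\<omega> \<in> ?B"
    then obtain T U where TU: "U \<in> K" "V \<subseteq> U" "T \<subseteq> U" "\<not> V \<subseteq> T"
      and \<omega>: "\<omega> = convex_cone hull (insert v T)" by blast
    have "convex_cone hull T \<in> cone_faces (convex_cone hull U)"
      using cone_faces_simplicial_hull[OF K(1)[OF TU(1)]] TU(3) by blast
    moreover have "ray v \<subseteq> convex_cone hull U" "\<not> ray v \<subseteq> convex_cone hull T"
      using TU K(2)[OF TU(1,3)] rayV by auto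
    moreover have "\<omega> = {x + y | x y. x \<in> ray v \<and> y \<in> convex_cone hull T}"
      by (simp add: \<omega> ray_plus_hull)
    ultimately show "\<omega> \<in> ?A" using TU(1) by blast
  qed
  ultimately show ?thesis unfolding star_subdivision_def image_Un by simp
qed

text \<open>Coefficients over an independent set are unique, so a cone over part of \<open>S\<close>
  contains \<open>v\<close> only if all of \<open>V\<close> is among its generators. This identifies
  the smallest cone around a new ray, as \<open>star_subdivision_complex\<close> requires.\<close>

lemma positive_combination_in_hull_iff:
  fixes S :: "'a::euclidean_space set"
  assumes S: "independent S" and V: "V \<subseteq> S" and c: "\<And>s. s \<in> V \<Longrightarrow> 0 < c s"
    and v: "v = (\<Sum>s\<in>V. c s *\<^sub>R s)" and T: "T \<subseteq> S"
  shows "v \<in> convex_cone hull T \<longleftrightarrow> V \<subseteq> T"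
proof
  assume "V \<subseteq> T"
  then show "v \<in> convex_cone hull T"
    unfolding v using c by (intro convex_cone_hull_sum) (auto intro: hull_inc less_imp_le)
next
  assume vT: "v \<in> convex_cone hull T"
  have "representation S v t = c t" if t: "t \<in> V" for t
  proof -
    have "representation S v t = (\<Sum>s\<in>V. c s * representation S s t)"
      using S V by (simp add: v representation_sum representation_scale span_base span_scale subset_eq)
    also have "\<dots> = (\<Sum>s\<in>V. if s = t then c s else 0)"
      using S V by (intro sum.cong) (auto simp: representation_basis)
    also have "\<dots> = c t"
      using finite_subset[OF V independent_imp_finite[OF S]] t by simp
    finally show ?thesis .
  qed
  moreover have "\<forall>s\<in>S - T. representation S v s = 0"
    using vT simplicial_hull_subset_iff[OF S T] by blast
  ultimately show "V \<subseteq> T" using c V by (metis DiffI less_irrefl subsetD subsetI)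
qed

text \<open>A form that vanishes on the other elements vanishes on their span. Thus the wall
  equations also certify independence.\<close>

lemma independent_if_separated:
  assumes "\<And>w. w \<in> S \<Longrightarrow> \<exists>t. 0 < pair t w \<and> (\<forall>w'\<in>S - {w}. pair t w' = 0)"
  shows "independent S"
  unfolding dependent_def
proof (rule notI, elim bexE)
  fix w assume w: "w \<in> S" "w \<in> span (S - {w})"
  obtain t where t: "0 < pair t w" "\<forall>w'\<in>S - {w}. pair t w' = 0" using assms[OF w(1)] by blast
  have "pair t w = 0"
    using linear_eq_on_span[OF linear_pair linear_pair, of "S - {w}" t 0 w] t(2) w(2) by auto
  then show False using t(1) by simp
qed

lemma primitive_vecI:
  assumes v: "v \<in> lattice3" and m: "pair m v = 1"
  shows "primitive_vec v"
  unfolding primitive_vec_def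
proof (intro conjI ballI allI impI)
  show "v \<noteq> 0" using m by auto
  fix w k assume w: "w \<in> lattice3" "v = real k *\<^sub>R w"
  obtain j where j: "pair m w = of_int j" using pair_Ints[OF w(1)] by (auto elim: Ints_cases)
  have "real k * pair m w = 1"
    using m unfolding w(2) linear_scale[OF linear_pair] by simp
  then have "int k * j = 1"
    unfolding j by (metis of_int_1 of_int_eq_iff of_int_mult of_int_of_nat_eq)
  then show "k = 1" by (simp add: zmult_eq_1_iff)
qed (rule v)

lemma in_hull_insertE:
  fixes u :: "real ^ 3"
  assumes "x \<in> convex_cone hull (insert u T)"
  obtains a y where "0 \<le> a" "y \<in> convex_cone hull T" "x = a *\<^sub>R u + y"
proof -
  obtain z y where "z \<in> ray u" "y \<in> convex_cone hull T" "x = z + y"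
    using assms unfolding ray_plus_hull[symmetric] by blast
  then show thesis using that by (auto simp: ray_eq)
qed

lemma in_hull_3:
  fixes u :: "real ^ 3"
  assumes "x \<in> convex_cone hull {u, v, w}"
  obtains a b c where "0 \<le> a" "0 \<le> b" "0 \<le> c" "x = a *\<^sub>R u + b *\<^sub>R v + c *\<^sub>R w"
proof -
  obtain a y where a: "0 \<le> a" "y \<in> convex_cone hull {v, w}" "x = a *\<^sub>R u + y"
    using in_hull_insertE[OF assms] .
  obtain b z where b: "0 \<le> b" "z \<in> convex_cone hull {w}" "y = b *\<^sub>R v + z"
    using in_hull_insertE[OF a(2)] .
  obtain c where "0 \<le> c" "z = c *\<^sub>R w"
    using b(2) unfolding ray_def[symmetric] ray_eq by blast
  then show thesis using that[of a b c] a b by (simp add: add.assoc)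
qed

lemma pair_vector:
  "pair (vector [a, b, c]) (vector [x, y, z]) =
    real_of_int a * x + real_of_int b * y + real_of_int c * z"
  by (simp add: pair_def sum_3)

lemma vector3_eq_iff:
  "(vector [a, b, c] :: 'a::zero ^ 3) = vector [x, y, z] \<longleftrightarrow> a = x \<and> b = y \<and> c = z"
  by (simp add: vec_eq_iff forall_3)

lemma vector3_lattice3: "vector [a, b, c] \<in> lattice3 \<longleftrightarrow> a \<in> \<int> \<and> b \<in> \<int> \<and> c \<in> \<int>"
  by (simp add: lattice3_def forall_3)

lemma vector3_combination:
  "a *\<^sub>R vector [x, y, z] + b *\<^sub>R vector [x', y', z'] + c *\<^sub>R vector [x'', y'', z''] =
    (vector [a * x + b * x' + c * x'', a * y + b * y' + c * y'', a * z + b * z' + c * z''] :: real ^ 3)"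
  by (simp add: vec_eq_iff forall_3)

lemma Ints_nonneg_le_1: "(x::real) \<in> \<int> \<Longrightarrow> 0 \<le> x \<Longrightarrow> x \<le> 1 \<Longrightarrow> x = 0 \<or> x = 1"
  by (auto elim!: Ints_cases)

section \<open>The generators and the four maximal cones\<close>

definition gen1 :: "nat \<Rightarrow> real ^ 3" where
  "gen1 q = vector [real q ^ 3 + real q ^ 2 + real q + 1, - (real q) - 1, - (real q ^ 2) - real q - 1]"
definition gen2 :: "real ^ 3" where "gen2 = vector [0, 1, 0]"
definition gen3 :: "real ^ 3" where "gen3 = vector [0, 0, 1]"
definition genp :: "nat \<Rightarrow> real ^ 3" where "genp q = vector [real q ^ 2 + 1, -1, - real q]"
definition genr :: "real ^ 3" where "genr = vector [1, 0, 0]"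

lemmas gen_defs = gen1_def gen2_def gen3_def genp_def genr_def

definition facets :: "nat \<Rightarrow> (real ^ 3) set set" where
  "facets q = {{gen1 q, genp q, gen2}, {genp q, gen3, genr}, {genp q, gen2, genr}, {gen2, gen3, genr}}"

text \<open>The forms defining the canonical divisor on the four maximal cones, multiplied by
  \<open>q (q\<^sup>2 + 1)\<close> to make them integral.\<close>

definition support_form :: "nat \<Rightarrow> (real ^ 3) set \<Rightarrow> int ^ 3" where
  "support_form q G =
    (let n = int q; M = n * (n ^ 2 + 1) in
     if gen1 q \<in> G then vector [n * (n ^ 2 + 2), M, n * M]
     else if gen2 \<notin> G then vector [M, M * (n ^ 2 - n), M]
     else if genp q \<in> G then vector [M, M, (n ^ 2 - 1) * (n ^ 2 + 1)]
     else vector [M, M, M])"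

context
  fixes q :: nat
  assumes q: "2 \<le> q"
begin

lemma gens_distinct:
  "gen1 q \<noteq> gen2" "gen1 q \<noteq> gen3" "gen1 q \<noteq> genp q" "gen1 q \<noteq> genr" "genp q \<noteq> gen2"
  "genp q \<noteq> gen3" "genp q \<noteq> genr" "gen2 \<noteq> gen3" "gen2 \<noteq> genr" "gen3 \<noteq> genr"
  using q by (auto simp: gen_defs vector3_eq_iff)

lemmas gens_distinct' = gens_distinct gens_distinct[symmetric]

lemma gens_primitive:
  "primitive_vec (gen1 q)" "primitive_vec gen2" "primitive_vec gen3" "primitive_vec (genp q)"
  "primitive_vec genr"
proof -
  have L: "gen1 q \<in> lattice3" "gen2 \<in> lattice3" "gen3 \<in> lattice3" "genp q \<in> lattice3" "genr \<in> lattice3"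
    by (simp_all add: gen_defs vector3_lattice3)
  show "primitive_vec (gen1 q)"
    \<comment> \<open>The second and third coordinates of \<open>gen1 q\<close> are already coprime,
      because \<open>(q^2 + q + 1) - q (q + 1) = 1\<close>.\<close>
    by (rule primitive_vecI[OF L(1), of "vector [0, int q, -1]"])
       (simp add: gen_defs pair_vector algebra_simps power2_eq_square)
  show "primitive_vec gen2"
    by (rule primitive_vecI[OF L(2), of "vector [0, 1, 0]"]) (simp add: gen_defs pair_vector)
  show "primitive_vec gen3"
    by (rule primitive_vecI[OF L(3), of "vector [0, 0, 1]"]) (simp add: gen_defs pair_vector)
  show "primitive_vec (genp q)"
    by (rule primitive_vecI[OF L(4), of "vector [0, -1, 0]"]) (simp add: gen_defs pair_vector)
  show "primitive_vec genr"
    by (rule primitive_vecI[OF L(5), of "vector [1, 0, 0]"]) (simp add: gen_defs pair_vector)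
qed

text \<open>Positive coefficients at \<open>gen1 q\<close> and \<open>gen3\<close> alone: the first
  ray lies inside a two-dimensional face of \<open>sigma_M q\<close>, and its star subdivision cuts
  the cone in two.\<close>

lemma genp_eq: "genp q = (1 / (real q + 1)) *\<^sub>R gen1 q + (1 / (real q + 1)) *\<^sub>R gen3"
proof -
  have "(real q + 1) *\<^sub>R genp q = gen1 q + gen3"
    by (simp add: gen_defs vec_eq_iff forall_3 algebra_simps power2_eq_square power3_eq_cube)
  then have "(1 / (real q + 1)) *\<^sub>R ((real q + 1) *\<^sub>R genp q) = (1 / (real q + 1)) *\<^sub>R (gen1 q + gen3)"
    by simp
  then show ?thesis by (simp add: scaleR_add_right)
qed

text \<open>All coefficients are positive, so the second ray lies in the interior of the cone over
  \<open>genp q\<close>, \<open>gen2\<close>, \<open>gen3\<close>, and its star subdivision cuts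
  that cone in three.\<close>

lemma genr_eq:
  "genr = (1 / (real q ^ 2 + 1)) *\<^sub>R genp q + (1 / (real q ^ 2 + 1)) *\<^sub>R gen2 +
    (real q / (real q ^ 2 + 1)) *\<^sub>R gen3"
proof -
  have nz: "real q ^ 2 + 1 \<noteq> 0" by (smt (verit) zero_le_power2)
  have "(real q ^ 2 + 1) *\<^sub>R genr = genp q + gen2 + real q *\<^sub>R gen3"
    by (simp add: gen_defs vec_eq_iff forall_3 algebra_simps power2_eq_square)
  then have "(1 / (real q ^ 2 + 1)) *\<^sub>R ((real q ^ 2 + 1) *\<^sub>R genr) =
      (1 / (real q ^ 2 + 1)) *\<^sub>R (genp q + gen2 + real q *\<^sub>R gen3)" by simp
  then show ?thesis using nz by (simp add: scaleR_add_right)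
qed

text \<open>The values off each cone are written as multiples of \<open>M\<close> or as
  \<open>M\<close> plus a term, in the shape in which \<open>support_form_strict\<close> shows that
  they exceed \<open>M\<close>.\<close>

lemma support_form_values:
  fixes n M :: real
  defines "n \<equiv> real q" and "M \<equiv> n * (n ^ 2 + 1)"
  shows "pair (support_form q {gen1 q, genp q, gen2}) (gen1 q) = M"
    "pair (support_form q {gen1 q, genp q, gen2}) (genp q) = M"
    "pair (support_form q {gen1 q, genp q, gen2}) gen2 = M"
    "pair (support_form q {gen1 q, genp q, gen2}) gen3 = n * M"
    "pair (support_form q {gen1 q, genp q, gen2}) genr = M + n"
    "pair (support_form q {genp q, gen3, genr}) (gen1 q) = n * M"
    "pair (support_form q {genp q, gen3, genr}) (genp q) = M"
    "pair (support_form q {genp q, gen3, genr}) gen2 = M * (n ^ 2 - n)"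
    "pair (support_form q {genp q, gen3, genr}) gen3 = M"
    "pair (support_form q {genp q, gen3, genr}) genr = M"
    "pair (support_form q {genp q, gen2, genr}) (gen1 q) = M + (n ^ 2 + 1)"
    "pair (support_form q {genp q, gen2, genr}) (genp q) = M"
    "pair (support_form q {genp q, gen2, genr}) gen2 = M"
    "pair (support_form q {genp q, gen2, genr}) gen3 = M + (n ^ 2 + 1) * (n ^ 2 - n - 1)"
    "pair (support_form q {genp q, gen2, genr}) genr = M"
    "pair (support_form q {gen2, gen3, genr}) (gen1 q) = M * (n ^ 3 - n - 1)"
    "pair (support_form q {gen2, gen3, genr}) (genp q) = M * (n ^ 2 - n)"
    "pair (support_form q {gen2, gen3, genr}) gen2 = M"
    "pair (support_form q {gen2, gen3, genr}) gen3 = M"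
    "pair (support_form q {gen2, gen3, genr}) genr = M"
  using gens_distinct' unfolding n_def M_def
  by (simp_all add: support_form_def Let_def,
      simp_all add: gen_defs pair_vector algebra_simps power2_eq_square power3_eq_cube)

text \<open>The three forms are equations of the facets of \<open>sigma_M q\<close> opposite to
  \<open>gen1 q\<close>, \<open>gen2\<close> and \<open>gen3\<close>, in this order. The second also
  vanishes at \<open>genp q\<close>, a multiple of \<open>gen1 q + gen3\<close>.\<close>

lemma boundary_forms:
  "pair (vector [1, 0, 0]) gen2 = 0" "pair (vector [1, 0, 0]) gen3 = 0"
  "0 < pair (vector [1, 0, 0]) genr"
  "0 < pair (vector [1, 0, 0]) (gen1 q)" "0 < pair (vector [1, 0, 0]) (genp q)"
  "pair (vector [1, int q ^ 2 + 1, 0]) (gen1 q) = 0"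
  "pair (vector [1, int q ^ 2 + 1, 0]) (genp q) = 0"
  "0 < pair (vector [1, int q ^ 2 + 1, 0]) gen2"
  "pair (vector [1, int q ^ 2 + 1, 0]) gen3 = 0"
  "0 < pair (vector [1, int q ^ 2 + 1, 0]) genr"
  "pair (vector [int q ^ 2 + int q + 1, 0, int q ^ 3 + int q ^ 2 + int q + 1]) (gen1 q) = 0"
  "0 < pair (vector [int q ^ 2 + int q + 1, 0, int q ^ 3 + int q ^ 2 + int q + 1]) (genp q)"
  "pair (vector [int q ^ 2 + int q + 1, 0, int q ^ 3 + int q ^ 2 + int q + 1]) gen2 = 0"
  "0 < pair (vector [int q ^ 2 + int q + 1, 0, int q ^ 3 + int q ^ 2 + int q + 1]) gen3"
proof -
  have pos: "0 < real q ^ 3 + real q ^ 2 + real q + 1" "0 < real q ^ 2 + 1"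
    by (simp_all add: add_nonneg_pos)
  show "pair (vector [1, 0, 0]) gen2 = 0" "pair (vector [1, 0, 0]) gen3 = 0"
    "0 < pair (vector [1, 0, 0]) genr"
    "0 < pair (vector [1, 0, 0]) (gen1 q)" "0 < pair (vector [1, 0, 0]) (genp q)"
    using pos by (simp_all add: gen_defs pair_vector)
  show "pair (vector [1, int q ^ 2 + 1, 0]) (gen1 q) = 0"
    "pair (vector [1, int q ^ 2 + 1, 0]) (genp q) = 0"
    "pair (vector [1, int q ^ 2 + 1, 0]) gen3 = 0"
    "0 < pair (vector [1, int q ^ 2 + 1, 0]) genr"
    "0 < pair (vector [1, int q ^ 2 + 1, 0]) gen2"
    using pos by (simp_all add: gen_defs pair_vector algebra_simps power2_eq_square power3_eq_cube)
  show "pair (vector [int q ^ 2 + int q + 1, 0, int q ^ 3 + int q ^ 2 + int q + 1]) (gen1 q) = 0"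
    "pair (vector [int q ^ 2 + int q + 1, 0, int q ^ 3 + int q ^ 2 + int q + 1]) gen2 = 0"
    "0 < pair (vector [int q ^ 2 + int q + 1, 0, int q ^ 3 + int q ^ 2 + int q + 1]) gen3"
    using pos by (simp_all add: gen_defs pair_vector algebra_simps power2_eq_square power3_eq_cube)
  have "pair (vector [int q ^ 2 + int q + 1, 0, int q ^ 3 + int q ^ 2 + int q + 1]) (genp q) = real q ^ 2 + 1"
    by (simp add: gen_defs pair_vector algebra_simps power2_eq_square power3_eq_cube)
  then show "0 < pair (vector [int q ^ 2 + int q + 1, 0, int q ^ 3 + int q ^ 2 + int q + 1]) (genp q)"
    using pos by simp
qed

lemma boundary_forms_dual:
  "vector [1, 0, 0] \<in> dual_lattice_points (convex_cone hull {gen1 q, gen2, gen3})"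
  "vector [1, int q ^ 2 + 1, 0] \<in> dual_lattice_points (convex_cone hull {gen1 q, gen2, gen3})"
  "vector [int q ^ 2 + int q + 1, 0, int q ^ 3 + int q ^ 2 + int q + 1]
    \<in> dual_lattice_points (convex_cone hull {gen1 q, gen2, gen3})"
  using boundary_forms by (simp_all add: dual_lattice_points_hull)

lemma facets_cases:
  assumes "G \<in> facets q"
  obtains "G = {gen1 q, genp q, gen2}" | "G = {genp q, gen3, genr}" | "G = {genp q, gen2, genr}"
    | "G = {gen2, gen3, genr}"
  using assms by (auto simp: facets_def)

text \<open>The positivity facts behind strict concavity. The most delicate is that of
  \<open>n ^ 2 - n - 1\<close>, which is 1 at \<open>n = 2\<close> but negative at
  \<open>n = 1\<close>.\<close>

lemma support_form_strict:
  fixes n M :: real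
  defines "n \<equiv> real q" and "M \<equiv> n * (n ^ 2 + 1)"
  shows "0 < M" "M < n * M" "0 < q" "M < M * (n ^ 2 - n)" "0 < n ^ 2 + 1"
    "0 < (n ^ 2 + 1) * (n ^ 2 - n - 1)" "M < M * (n ^ 3 - n - 1)"
proof -
  have n: "2 \<le> n" using q by (simp add: n_def)
  have sq: "2 * n \<le> n ^ 2" using mult_right_mono[of 2 n n] n by (simp add: power2_eq_square)
  have cu: "4 * n \<le> n ^ 3"
  proof -
    have "n * (2 * n) \<le> n * n ^ 2" using n sq by (intro mult_left_mono) auto
    moreover have "n * (2 * n) = 2 * n ^ 2" "n * n ^ 2 = n ^ 3"
      by (simp_all add: power2_eq_square power3_eq_cube)
    ultimately show ?thesis using sq by linarith
  qed
  have p: "0 < n ^ 2 + 1" by (simp add: add_nonneg_pos)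
  show M: "0 < M" using n p by (simp add: M_def)
  show "M < n * M" using M n by simp
  show "0 < q" "0 < n ^ 2 + 1" using q p by simp_all
  show "M < M * (n ^ 2 - n)" using M n sq by simp
  show "M < M * (n ^ 3 - n - 1)" using M n cu by simp
  show "0 < (n ^ 2 + 1) * (n ^ 2 - n - 1)" using p n sq by simp
qed

lemma support_form_on: "G \<in> facets q \<Longrightarrow> w \<in> G \<Longrightarrow>
    pair (support_form q G) w = real q * (real q ^ 2 + 1)"
  by (elim facets_cases) (auto simp: support_form_values)

lemma facets_Union: "\<Union>(facets q) = {gen1 q, genp q, gen2, gen3, genr}"
  by (auto simp: facets_def)

lemma support_form_off:
  assumes "G \<in> facets q" "H \<in> facets q" "w \<in> H" "w \<notin> G"
  shows "real q * (real q ^ 2 + 1) < pair (support_form q G) w"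
proof -
  have "w \<in> {gen1 q, genp q, gen2, gen3, genr}" using assms facets_Union by blast
  with assms(1,4) show ?thesis
    by (elim facets_cases) (auto simp: support_form_values intro: support_form_strict)
qed

lemma facets_walls:
  assumes G: "G \<in> facets q" and w: "w \<in> G"
  shows "\<exists>t. 0 < pair t w \<and> (\<forall>w'\<in>G - {w}. pair t w' = 0) \<and>
    (t \<in> dual_lattice_points (convex_cone hull {gen1 q, gen2, gen3}) \<or>
      (\<exists>H\<in>facets q. t = support_form q H - support_form q G))"
proof -
  \<comment> \<open>On the two generators that \<open>H\<close> shares with \<open>G\<close> both
    forms equal \<open>M\<close>; at \<open>w\<close> that of \<open>H\<close> is larger by strict
    concavity.\<close>
  have interior: ?thesis if "H \<in> facets q" "w \<notin> H" "G - {w} \<subseteq> H" for H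
  proof (intro exI[of _ "support_form q H - support_form q G"] conjI ballI disjI2 bexI[of _ H])
    show "0 < pair (support_form q H - support_form q G) w"
      using support_form_off[OF that(1) G w that(2)] support_form_on[OF G w] by simp
    show "pair (support_form q H - support_form q G) w' = 0" if "w' \<in> G - {w}" for w'
      using support_form_on[OF \<open>H \<in> facets q\<close>] support_form_on[OF G] that \<open>G - {w} \<subseteq> H\<close> by auto
  qed (use that in auto)
  have mem: "{gen1 q, genp q, gen2} \<in> facets q" "{genp q, gen3, genr} \<in> facets q"
    "{genp q, gen2, genr} \<in> facets q" "{gen2, gen3, genr} \<in> facets q"
    by (auto simp: facets_def)
  have boundary: ?thesis
    if "t \<in> dual_lattice_points (convex_cone hull {gen1 q, gen2, gen3})"
      "0 < pair t w" "\<forall>w'\<in>G - {w}. pair t w' = 0" for t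
    using that by blast
  from G show ?thesis
  proof (cases rule: facets_cases)
    case 1
    then consider "w = gen1 q" | "w = genp q" | "w = gen2" using w by auto
    then show ?thesis
    proof cases
      case 1
      show ?thesis by (rule interior[OF mem(3)]) (use 1 \<open>G = _\<close> gens_distinct' in auto)
    next
      case 2
      show ?thesis by (rule boundary[OF boundary_forms_dual(3)]) (use 2 \<open>G = _\<close> boundary_forms in auto)
    next
      case 3
      show ?thesis by (rule boundary[OF boundary_forms_dual(2)]) (use 3 \<open>G = _\<close> boundary_forms in auto)
    qed
  next
    case 2
    then consider "w = genp q" | "w = gen3" | "w = genr" using w by auto
    then show ?thesis
    proof cases
      case 1
      show ?thesis by (rule interior[OF mem(4)]) (use 1 \<open>G = _\<close> gens_distinct' in auto)
    next
      case 2
      show ?thesis by (rule interior[OF mem(3)]) (use 2 \<open>G = _\<close> gens_distinct' in auto)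
    next
      case 3
      show ?thesis by (rule boundary[OF boundary_forms_dual(2)]) (use 3 \<open>G = _\<close> boundary_forms in auto)
    qed
  next
    case 3
    then consider "w = genp q" | "w = gen2" | "w = genr" using w by auto
    then show ?thesis
    proof cases
      case 1
      show ?thesis by (rule interior[OF mem(4)]) (use 1 \<open>G = _\<close> gens_distinct' in auto)
    next
      case 2
      show ?thesis by (rule interior[OF mem(2)]) (use 2 \<open>G = _\<close> gens_distinct' in auto)
    next
      case 3
      show ?thesis by (rule interior[OF mem(1)]) (use 3 \<open>G = _\<close> gens_distinct' in auto)
    qed
  next
    case 4
    then consider "w = gen2" | "w = gen3" | "w = genr" using w by auto
    then show ?thesis
    proof cases
      case 1
      show ?thesis by (rule interior[OF mem(2)]) (use 1 \<open>G = _\<close> gens_distinct' in auto)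
    next
      case 2
      show ?thesis by (rule interior[OF mem(3)]) (use 2 \<open>G = _\<close> gens_distinct' in auto)
    next
      case 3
      show ?thesis by (rule boundary[OF boundary_forms_dual(1)]) (use 3 \<open>G = _\<close> boundary_forms in auto)
    qed
  qed
qed

lemma facets_terminal:
  assumes G: "G \<in> facets q" and x: "x \<in> convex_cone hull G" "x \<in> lattice3"
    and le: "pair (support_form q G) x \<le> real q * (real q ^ 2 + 1)"
  shows "x = 0 \<or> x \<in> G"
proof -
  define n where "n = real q"
  have n: "n \<in> \<int>" by (simp add: n_def)
  define M where "M = n * (n ^ 2 + 1)"
  have M: "0 < M" unfolding M_def n_def by (rule support_form_strict)
  have sum_le: "a + b + c \<le> 1"
    if "G = {u, v, w}" "x = a *\<^sub>R u + b *\<^sub>R v + c *\<^sub>R w" for a b c u v w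
  proof -
    have "pair (support_form q G) x = a * M + b * M + c * M"
      using support_form_on[OF G] that(1)
      by (simp add: that(2) linear_add[OF linear_pair] linear_scale[OF linear_pair] M_def n_def)
    then have "(a + b + c) * M \<le> 1 * M"
      using le by (simp add: M_def n_def algebra_simps)
    then show ?thesis using M by (rule mult_right_le_imp_le)
  qed
  from G show ?thesis
  proof (cases rule: facets_cases)
    case 1
    obtain a b c where abc: "0 \<le> a" "0 \<le> b" "0 \<le> c"
      "x = a *\<^sub>R gen1 q + b *\<^sub>R genp q + c *\<^sub>R gen2"
      using in_hull_3 x(1) 1 by metis
    have le1: "a + b + c \<le> 1" by (rule sum_le[OF 1 abc(4)])
    define s where "s = (n + 1) * a + b"
    have "x = vector [(n ^ 2 + 1) * s, c - s, - (n * s) - a]"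
      unfolding abc(4) gen_defs vector3_combination vector3_eq_iff s_def n_def[symmetric]
      by (simp add: algebra_simps power2_eq_square power3_eq_cube)
    then have int: "(n ^ 2 + 1) * s \<in> \<int>" "c - s \<in> \<int>" "- (n * s) - a \<in> \<int>"
      using x(2) by (simp_all add: vector3_lattice3)
    \<comment> \<open>The integral form \<open>(1, 0, q)\<close> is 1 at \<open>gen1 q\<close> and
      \<open>genp q\<close> and 0 at \<open>gen2\<close>. A lattice point of the shed thus lies on
      the ray of \<open>gen2\<close> or on the edge joining the other two generators, and one
      coordinate remains to be examined.\<close>
    have "a + b = (n ^ 2 + 1) * s + n * (- (n * s) - a)"
      by (simp add: s_def algebra_simps power2_eq_square)
    then have "a + b \<in> \<int>" using int n by (metis Ints_add Ints_mult)
    then consider "a + b = 0" | "a + b = 1" using Ints_nonneg_le_1[of "a + b"] abc le1 by fastforce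
    then show ?thesis
    proof cases
      case 1
      then have ab: "a = 0" "b = 0" using abc by auto
      then have "c \<in> \<int>" using int(2) by (simp add: s_def)
      then have "c = 0 \<or> c = 1" using Ints_nonneg_le_1 abc le1 ab by simp
      then show ?thesis using abc(4) ab \<open>G = _\<close> by auto
    next
      case 2
      then have c: "c = 0" using abc le1 by auto
      then have s: "s \<in> \<int>" using int(2) by (metis Ints_minus diff_0 minus_minus)
      have "a = - (- (n * s) - a) - n * s" by simp
      then have "a \<in> \<int>" using int(3) s n by (metis Ints_diff Ints_minus Ints_mult)
      then have "a = 0 \<or> a = 1" using Ints_nonneg_le_1 abc 2 by simp
      then show ?thesis using abc(4) 2 c \<open>G = _\<close> by auto
    qed
  next
    case 2
    obtain a b c where abc: "0 \<le> a" "0 \<le> b" "0 \<le> c"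
      "x = a *\<^sub>R genp q + b *\<^sub>R gen3 + c *\<^sub>R genr"
      using in_hull_3 x(1) 2 by metis
    have le1: "a + b + c \<le> 1" by (rule sum_le[OF 2 abc(4)])
    \<comment> \<open>These three generators are a basis of the lattice: the coordinates of
      \<open>x\<close> return \<open>a\<close>, \<open>b\<close> and \<open>c\<close> as
      integers.\<close>
    have "x = vector [(n ^ 2 + 1) * a + c, - a, b - n * a]"
      unfolding abc(4) gen_defs vector3_combination vector3_eq_iff n_def[symmetric]
      by (simp add: algebra_simps)
    then have int: "(n ^ 2 + 1) * a + c \<in> \<int>" "- a \<in> \<int>" "b - n * a \<in> \<int>"
      using x(2) by (simp_all add: vector3_lattice3)
    have a: "a \<in> \<int>" using int(2) by (metis Ints_minus minus_minus)
    have "b = (b - n * a) + n * a" by simp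
    then have b: "b \<in> \<int>" using int(3) a n by (metis Ints_add Ints_mult)
    have "c = ((n ^ 2 + 1) * a + c) - (n ^ 2 + 1) * a" by simp
    then have c: "c \<in> \<int>" using int(1) a n by (metis Ints_1 Ints_add Ints_diff Ints_mult Ints_power)
    have "a = 0 \<or> a = 1" "b = 0 \<or> b = 1" "c = 0 \<or> c = 1"
      using Ints_nonneg_le_1[OF a] Ints_nonneg_le_1[OF b] Ints_nonneg_le_1[OF c] abc le1 by auto
    then show ?thesis using abc(4) le1 2 by auto
  next
    case 3
    obtain a b c where abc: "0 \<le> a" "0 \<le> b" "0 \<le> c"
      "x = a *\<^sub>R genp q + b *\<^sub>R gen2 + c *\<^sub>R genr"
      using in_hull_3 x(1) 3 by metis
    have le1: "a + b + c \<le> 1" by (rule sum_le[OF 3 abc(4)])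
    have "x = vector [(n ^ 2 + 1) * a + c, b - a, - (n * a)]"
      unfolding abc(4) gen_defs vector3_combination vector3_eq_iff n_def[symmetric]
      by (simp add: algebra_simps)
    then have int: "(n ^ 2 + 1) * a + c \<in> \<int>" "b - a \<in> \<int>" "- (n * a) \<in> \<int>"
      using x(2) by (simp_all add: vector3_lattice3)
    \<comment> \<open>Again the form \<open>(1, 0, q)\<close>, here with values 1, 0, 1 at
      \<open>genp q\<close>, \<open>gen2\<close>, \<open>genr\<close>.\<close>
    have "a + c = ((n ^ 2 + 1) * a + c) + n * (- (n * a))"
      by (simp add: algebra_simps power2_eq_square)
    then have "a + c \<in> \<int>" using int n by (metis Ints_add Ints_mult)
    then consider "a + c = 0" | "a + c = 1" using Ints_nonneg_le_1[of "a + c"] abc le1 by fastforce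
    then show ?thesis
    proof cases
      case 1
      then have ac: "a = 0" "c = 0" using abc by auto
      then have "b = 0 \<or> b = 1" using Ints_nonneg_le_1[of b] int(2) abc le1 by simp
      then show ?thesis using abc(4) ac \<open>G = _\<close> by auto
    next
      case 2
      then have b: "b = 0" using abc le1 by auto
      then have "a \<in> \<int>" using int(2) by (metis Ints_minus diff_0 minus_minus)
      then have "a = 0 \<or> a = 1" using Ints_nonneg_le_1 abc 2 by simp
      then show ?thesis using abc(4) 2 b \<open>G = _\<close> by auto
    qed
  next
    case 4
    obtain a b c where abc: "0 \<le> a" "0 \<le> b" "0 \<le> c"
      "x = a *\<^sub>R gen2 + b *\<^sub>R gen3 + c *\<^sub>R genr"
      using in_hull_3 x(1) 4 by metis
    have le1: "a + b + c \<le> 1" by (rule sum_le[OF 4 abc(4)])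
    have "x = vector [c, a, b]"
      unfolding abc(4) gen_defs vector3_combination vector3_eq_iff by simp
    then have "a \<in> \<int>" "b \<in> \<int>" "c \<in> \<int>"
      using x(2) by (simp_all add: vector3_lattice3)
    then have "a = 0 \<or> a = 1" "b = 0 \<or> b = 1" "c = 0 \<or> c = 1"
      using Ints_nonneg_le_1[of a] Ints_nonneg_le_1[of b] Ints_nonneg_le_1[of c] abc le1 by auto
    then show ?thesis using abc(4) le1 4 by auto
  qed
qed

lemma facets_regular:
  "regular_triangulation {gen1 q, gen2, gen3} (facets q) (support_form q) (real q * (real q ^ 2 + 1))"
proof
  show "finite (facets q)" "facets q \<noteq> {}" by (auto simp: facets_def)
  show "0 < real q * (real q ^ 2 + 1)" by (rule support_form_strict)
next
  fix G assume G: "G \<in> facets q"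
  have "independent G"
    using facets_walls[OF G] by (intro independent_if_separated) blast
  moreover have "\<And>w. w \<in> G \<Longrightarrow> primitive_vec w"
    using G gens_primitive by (elim facets_cases) auto
  ultimately show "simplicial_gens G" by (simp add: simplicial_gens_def)
  show "card G = 3"
    using G gens_distinct' by (elim facets_cases) auto
  have E: "gen1 q \<in> convex_cone hull {gen1 q, gen2, gen3}" "gen2 \<in> convex_cone hull {gen1 q, gen2, gen3}"
    "gen3 \<in> convex_cone hull {gen1 q, gen2, gen3}"
    by (auto intro: hull_inc)
  moreover have p: "genp q \<in> convex_cone hull {gen1 q, gen2, gen3}"
    unfolding genp_eq
    using E by (intro convex_cone_add convex_cone_scaleR convex_cone_convex_cone_hull) auto
  moreover have "genr \<in> convex_cone hull {gen1 q, gen2, gen3}"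
    unfolding genr_eq
    using E p by (intro convex_cone_add convex_cone_scaleR convex_cone_convex_cone_hull) auto
  ultimately show "G \<subseteq> convex_cone hull {gen1 q, gen2, gen3}"
    using G by (elim facets_cases) auto
qed (rule support_form_on support_form_off facets_walls facets_terminal; assumption)+

section \<open>The two star subdivisions of \<open>sigma_M q\<close>\<close>

lemma independent_E: "independent {gen1 q, gen2, gen3}"
  and independent_p23: "independent {genp q, gen2, gen3}"
proof -
  show "independent {gen1 q, gen2, gen3}"
  proof (rule independent_if_separated)
    fix w assume "w \<in> {gen1 q, gen2, gen3}"
    then consider "w = gen1 q" | "w = gen2" | "w = gen3" by auto
    then show "\<exists>t. 0 < pair t w \<and> (\<forall>w'\<in>{gen1 q, gen2, gen3} - {w}. pair t w' = 0)"
      using boundary_forms gens_distinct' by cases (metis Diff_iff insert_iff empty_iff)+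
  qed
  \<comment> \<open>An equation of the wall over \<open>genp q\<close> and \<open>gen2\<close>,
    which appears only with the first star subdivision.\<close>
  have h: "pair (vector [int q, 0, int q ^ 2 + 1]) (genp q) = 0"
    "pair (vector [int q, 0, int q ^ 2 + 1]) gen2 = 0"
    "0 < pair (vector [int q, 0, int q ^ 2 + 1]) gen3"
    using support_form_strict(5) by (simp_all add: gen_defs pair_vector algebra_simps)
  show "independent {genp q, gen2, gen3}"
  proof (rule independent_if_separated)
    fix w assume "w \<in> {genp q, gen2, gen3}"
    then consider "w = genp q" | "w = gen2" | "w = gen3" by auto
    then show "\<exists>t. 0 < pair t w \<and> (\<forall>w'\<in>{genp q, gen2, gen3} - {w}. pair t w' = 0)"
      using boundary_forms h gens_distinct' by cases (metis Diff_iff insert_iff empty_iff)+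
  qed
qed

lemma star_subdivision_p:
  "star_subdivision (cone_faces (convex_cone hull {gen1 q, gen2, gen3})) (ray (genp q)) =
    (\<lambda>T. convex_cone hull T) ` (Pow {gen1 q, genp q, gen2} \<union> Pow {genp q, gen2, gen3})"
proof -
  let ?E = "{gen1 q, gen2, gen3}" and ?V = "{gen1 q, gen3}"
  have V: "genp q \<in> convex_cone hull T \<longleftrightarrow> ?V \<subseteq> T" if "T \<in> Pow ?E" for T
  proof (rule positive_combination_in_hull_iff[OF independent_E])
    show "genp q = (\<Sum>s\<in>?V. (1 / (real q + 1)) *\<^sub>R s)"
      using gens_distinct' by (simp add: genp_eq)
  qed (use that in auto)
  have "{T \<in> Pow ?E. \<not> ?V \<subseteq> T} \<union>
      {insert (genp q) T | T U. U \<in> Pow ?E \<and> ?V \<subseteq> U \<and> T \<subseteq> U \<and> \<not> ?V \<subseteq> T} =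
      Pow {gen1 q, genp q, gen2} \<union> Pow {genp q, gen2, gen3}" (is "?A \<union> ?B = ?R")
  proof
    show "?A \<union> ?B \<subseteq> ?R" by auto
    show "?R \<subseteq> ?A \<union> ?B"
    proof
      fix X assume X: "X \<in> ?R"
      show "X \<in> ?A \<union> ?B"
      proof (cases "genp q \<in> X")
        case True
        have "X - {genp q} \<subseteq> ?E" "\<not> ?V \<subseteq> X - {genp q}" "X = insert (genp q) (X - {genp q})"
          using X True gens_distinct' by auto
        then have "X \<in> ?B" by blast
        then show ?thesis ..
      next
        case False
        then have "X \<in> ?A" using X gens_distinct' by auto
        then show ?thesis ..
      qed
    qed
  qed
  moreover have "cone_faces (convex_cone hull ?E) = (\<lambda>T. convex_cone hull T) ` Pow ?E"
    by (rule cone_faces_simplicial_hull[OF independent_E])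
  moreover have "star_subdivision ((\<lambda>T. convex_cone hull T) ` Pow ?E) (ray (genp q)) =
    (\<lambda>T. convex_cone hull T) ` ({T \<in> Pow ?E. \<not> ?V \<subseteq> T} \<union>
      {insert (genp q) T | T U. U \<in> Pow ?E \<and> ?V \<subseteq> U \<and> T \<subseteq> U \<and> \<not> ?V \<subseteq> T})"
  proof (rule star_subdivision_complex)
    show "independent T" if "T \<in> Pow ?E" for T
      using that independent_mono[OF independent_E] by blast
  qed (use V in auto)
  ultimately show ?thesis by simp
qed

text \<open>The wall over \<open>genp q\<close> and \<open>gen2\<close> separates: its equation,
  with the sign that makes it nonnegative at \<open>gen1 q\<close>, has the value \<open>- q\<close>
  at \<open>genr\<close>. Hence the second star subdivision leaves this cone as it is.\<close>

lemma genr_notin: "genr \<notin> convex_cone hull {gen1 q, genp q, gen2}"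
proof
  let ?h = "vector [- int q, 0, - (int q ^ 2) - 1]"
  assume "genr \<in> convex_cone hull {gen1 q, genp q, gen2}"
  moreover have "pair ?h (gen1 q) = real q ^ 2 + 1" "pair ?h (genp q) = 0" "pair ?h gen2 = 0"
    by (simp_all add: gen_defs pair_vector algebra_simps power2_eq_square power3_eq_cube)
  then have "0 \<le> pair ?h s" if "s \<in> {gen1 q, genp q, gen2}" for s
    using that support_form_strict(5) by auto
  ultimately have "0 \<le> pair ?h genr"
    by (rule linear_nonneg_on_convex_cone_hull[OF linear_pair, rotated])
  then show False using q by (simp add: gen_defs pair_vector)
qed

lemma star_subdivision_r:
  "star_subdivision ((\<lambda>T. convex_cone hull T) ` (Pow {gen1 q, genp q, gen2} \<union> Pow {genp q, gen2, gen3}))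
      (ray genr) = (\<lambda>T. convex_cone hull T) ` (\<Union>G\<in>facets q. Pow G)"
proof -
  let ?C = "{gen1 q, genp q, gen2}" and ?V = "{genp q, gen2, gen3}"
  let ?K = "Pow ?C \<union> Pow ?V"
  have indepC: "independent ?C"
    using facets_walls[of ?C] by (intro independent_if_separated) (auto simp: facets_def)
  \<comment> \<open>The coefficients in \<open>genr_eq\<close>, as a function on the
    generators.\<close>
  define c where "c s = (if s = gen3 then real q else 1) / (real q ^ 2 + 1)" for s :: "real ^ 3"
  have V: "genr \<in> convex_cone hull T \<longleftrightarrow> ?V \<subseteq> T" if "T \<in> ?K" for T
  proof (cases "T \<subseteq> ?V")
    case True
    show ?thesis
    proof (rule positive_combination_in_hull_iff[OF independent_p23])
      show "genr = (\<Sum>s\<in>?V. c s *\<^sub>R s)"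
        using gens_distinct' genr_eq by (simp add: c_def add.assoc)
      show "0 < c s" if "s \<in> ?V" for s
        using support_form_strict(3,5) by (simp add: c_def)
    qed (use True in auto)
  next
    case False
    then have "T \<subseteq> ?C" using that by auto
    then show ?thesis
      using genr_notin hull_mono[of T ?C convex_cone] gens_distinct' by blast
  qed
  have "{T \<in> ?K. \<not> ?V \<subseteq> T} \<union>
      {insert genr T | T U. U \<in> ?K \<and> ?V \<subseteq> U \<and> T \<subseteq> U \<and> \<not> ?V \<subseteq> T} =
      (\<Union>G\<in>facets q. Pow G)" (is "?A \<union> ?B = ?R")
  proof
    \<comment> \<open>\<open>?V\<close> is a maximal simplex of the complex, so it is the only one
      that gets subdivided.\<close>
    have "U = ?V" if "U \<in> ?K" "?V \<subseteq> U" for U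
    proof -
      have "gen3 \<in> U" "gen3 \<notin> ?C" using that(2) gens_distinct' by auto
      then have "\<not> U \<subseteq> ?C" by blast
      then have "U \<subseteq> ?V" using that(1) by blast
      then show ?thesis using that(2) by (rule subset_antisym)
    qed
    then have B_eq: "?B = {insert genr T | T. T \<subseteq> ?V \<and> \<not> ?V \<subseteq> T}"
      by (smt (verit) Collect_cong Pow_iff UnI2 order_refl)
    have proper: "T \<subseteq> {genp q, gen2} \<or> T \<subseteq> {genp q, gen3} \<or> T \<subseteq> {gen2, gen3}"
      if "T \<subseteq> ?V" "\<not> ?V \<subseteq> T" for T
      using that by auto
    have R_eq: "?R = Pow ?C \<union> Pow {genp q, gen3, genr} \<union> Pow {genp q, gen2, genr} \<union> Pow {gen2, gen3, genr}"
      by (auto simp: facets_def)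
    show "?A \<union> ?B \<subseteq> ?R"
    proof (rule Un_least)
      show "?A \<subseteq> ?R"
      proof
        fix T assume "T \<in> ?A"
        then have "T \<subseteq> ?C \<or> T \<subseteq> {genp q, gen2} \<or> T \<subseteq> {genp q, gen3} \<or> T \<subseteq> {gen2, gen3}"
          using proper by blast
        then show "T \<in> ?R" unfolding R_eq by blast
      qed
      show "?B \<subseteq> ?R"
      proof
        fix X assume "X \<in> ?B"
        then obtain T where "X = insert genr T" "T \<subseteq> ?V" "\<not> ?V \<subseteq> T" unfolding B_eq by blast
        then show "X \<in> ?R" using proper[of T] unfolding R_eq by blast
      qed
    qed
    show "?R \<subseteq> ?A \<union> ?B"
    proof
      fix X assume X: "X \<in> ?R"
      show "X \<in> ?A \<union> ?B"
      proof (cases "genr \<in> X")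
        case True
        then have "X - {genr} \<subseteq> ?V" "\<not> ?V \<subseteq> X - {genr}" "X = insert genr (X - {genr})"
          using X gens_distinct' unfolding R_eq by auto
        then have "X \<in> ?B" unfolding B_eq by blast
        then show ?thesis ..
      next
        case False
        then have "X \<in> ?A" using X gens_distinct' unfolding R_eq by auto
        then show ?thesis ..
      qed
    qed
  qed
  moreover have "star_subdivision ((\<lambda>T. convex_cone hull T) ` ?K) (ray genr) =
    (\<lambda>T. convex_cone hull T) ` ({T \<in> ?K. \<not> ?V \<subseteq> T} \<union>
      {insert genr T | T U. U \<in> ?K \<and> ?V \<subseteq> U \<and> T \<subseteq> U \<and> \<not> ?V \<subseteq> T})"
  proof (rule star_subdivision_complex)
    show "independent T" if "T \<in> ?K" for T
      using that independent_mono[OF indepC] independent_mono[OF independent_p23] by blast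
  qed (use V in auto)
  ultimately show ?thesis by simp
qed

end

theorem theorem3p1:
  fixes q :: nat
  assumes "primepow q" and "CARD('k::{field,finite}) = q"
  shows "let \<Sigma>min = star_subdivision
             (star_subdivision (cone_faces (sigma_M q)) (ray (vector [real q ^ 2 + 1, -1, - real q])))
             (ray (vector [1, 0, 0]))
         in minimal_terminal_model TYPE('k) (sigma_M q) \<Sigma>min \<and>
            (\<forall>\<Sigma>. minimal_terminal_model TYPE('k) (sigma_M q) \<Sigma> \<longrightarrow> \<Sigma> = \<Sigma>min)"
proof -
  have q: "2 \<le> q" using primepow_gt_Suc_0[OF assms(1)] by simp
  interpret regular_triangulation "{gen1 q, gen2, gen3}" "facets q" "support_form q"
      "real q * (real q ^ 2 + 1)"
    by (rule facets_regular[OF q])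
  have \<sigma>: "sigma_M q = convex_cone hull {gen1 q, gen2, gen3}"
    by (simp add: sigma_M_def gen_defs)
  have \<Sigma>min: "star_subdivision
      (star_subdivision (cone_faces (sigma_M q)) (ray (vector [real q ^ 2 + 1, -1, - real q])))
      (ray (vector [1, 0, 0])) = fan_of"
    using star_subdivision_p[OF q] star_subdivision_r[OF q]
    by (simp add: \<sigma> fan_of_def image_UN flip: genp_def genr_def)
  show ?thesis
    unfolding Let_def \<Sigma>min unfolding \<sigma>
    by (intro conjI allI impI minimal_terminal_model_fan_of minimal_terminal_model_unique)
qed

end
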